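(* Let $b,\sigma:\mathbb{R}\to\mathbb{R}$ be such that $\sigma(y)>0$ for any $y\in\mathbb{R}$, $b$ is measurable and locally bounded, and $\sigma$ is locally Lipschitz-continuous. Assume that there is an $\mathbb{R}$-valued Itô-process $Y$ satisfying $$dY_t=b(Y(t))\,dt+\sigma(Y(t))\,dW(t),$$ where $W$ is a one-dimensional standard Brownian motion. Then $Y_t$ has a locally bounded version of its density for any $t>0$.
   Context: Let $(\Omega,\mathcal{A},(\mathcal{F}_t)_{t\ge 0},P)$ be a stochastic basis with right-continuous and complete filtration; $W$ is a standard $(\mathcal{F}_t)$-Brownian motion. An $\mathbb{R}$-valued Itô-process is a process of the form $Y(t)=y_0+\int_0^t\beta(s)\,ds+\int_0^t\varsigma(s)\,dW(s)$, $t\ge 0$, with $y_0\in\mathbb{R}$, $\beta$ progressively measurable with locally integrable paths and $\varsigma$ progressively measurable with locally square integrable paths. In particular $Y$ is defined for all times $t\ge0$ and starts at a deterministic point. Density means density with respect to Lebesgue measure. *)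

theory Defs
  imports "HOL-Probability.Probability"
begin

text \<open>
  Time is \<open>{0..}\<close> inside \<^typ>\<open>real\<close>; values of filtrations and processes at negative times are
  never constrained or used.
\<close>

definition locally_bounded :: "(real \<Rightarrow> real) \<Rightarrow> bool" where
  "locally_bounded f \<longleftrightarrow> (\<forall>x. \<exists>r>0. bounded (f ` cball x r))"

definition locally_lipschitz :: "(real \<Rightarrow> real) \<Rightarrow> bool" where
  "locally_lipschitz f \<longleftrightarrow> (\<forall>x. \<exists>r>0. \<exists>L. L-lipschitz_on (cball x r) f)"

text \<open>
  Only the underlying sigma-algebra of \<open>F t\<close> matters, not its measure. Completeness of the
  filtration: all subsets of \<open>P\<close>-null sets belong to \<open>F 0\<close>.
\<close>

locale stochastic_basis = prob_space P + complete_measure P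
  for P :: "'a measure" and F :: "real \<Rightarrow> 'a measure" +
  assumes subalgebra_F: "0 \<le> t \<Longrightarrow> subalgebra P (F t)"
    and F_mono: "0 \<le> s \<Longrightarrow> s \<le> t \<Longrightarrow> sets (F s) \<subseteq> sets (F t)"
    and F_right_continuous: "0 \<le> t \<Longrightarrow> (\<Inter>s\<in>{t<..}. sets (F s)) = sets (F t)"
    and F_complete: "null_sets P \<subseteq> sets (F 0)"

definition adapted :: "(real \<Rightarrow> 'a measure) \<Rightarrow> (real \<Rightarrow> 'a \<Rightarrow> real) \<Rightarrow> bool" where
  "adapted F X \<longleftrightarrow> (\<forall>t\<ge>0. X t \<in> borel_measurable (F t))"

definition progressively_measurable ::
    "(real \<Rightarrow> 'a measure) \<Rightarrow> (real \<Rightarrow> 'a \<Rightarrow> real) \<Rightarrow> bool" where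
  "progressively_measurable F X \<longleftrightarrow>
    (\<forall>t\<ge>0. (\<lambda>(s, \<omega>). X s \<omega>) \<in> borel_measurable (restrict_space borel {0..t} \<Otimes>\<^sub>M F t))"

definition brownian_motion ::
    "'a measure \<Rightarrow> (real \<Rightarrow> 'a measure) \<Rightarrow> (real \<Rightarrow> 'a \<Rightarrow> real) \<Rightarrow> bool" where
  "brownian_motion P F W \<longleftrightarrow>
    adapted F W \<and>
    (AE \<omega> in P. W 0 \<omega> = 0) \<and>
    (AE \<omega> in P. continuous_on {0..} (\<lambda>t. W t \<omega>)) \<and>
    (\<forall>s\<ge>0. \<forall>t>s.
      distributed P lborel (\<lambda>\<omega>. W t \<omega> - W s \<omega>) (\<lambda>x. ennreal (normal_density 0 (sqrt (t - s)) x)) \<and>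
      prob_space.indep_set P (sets (F s))
        (sets (vimage_algebra (space P) (\<lambda>\<omega>. W t \<omega> - W s \<omega>) borel)))"

text \<open>
  The simple process given by times \<open>\<tau> 0 \<le> \<dots> \<le> \<tau> n\<close> and bounded coefficients \<open>\<xi> i\<close>,
  measurable with respect to \<open>F (\<tau> i)\<close>, and its elementary stochastic integral.
\<close>

definition simple_data ::
    "(real \<Rightarrow> 'a measure) \<Rightarrow> nat \<Rightarrow> (nat \<Rightarrow> real) \<Rightarrow> (nat \<Rightarrow> 'a \<Rightarrow> real) \<Rightarrow> bool" where
  "simple_data F n \<tau> \<xi> \<longleftrightarrow>
    0 \<le> \<tau> 0 \<and>
    (\<forall>i<n. \<tau> i \<le> \<tau> (Suc i) \<and> \<xi> i \<in> borel_measurable (F (\<tau> i)) \<and> bounded (\<xi> i ` space (F (\<tau> i))))"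

definition simple_process ::
    "nat \<Rightarrow> (nat \<Rightarrow> real) \<Rightarrow> (nat \<Rightarrow> 'a \<Rightarrow> real) \<Rightarrow> real \<Rightarrow> 'a \<Rightarrow> real" where
  "simple_process n \<tau> \<xi> t \<omega> = (\<Sum>i<n. \<xi> i \<omega> * indicator {\<tau> i<..\<tau> (Suc i)} t)"

definition simple_integral ::
    "(real \<Rightarrow> 'a \<Rightarrow> real) \<Rightarrow> nat \<Rightarrow> (nat \<Rightarrow> real) \<Rightarrow> (nat \<Rightarrow> 'a \<Rightarrow> real) \<Rightarrow> real \<Rightarrow> 'a \<Rightarrow> real" where
  "simple_integral W n \<tau> \<xi> t \<omega> =
    (\<Sum>i<n. \<xi> i \<omega> * (W (min (\<tau> (Suc i)) t) \<omega> - W (min (\<tau> i) t) \<omega>))"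

text \<open>
  The measurability clause is needed because \<^const>\<open>measure\<close> is 0 on non-measurable sets.
\<close>

definition tendsto_zero_in_prob :: "'a measure \<Rightarrow> (nat \<Rightarrow> 'a \<Rightarrow> ennreal) \<Rightarrow> bool" where
  "tendsto_zero_in_prob P Z \<longleftrightarrow>
    (\<forall>k. Z k \<in> borel_measurable P) \<and>
    (\<forall>\<epsilon>>0. (\<lambda>k. measure P {\<omega> \<in> space P. Z k \<omega> > ennreal \<epsilon>}) \<longlonglongrightarrow> 0)"

text \<open>
  \<open>X\<close> is a continuous version of the It\^o integral process of \<open>\<sigma>\<close> with respect to \<open>W\<close>, i.e. the
  limit, uniformly on compact time intervals in probability, of the integrals of simple processes
  \<open>H\<^sub>k\<close> such that the integral of \<open>(H\<^sub>k - \<sigma>)\<^sup>2\<close> over each \<open>{0..T}\<close> tends to 0 in probability. For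
  progressively measurable \<open>\<sigma>\<close> with almost surely locally square integrable paths such an \<open>X\<close>
  exists, and it is unique up to indistinguishability and independent of the choice of the \<open>H\<^sub>k\<close>.
\<close>

definition ito_integral ::
    "'a measure \<Rightarrow> (real \<Rightarrow> 'a measure) \<Rightarrow> (real \<Rightarrow> 'a \<Rightarrow> real) \<Rightarrow> (real \<Rightarrow> 'a \<Rightarrow> real)
      \<Rightarrow> (real \<Rightarrow> 'a \<Rightarrow> real) \<Rightarrow> bool" where
  "ito_integral P F W \<sigma> X \<longleftrightarrow>
    adapted F X \<and>
    (AE \<omega> in P. continuous_on {0..} (\<lambda>t. X t \<omega>)) \<and>
    (\<exists>n \<tau> \<xi>. (\<forall>k. simple_data F (n k) (\<tau> k) (\<xi> k)) \<and>
      (\<forall>T\<ge>0.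
        tendsto_zero_in_prob P
          (\<lambda>k \<omega>. \<integral>\<^sup>+s\<in>{0..T}. ennreal ((simple_process (n k) (\<tau> k) (\<xi> k) s \<omega> - \<sigma> s \<omega>)\<^sup>2) \<partial>lborel) \<and>
        tendsto_zero_in_prob P
          (\<lambda>k \<omega>. SUP t\<in>{0..T}. ennreal \<bar>simple_integral W (n k) (\<tau> k) (\<xi> k) t \<omega> - X t \<omega>\<bar>)))"

text \<open>
  \<open>Y\<close> is the It\^o process with deterministic initial value \<open>y0\<close>, drift \<open>\<beta>\<close> and diffusion
  coefficient \<open>\<sigma>\<close>; path properties and the defining identity are required almost surely.
\<close>

definition ito_process ::
    "'a measure \<Rightarrow> (real \<Rightarrow> 'a measure) \<Rightarrow> (real \<Rightarrow> 'a \<Rightarrow> real) \<Rightarrow> real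
      \<Rightarrow> (real \<Rightarrow> 'a \<Rightarrow> real) \<Rightarrow> (real \<Rightarrow> 'a \<Rightarrow> real) \<Rightarrow> (real \<Rightarrow> 'a \<Rightarrow> real) \<Rightarrow> bool" where
  "ito_process P F W y0 \<beta> \<sigma> Y \<longleftrightarrow>
    progressively_measurable F \<beta> \<and>
    (AE \<omega> in P. \<forall>t\<ge>0. set_integrable lborel {0..t} (\<lambda>s. \<beta> s \<omega>)) \<and>
    progressively_measurable F \<sigma> \<and>
    (AE \<omega> in P. \<forall>t\<ge>0. set_integrable lborel {0..t} (\<lambda>s. (\<sigma> s \<omega>)\<^sup>2)) \<and>
    (\<exists>X. ito_integral P F W \<sigma> X \<and>
      (AE \<omega> in P. \<forall>t\<ge>0. Y t \<omega> = y0 + (LINT s:{0..t}|lborel. \<beta> s \<omega>) + X t \<omega>))"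

end

(*
  The Gaussian kernel with variance \<epsilon> + \<sigma>(x)^2 (t - s) solves the backward heat equation with the
  diffusion coefficient frozen at x. Applied to this kernel (times a cutoff), the generator of Y has
  size v^(-1/2) times a Gaussian kernel of variance 2 v, where v is the variance at time s: the drift
  costs one derivative, and the second-order error carries the factor \<sigma>(y)^2 - \<sigma>(x)^2 = O(|y - x|),
  which regains one of the two derivatives. Hence if the law of Y_s near x, smoothed at scale
  sqrt \<epsilon>, is O(\<epsilon>^(-a)), then integrating over s improves the bound to O(\<epsilon>^(1/4 - a)) on a smaller
  interval. The trivial bound a = 1/2 improves twice to a = 0, that is P(Y_t in I) <= C |I| for
  intervals I in a compact set.

  It\^o's formula is only needed as an inequality for expectations. It is obtained from the simple
  integrands defining the stochastic integral by a second-order Taylor expansion on a fine grid,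
  weighted by a decreasing function of the clock \<integral> |\<beta>| + H^2 ds, which keeps the sums bounded.
*)

theory Submission
  imports Defs
begin

section \<open>Gaussian kernels and the test function\<close>

text \<open>The gain of 1/4 per round is dictated by an integral. From the bound v^(-a) the
  generator produces v^(-1/2 - a); for a = 1/2 this is v^(-1), whose time integral diverges
  logarithmically as \<epsilon> tends to 0, so the full power 1/2 cannot be won at once. Writing
  v^(-1/2 - a) = v^(-(a - 1/4)) v^(-3/4) and using v \<ge> \<epsilon> in the first factor leaves a
  factor that is integrable uniformly in \<epsilon>. Each round costs time, because the kernel must
  have a variance bounded below at the initial time, and space, because the coefficients are
  controlled on compact sets only and the cutoff loses a margin. Two obstacles shape the stochastic
  part. The Ito integral is a limit in probability of simple integrals without common bounds;
  expectations are therefore compared for one simple process at a time, and only uniformly bounded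
  quantities are carried to the limit. Also, \<open>Y\<close> is not given as a jointly measurable
  process, so Fubini needs a version built from path continuity. Taylor constants may depend on
  \<epsilon> and on the simple process; the generator bound may not.\<close>

text \<open>
  The kernel omits the factor \<open>1 / sqrt (2 \<pi>)\<close>; the recursion is that of the Hermite polynomials.
\<close>

fun gauss_deriv :: "nat \<Rightarrow> real \<Rightarrow> real \<Rightarrow> real" where
  "gauss_deriv 0 v u = exp (- (u\<^sup>2) / (2 * v)) / sqrt v"
| "gauss_deriv (Suc 0) v u = - (u / v) * gauss_deriv 0 v u"
| "gauss_deriv (Suc (Suc n)) v u = - (u * gauss_deriv (Suc n) v u + (real n + 1) * gauss_deriv n v u) / v"

text \<open>Differentiating the factor \<open>u\<close> of the recursion yields one more copy of the
  derivative of order \<open>Suc n\<close>, which raises the coefficient from n + 1 to n + 2: the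
  recursion one index higher.\<close>

lemma gauss_deriv_has_derivative_u:
  assumes "v > 0"
  shows "(gauss_deriv n v has_real_derivative gauss_deriv (Suc n) v u) (at u)"
  using assms
proof (induction n v u rule: gauss_deriv.induct)
  case (1 v u)
  have "((\<lambda>u. exp (- (u\<^sup>2) / (2 * v)) / sqrt v) has_real_derivative gauss_deriv (Suc 0) v u) (at u)"
    using 1 by (auto intro!: derivative_eq_intros simp: field_simps)
  then show ?case by (simp add: fun_eq_iff)
next
  case (2 v u)
  have "((\<lambda>u. - (u / v) * gauss_deriv 0 v u) has_real_derivative gauss_deriv (Suc (Suc 0)) v u) (at u)"
    using 2 by (auto intro!: derivative_eq_intros 2 simp del: gauss_deriv.simps(1) simp: field_simps)
  then show ?case by simp
next
  case (3 n v u)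
  have "((\<lambda>u. - (u * gauss_deriv (Suc n) v u + (real n + 1) * gauss_deriv n v u) / v)
      has_real_derivative - (gauss_deriv (Suc n) v u + u * gauss_deriv (Suc (Suc n)) v u
         + (real n + 1) * gauss_deriv (Suc n) v u) / v) (at u)"
    using 3(3) by (auto intro!: derivative_eq_intros 3 simp del: gauss_deriv.simps)
  also have "- (gauss_deriv (Suc n) v u + u * gauss_deriv (Suc (Suc n)) v u
         + (real n + 1) * gauss_deriv (Suc n) v u) / v = gauss_deriv (Suc (Suc (Suc n))) v u"
    unfolding gauss_deriv.simps(3)[of "Suc n"] by (simp del: gauss_deriv.simps add: algebra_simps)
  finally show ?case by simp
qed

text \<open>The heat equation, for all derivatives of the kernel at once. In the recursive case the
  derivative of 1 / v supplies the missing 2 in the coefficient n + 3 of the recursion two indices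
  higher.\<close>

lemma gauss_deriv_has_derivative_v:
  assumes "v > 0"
  shows "((\<lambda>v. gauss_deriv n v u) has_real_derivative gauss_deriv (Suc (Suc n)) v u / 2) (at v)"
  using assms
proof (induction n v u rule: gauss_deriv.induct)
  case (1 v u)
  have "((\<lambda>v. exp (- (u\<^sup>2) / (2 * v)) / sqrt v) has_real_derivative
      (exp (- (u\<^sup>2) / (2 * v)) * (u\<^sup>2 / (2 * v\<^sup>2)) * sqrt v
        - exp (- (u\<^sup>2) / (2 * v)) * (inverse (sqrt v) / 2)) / (sqrt v * sqrt v)) (at v)"
    using 1 by (auto intro!: derivative_eq_intros simp: power2_eq_square)
  also have "(exp (- (u\<^sup>2) / (2 * v)) * (u\<^sup>2 / (2 * v\<^sup>2)) * sqrt v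
        - exp (- (u\<^sup>2) / (2 * v)) * (inverse (sqrt v) / 2)) / (sqrt v * sqrt v)
      = gauss_deriv (Suc (Suc 0)) v u / 2"
    using 1 by (simp add: field_simps power2_eq_square)
  finally show ?case by simp
next
  case (2 v u)
  have "((\<lambda>v. - (u / v) * gauss_deriv 0 v u) has_real_derivative
       (u / v\<^sup>2) * gauss_deriv 0 v u + - (u / v) * (gauss_deriv (Suc (Suc 0)) v u / 2)) (at v)"
    using 2(2) by (auto intro!: derivative_eq_intros 2 simp del: gauss_deriv.simps simp: field_simps power2_eq_square)
  also have "(u / v\<^sup>2) * gauss_deriv 0 v u + - (u / v) * (gauss_deriv (Suc (Suc 0)) v u / 2)
     = gauss_deriv (Suc (Suc (Suc 0))) v u / 2"
    using 2(2) by (simp del: gauss_deriv.simps(1) add: field_simps power2_eq_square)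
  finally show ?case by simp
next
  case (3 n v u)
  define a b where "a = gauss_deriv n v u" and "b = gauss_deriv (Suc n) v u"
  have "((\<lambda>v. - (u * gauss_deriv (Suc n) v u + (real n + 1) * gauss_deriv n v u) / v)
      has_real_derivative (u * b + (real n + 1) * a) / v\<^sup>2
        - (u * (gauss_deriv (Suc (Suc (Suc n))) v u / 2) + (real n + 1) * (gauss_deriv (Suc (Suc n)) v u / 2)) / v) (at v)"
    unfolding a_def b_def using 3(3)
    by (auto intro!: derivative_eq_intros 3 simp del: gauss_deriv.simps simp: field_simps power2_eq_square)
  \<comment> \<open>The recursion read backwards, so that only derivatives of the kernel
    remain.\<close>
  also have "(u * b + (real n + 1) * a) / v\<^sup>2 = - gauss_deriv (Suc (Suc n)) v u / v"
    unfolding a_def b_def gauss_deriv.simps(3) minus_divide_left[symmetric] minus_minus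
    by (simp add: power2_eq_square)
  also have "- gauss_deriv (Suc (Suc n)) v u / v
        - (u * (gauss_deriv (Suc (Suc (Suc n))) v u / 2) + (real n + 1) * (gauss_deriv (Suc (Suc n)) v u / 2)) / v
      = gauss_deriv (Suc (Suc (Suc (Suc n)))) v u / 2"
    unfolding gauss_deriv.simps(3)[of "Suc (Suc n)"]
    using 3(3) by (simp del: gauss_deriv.simps add: field_simps)
  finally show ?case by simp
qed

lemma continuous_on_gauss_deriv:
  assumes "continuous_on S f" "continuous_on S g" "\<And>z. z \<in> S \<Longrightarrow> f z > 0"
  shows "continuous_on S (\<lambda>z. gauss_deriv n (f z) (g z))"
proof -
  have "\<forall>z\<in>S. f z \<noteq> 0" "\<forall>z\<in>S. sqrt (f z) \<noteq> 0" using assms(3) by force+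
  then show ?thesis
    using assms
    by (induction n rule: induct_nat_012)
      (simp, intro continuous_intros ballI; (auto; fail))+
qed

lemma gauss_nonneg: "v > 0 \<Longrightarrow> gauss_deriv 0 v u \<ge> 0"
  by simp

lemma gauss_le: "v > 0 \<Longrightarrow> gauss_deriv 0 v u \<le> v powr (-1/2)"
  by (simp add: powr_minus_divide powr_half_sqrt divide_right_mono)

text \<open>Used to absorb polynomial factors by doubling the variance, which turns exp (-w/2) into
  exp (-w/4). The factor 32 makes the quadratic Taylor coefficient of exp (w/4) equal to 1.\<close>

lemma poly_le_exp:
  fixes w :: real assumes "w \<ge> 0" shows "(1 + w)\<^sup>2 \<le> 32 * exp (w / 4)"
proof -
  have "(1 + w)\<^sup>2 \<le> 32 * (1 + w / 4 + (w / 4)\<^sup>2 / 2)"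
    using assms by (simp add: power2_eq_square algebra_simps)
  also have "\<dots> \<le> 32 * exp (w / 4)"
    using exp_lower_Taylor_quadratic[of "w / 4"] assms by (intro mult_left_mono) auto
  finally show ?thesis .
qed

text \<open>In terms of \<open>w = u\<^sup>2 / v\<close> each expression is a power of v times the
  kernel times a function of w that is at most (1 + w)^2. Two derivatives cost 1 / v, of which the
  factor \<open>u\<close> gives back one square root. The constant 46 exceeds 32 sqrt 2, where sqrt
  2 compares the prefactors of variance v and 2 v.\<close>

lemma gauss_deriv_bounds:
  assumes v: "v > 0"
  shows "gauss_deriv 0 v u \<le> 46 * gauss_deriv 0 (2 * v) u"
    and "\<bar>gauss_deriv 1 v u\<bar> \<le> 46 * v powr (-1/2) * gauss_deriv 0 (2 * v) u"
    and "\<bar>u * gauss_deriv 2 v u\<bar> \<le> 46 * v powr (-1/2) * gauss_deriv 0 (2 * v) u"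
proof -
  define w where "w = u\<^sup>2 / v"
  define G where "G = gauss_deriv 0 v u"
  define r where "r = v powr (-1/2)"
  have w0: "w \<ge> 0" using v by (simp add: w_def)
  have G0: "G \<ge> 0" unfolding G_def using v by (rule gauss_nonneg)
  have r: "r > 0" "\<bar>u\<bar> / v = r * sqrt w"
    using v by (auto simp: r_def w_def powr_minus_divide powr_half_sqrt real_sqrt_divide field_simps)
  have e: "exp (w / 4) * G = sqrt 2 * gauss_deriv 0 (2 * v) u"
  proof -
    have "exp (w / 4) * exp (- (u\<^sup>2) / (2 * v)) = exp (- (u\<^sup>2) / (2 * (2 * v)))"
      unfolding exp_add[symmetric] w_def using v by (simp add: field_simps)
    then show ?thesis
      unfolding G_def using v by (simp add: real_sqrt_mult field_simps)
  qed
  have s2: "32 * sqrt 2 \<le> (46::real)"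
  proof -
    have "sqrt 2 \<le> (46 / 32 :: real)" by (rule real_le_lsqrt) (auto simp: power2_eq_square)
    then show ?thesis by simp
  qed
  have main: "(1 + w)\<^sup>2 * G \<le> 46 * gauss_deriv 0 (2 * v) u"
  proof -
    have "(1 + w)\<^sup>2 * G \<le> 32 * exp (w / 4) * G"
      using poly_le_exp[OF w0] G0 by (intro mult_right_mono)
    also have "\<dots> = 32 * sqrt 2 * gauss_deriv 0 (2 * v) u" using e by simp
    also have "\<dots> \<le> 46 * gauss_deriv 0 (2 * v) u"
      using s2 gauss_nonneg[of "2 * v" u] v by (intro mult_right_mono) auto
    finally show ?thesis .
  qed
  have sw: "sqrt w \<le> 1 + w"
    by (rule real_le_lsqrt) (use w0 in \<open>auto simp: power2_eq_square algebra_simps\<close>)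
  have "1 * G \<le> (1 + w)\<^sup>2 * G" using w0 G0 by (intro mult_right_mono) (auto simp: one_le_power)
  then show "gauss_deriv 0 v u \<le> 46 * gauss_deriv 0 (2 * v) u" using main G_def by simp
  have "\<bar>gauss_deriv 1 v u\<bar> = r * (sqrt w * G)"
  proof -
    have "gauss_deriv 1 v u = - (u / v) * G" unfolding G_def by simp
    then have "\<bar>gauss_deriv 1 v u\<bar> = \<bar>u\<bar> / v * G" using G0 v by (simp add: abs_mult)
    then show ?thesis using r by simp
  qed
  also have "\<dots> \<le> r * ((1 + w)\<^sup>2 * G)"
  proof -
    have "sqrt w \<le> (1 + w)\<^sup>2" using sw w0 by (smt (verit) one_le_power self_le_power zero_less_numeral)
    then show ?thesis using r G0 by (intro mult_left_mono mult_right_mono) auto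
  qed
  also have "\<dots> \<le> r * (46 * gauss_deriv 0 (2 * v) u)" using main r by (intro mult_left_mono) auto
  finally show "\<bar>gauss_deriv 1 v u\<bar> \<le> 46 * v powr (-1/2) * gauss_deriv 0 (2 * v) u"
    by (simp add: r_def mult_ac del: gauss_deriv.simps)
  have "\<bar>u * gauss_deriv 2 v u\<bar> = \<bar>u\<bar> / v * (\<bar>w - 1\<bar> * G)"
  proof -
    have "gauss_deriv 2 v u = (w - 1) / v * G"
      unfolding G_def w_def numeral_2_eq_2 using v by (simp add: field_simps power2_eq_square)
    then show ?thesis using G0 v by (simp add: abs_mult)
  qed
  also have "\<dots> = r * (sqrt w * \<bar>w - 1\<bar> * G)" using r by simp
  also have "\<dots> \<le> r * ((1 + w)\<^sup>2 * G)"
  proof -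
    have "sqrt w * \<bar>w - 1\<bar> \<le> (1 + w) * (1 + w)" using sw w0 by (intro mult_mono) auto
    then show ?thesis using r G0 by (intro mult_left_mono mult_right_mono) (auto simp: power2_eq_square)
  qed
  also have "\<dots> \<le> r * (46 * gauss_deriv 0 (2 * v) u)" using main r by (intro mult_left_mono) auto
  finally show "\<bar>u * gauss_deriv 2 v u\<bar> \<le> 46 * v powr (-1/2) * gauss_deriv 0 (2 * v) u"
    by (simp add: r_def mult_ac del: gauss_deriv.simps)
qed

section \<open>Polynomial cutoffs supported in [-R, R]\<close>

definition bump :: "real \<Rightarrow> nat \<Rightarrow> real \<Rightarrow> real" where
  "bump R n y = (max 0 (R\<^sup>2 - y\<^sup>2)) ^ n"

text \<open>Away from 0 the function agrees locally with 0 or with a monomial. At 0 the difference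
  quotient is a positive power of \<open>max 0 h\<close>, because the exponent is at least
  2.\<close>

lemma max0_power_has_derivative:
  fixes w :: real
  shows "((\<lambda>w. max 0 w ^ Suc (Suc n)) has_real_derivative (real n + 2) * max 0 w ^ Suc n) (at w)"
proof (cases w "0 :: real" rule: linorder_cases)
  case less
  have "((\<lambda>w. 0) has_real_derivative 0) (at w)" by simp
  then show ?thesis
  proof (rule DERIV_cong[OF DERIV_cong_ev[THEN iffD1, rotated -1]])
    show "\<forall>\<^sub>F x in nhds w. 0 = max 0 x ^ Suc (Suc n)"
      using eventually_nhds_in_open[of "{..<0}" w] less by (auto elim!: eventually_mono)
  qed (use less in auto)
next
  case greater
  have "((\<lambda>w. w ^ Suc (Suc n)) has_real_derivative (real n + 2) * w ^ Suc n) (at w)"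
    using DERIV_pow[of "Suc (Suc n)" w] by (simp add: add.commute)
  then show ?thesis
  proof (rule DERIV_cong[OF DERIV_cong_ev[THEN iffD1, rotated -1]])
    show "\<forall>\<^sub>F x in nhds w. x ^ Suc (Suc n) = max 0 x ^ Suc (Suc n)"
      using eventually_nhds_in_open[of "{0<..}" w] greater by (auto elim!: eventually_mono)
  qed (use greater in auto)
next
  case equal
  have "((\<lambda>h. max 0 h * max 0 h ^ n) \<longlongrightarrow> max 0 0 * max 0 0 ^ n) (at (0::real))"
    by (intro tendsto_intros)
  then have *: "((\<lambda>h. max 0 h ^ Suc n) \<longlongrightarrow> 0) (at (0::real))" by simp
  have "((\<lambda>h::real. (max 0 h ^ Suc (Suc n) - 0) / h) \<longlongrightarrow> 0) (at 0)"
  proof (rule Lim_transform_eventually[OF *])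
    show "\<forall>\<^sub>F h in at (0::real). max 0 h ^ Suc n = (max 0 h ^ Suc (Suc n) - 0) / h"
      unfolding eventually_at by (intro exI[of _ 1]) (auto simp: max_def)
  qed
  then show ?thesis unfolding equal by (simp add: DERIV_def)
qed

lemma bump_has_derivative:
  "(bump R (Suc (Suc n)) has_real_derivative - 2 * (real n + 2) * y * bump R (Suc n) y) (at y)"
proof -
  have "((\<lambda>y. max 0 (R\<^sup>2 - y\<^sup>2) ^ Suc (Suc n)) has_real_derivative
      ((real n + 2) * max 0 (R\<^sup>2 - y\<^sup>2) ^ Suc n) * (- 2 * y)) (at y)"
    by (rule DERIV_chain2[OF max0_power_has_derivative]) (auto intro!: derivative_eq_intros)
  then have "(bump R (Suc (Suc n)) has_real_derivative
      ((real n + 2) * bump R (Suc n) y) * (- 2 * y)) (at y)"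
    unfolding bump_def[abs_def] .
  also have "((real n + 2) * bump R (Suc n) y) * (- 2 * y) = - 2 * (real n + 2) * y * bump R (Suc n) y"
    by (simp only: mult_ac)
  finally show ?thesis .
qed

lemma bump_nonneg: "bump R n y \<ge> 0"
  by (simp add: bump_def)

text \<open>\<open>n > 0\<close> matters: since 0 ^ 0 = 1, \<open>bump R 0\<close> is constantly
  1.\<close>

lemma bump_zero: "R \<ge> 0 \<Longrightarrow> \<bar>y\<bar> \<ge> R \<Longrightarrow> n > 0 \<Longrightarrow> bump R n y = 0"
  using power_mono[of R "\<bar>y\<bar>" 2] by (simp add: bump_def max_def)

lemma bump_le: "bump R n y \<le> (R\<^sup>2) ^ n"
  unfolding bump_def by (intro power_mono) auto

lemma bump_ge: "\<bar>y\<bar> \<le> R' \<Longrightarrow> R' \<le> R \<Longrightarrow> (R\<^sup>2 - R'\<^sup>2) ^ n \<le> bump R n y"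
  unfolding bump_def using power_mono[of "\<bar>y\<bar>" R' 2] power_mono[of R' R 2]
  by (intro power_mono) auto

lemma continuous_on_bump [continuous_intros]:
  "continuous_on S f \<Longrightarrow> continuous_on S (\<lambda>z. bump R n (f z))"
  unfolding bump_def by (intro continuous_intros)

text \<open>
  The exponent 4 makes the cutoff three times continuously differentiable.
\<close>

definition test_fun :: "real \<Rightarrow> real \<Rightarrow> real \<Rightarrow> real \<Rightarrow> real \<Rightarrow> real \<Rightarrow> real \<Rightarrow> real" where
  "test_fun R c e T x s y = bump R 4 y * gauss_deriv 0 (e + c * (T - s)) (y - x)"

text \<open>The time derivative expressed through the heat equation: the variance decreases at rate
  c, and a derivative in the variance is half of a second space derivative.\<close>

definition test_fun_s :: "real \<Rightarrow> real \<Rightarrow> real \<Rightarrow> real \<Rightarrow> real \<Rightarrow> real \<Rightarrow> real \<Rightarrow> real" where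
  "test_fun_s R c e T x s y = - (c / 2) * (bump R 4 y * gauss_deriv 2 (e + c * (T - s)) (y - x))"

definition test_fun_y :: "real \<Rightarrow> real \<Rightarrow> real \<Rightarrow> real \<Rightarrow> real \<Rightarrow> real \<Rightarrow> real \<Rightarrow> real" where
  "test_fun_y R c e T x s y = - 8 * y * bump R 3 y * gauss_deriv 0 (e + c * (T - s)) (y - x)
     + bump R 4 y * gauss_deriv 1 (e + c * (T - s)) (y - x)"

text \<open>The product rule for cutoff times kernel; the coefficients with 8 and 48 are the first
  two derivatives of \<open>bump R 4\<close>.\<close>

definition test_fun_yy :: "real \<Rightarrow> real \<Rightarrow> real \<Rightarrow> real \<Rightarrow> real \<Rightarrow> real \<Rightarrow> real \<Rightarrow> real" where
  "test_fun_yy R c e T x s y =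
     (48 * y\<^sup>2 * bump R 2 y - 8 * bump R 3 y) * gauss_deriv 0 (e + c * (T - s)) (y - x)
     + 2 * (- 8 * y * bump R 3 y) * gauss_deriv 1 (e + c * (T - s)) (y - x)
     + bump R 4 y * gauss_deriv 2 (e + c * (T - s)) (y - x)"

text \<open>
  \<open>hs\<close>, \<open>hy\<close> and \<open>hyy\<close> play the role of derivatives of \<open>h\<close>, but only the Taylor bound is needed.
\<close>

locale test_function =
  fixes t0 t1 M C :: real and h hs hy hyy :: "real \<Rightarrow> real \<Rightarrow> real"
  assumes times: "0 \<le> t0" "t0 < t1"
    and M_pos: "M \<ge> 0" and C_pos: "C \<ge> 0"
    and h_nonneg: "\<And>s y. t0 \<le> s \<Longrightarrow> s \<le> t1 \<Longrightarrow> 0 \<le> h s y"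
    and h_bound: "\<And>s y. t0 \<le> s \<Longrightarrow> s \<le> t1 \<Longrightarrow> h s y \<le> M"
    and hs_bound: "\<And>s y. t0 \<le> s \<Longrightarrow> s \<le> t1 \<Longrightarrow> \<bar>hs s y\<bar> \<le> M"
    and hy_bound: "\<And>s y. t0 \<le> s \<Longrightarrow> s \<le> t1 \<Longrightarrow> \<bar>hy s y\<bar> \<le> M"
    and hyy_bound: "\<And>s y. t0 \<le> s \<Longrightarrow> s \<le> t1 \<Longrightarrow> \<bar>hyy s y\<bar> \<le> M"
    and h_cont: "continuous_on ({t0..t1} \<times> UNIV) (\<lambda>(s, y). h s y)"
    and hs_cont: "continuous_on ({t0..t1} \<times> UNIV) (\<lambda>(s, y). hs s y)"
    and hy_cont: "continuous_on ({t0..t1} \<times> UNIV) (\<lambda>(s, y). hy s y)"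
    and hyy_cont: "continuous_on ({t0..t1} \<times> UNIV) (\<lambda>(s, y). hyy s y)"
    and taylor: "\<And>u v y d. t0 \<le> u \<Longrightarrow> u \<le> v \<Longrightarrow> v \<le> t1 \<Longrightarrow>
      \<bar>h v (y + d) - h u y - hs u y * (v - u) - hy u y * d - hyy u y * d\<^sup>2 / 2\<bar>
        \<le> C * ((v - u)\<^sup>2 + (v - u) * \<bar>d\<bar> + \<bar>d\<bar> ^ 3)"

text \<open>Compactness: the variance stays above \<open>e\<close> on the time interval and the
  cutoff confines y. The bound depends on \<open>e\<close>, which is harmless, since it only enters
  the constants of \<open>test_function\<close> and never the final estimate.\<close>

lemma cutoff_gauss_bounded:
  fixes \<psi> :: "real \<Rightarrow> real"
  assumes cont: "continuous_on UNIV \<psi>" and zero: "\<And>y. \<bar>y\<bar> \<ge> R \<Longrightarrow> \<psi> y = 0"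
    and e: "e > 0" and c: "c \<ge> 0"
  obtains M where "M \<ge> 0" "\<And>s y. t0 \<le> s \<Longrightarrow> s \<le> T \<Longrightarrow> \<bar>\<psi> y * gauss_deriv n (e + c * (T - s)) (y - x)\<bar> \<le> M"
proof -
  let ?f = "\<lambda>z. \<psi> (snd z) * gauss_deriv n (e + c * (T - fst z)) (snd z - x)"
  have "continuous_on ({t0..T} \<times> {-R..R}) ?f"
    by (intro continuous_intros continuous_on_gauss_deriv continuous_on_compose2[OF cont])
      (use e c in \<open>auto intro!: add_pos_nonneg\<close>)
  then have "compact (?f ` ({t0..T} \<times> {-R..R}))"
    by (rule compact_continuous_image) (intro compact_Times compact_Icc)
  then have "bounded (?f ` ({t0..T} \<times> {-R..R}))" by (rule compact_imp_bounded)
  then obtain M where *: "\<And>w. w \<in> ?f ` ({t0..T} \<times> {-R..R}) \<Longrightarrow> norm w \<le> M"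
    by (auto simp only: bounded_iff)
  have M: "\<bar>?f z\<bar> \<le> M" if "z \<in> {t0..T} \<times> {-R..R}" for z
    using *[OF imageI[OF that]] by (simp only: real_norm_def)
  show thesis
  proof (rule that[of "max M 0"])
    fix s y assume s: "t0 \<le> s" "s \<le> T"
    show "\<bar>\<psi> y * gauss_deriv n (e + c * (T - s)) (y - x)\<bar> \<le> max M 0"
    proof (cases "\<bar>y\<bar> \<ge> R")
      case False
      then have "(s, y) \<in> {t0..T} \<times> {-R..R}" using s by auto
      from M[OF this] show ?thesis by (simp del: gauss_deriv.simps)
    qed (simp add: zero)
  qed simp
qed

lemma taylor2:
  fixes f f1 f2 f3 :: "real \<Rightarrow> real"
  assumes "\<And>y. (f has_real_derivative f1 y) (at y)"
    and "\<And>y. (f1 has_real_derivative f2 y) (at y)"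
    and "\<And>y. (f2 has_real_derivative f3 y) (at y)"
    and "\<And>y. \<bar>f3 y\<bar> \<le> B"
  shows "\<bar>f (y + d) - f y - f1 y * d - f2 y * d\<^sup>2 / 2\<bar> \<le> B * \<bar>d\<bar> ^ 3"
proof -
  define F where "F = (\<lambda>i::nat. if i = 0 then f else if i = 1 then f1 else if i = 2 then f2 else f3)"
  have "norm (F 0 (y + d) - (\<Sum>i\<le>2. F i y * ((y + d) - y) ^ i / fact i)) \<le> B * norm ((y + d) - y) ^ Suc 2 / fact 2"
  proof (rule field_Taylor[of UNIV])
    fix i :: nat and x :: real assume "i \<le> 2"
    then consider "i = 0" | "i = 1" | "i = 2" by linarith
    then show "(F i has_field_derivative F (Suc i) x) (at x within UNIV)"
      by cases (auto simp: F_def assms)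
  qed (auto simp: F_def assms)
  then have "\<bar>f (y + d) - f y - f1 y * d - f2 y * d\<^sup>2 / 2\<bar> \<le> B * \<bar>d\<bar> ^ 3 / 2"
    by (simp add: F_def numeral_2_eq_2 numeral_3_eq_3 diff_diff_eq add.assoc)
  also have "\<dots> \<le> B * \<bar>d\<bar> ^ 3"
    using order.trans[OF abs_ge_zero assms(4)[of y]] by simp
  finally show ?thesis .
qed

lemma taylor1_interval:
  fixes f f1 f2 :: "real \<Rightarrow> real"
  assumes "\<And>s. a \<le> s \<Longrightarrow> s \<le> b \<Longrightarrow> (f has_real_derivative f1 s) (at s)"
    and "\<And>s. a \<le> s \<Longrightarrow> s \<le> b \<Longrightarrow> (f1 has_real_derivative f2 s) (at s)"
    and "\<And>s. a \<le> s \<Longrightarrow> s \<le> b \<Longrightarrow> \<bar>f2 s\<bar> \<le> B"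
    and "a \<le> u" "u \<le> v" "v \<le> b"
  shows "\<bar>f v - f u - f1 u * (v - u)\<bar> \<le> B * (v - u)\<^sup>2"
proof -
  define F where "F = (\<lambda>i::nat. if i = 0 then f else if i = 1 then f1 else f2)"
  have "norm (F 0 v - (\<Sum>i\<le>1. F i u * (v - u) ^ i / fact i)) \<le> B * norm (v - u) ^ Suc 1 / fact 1"
  proof (rule field_Taylor[of "{a..b}"])
    fix i :: nat and x :: real assume "i \<le> 1" "x \<in> {a..b}"
    then consider "i = 0" | "i = 1" by linarith
    then show "(F i has_field_derivative F (Suc i) x) (at x within {a..b})"
      using has_field_derivative_at_within[OF assms(1)[of x]] has_field_derivative_at_within[OF assms(2)[of x]]
        \<open>x \<in> {a..b}\<close> by cases (simp_all add: F_def)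
  next
    show "norm (F (Suc 1) s) \<le> B" if "s \<in> {a..b}" for s using assms(3)[of s] that by (simp add: F_def)
    show "u \<in> {a..b}" "v \<in> {a..b}" using assms(4-6) by auto
  qed simp
  then show ?thesis by (simp add: F_def power2_eq_square diff_diff_eq)
qed

text \<open>The cutoff and the kernel with variance at least \<open>e\<close> have bounded
  derivatives up to second order in time, third order in space and mixed order. The Taylor remainder
  is split into a move in time at y + d, a move in space at the initial time, and the change of the
  time derivative between y + d and y.\<close>

lemma test_fun_regular:
  fixes c e t0 T x R :: real
  assumes "0 \<le> t0" "t0 < T" "e > 0" "c \<ge> 0" "R > 0"
  obtains M C where "test_function t0 T M C (test_fun R c e T x) (test_fun_s R c e T x) (test_fun_y R c e T x) (test_fun_yy R c e T x)"
proof -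
  note [simp del] = gauss_deriv.simps
  let ?v = "\<lambda>s. e + c * (T - s)"
  have v: "?v s > 0" if "s \<le> T" for s using assms that by (intro add_pos_nonneg) auto
  have bz: "bump R n y = 0" if "\<bar>y\<bar> \<ge> R" "n > 0" for n y using bump_zero that assms by simp
  have b4: "(bump R 4 has_real_derivative - 8 * y * bump R 3 y) (at y)" for y
    using bump_has_derivative[of R 2 y] by (simp add: eval_nat_numeral)
  have b3: "(bump R 3 has_real_derivative - 6 * y * bump R 2 y) (at y)" for y
    using bump_has_derivative[of R 1 y] by (simp add: eval_nat_numeral)
  have b2: "(bump R 2 has_real_derivative - 4 * y * bump R 1 y) (at y)" for y
    using bump_has_derivative[of R 0 y] by (simp add: eval_nat_numeral)
  have gu: "((\<lambda>y. gauss_deriv n w (y - x)) has_real_derivative gauss_deriv (Suc n) w (y - x)) (at y)"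
    if "w > 0" for n w y
  proof -
    have "((\<lambda>y. y - x) has_real_derivative 1) (at y)" by (auto intro!: derivative_eq_intros)
    from DERIV_chain2[OF gauss_deriv_has_derivative_u[OF that, where n = n] this] show ?thesis by simp
  qed
  have gs: "((\<lambda>s. gauss_deriv n (?v s) u) has_real_derivative - (c / 2) * gauss_deriv (Suc (Suc n)) (?v s) u) (at s)"
    if "s \<le> T" for n u s
  proof -
    have "(?v has_real_derivative - c) (at s)" by (auto intro!: derivative_eq_intros)
    from DERIV_chain2[OF gauss_deriv_has_derivative_v[OF v[OF that], where n = n and u = u] this]
    show ?thesis by (rule DERIV_cong) (simp add: field_simps)
  qed
  obtain M0 where M0: "M0 \<ge> 0" "\<And>s y. t0 \<le> s \<Longrightarrow> s \<le> T \<Longrightarrow> \<bar>bump R 4 y * gauss_deriv 0 (?v s) (y - x)\<bar> \<le> M0"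
    by (rule cutoff_gauss_bounded[of "bump R 4" R e c]) (use assms bz in \<open>auto intro!: continuous_intros\<close>)
  obtain M1 where M1: "M1 \<ge> 0" "\<And>s y. t0 \<le> s \<Longrightarrow> s \<le> T \<Longrightarrow> \<bar>bump R 4 y * gauss_deriv 1 (?v s) (y - x)\<bar> \<le> M1"
    by (rule cutoff_gauss_bounded[of "bump R 4" R e c]) (use assms bz in \<open>auto intro!: continuous_intros\<close>)
  obtain M2 where M2: "M2 \<ge> 0" "\<And>s y. t0 \<le> s \<Longrightarrow> s \<le> T \<Longrightarrow> \<bar>bump R 4 y * gauss_deriv 2 (?v s) (y - x)\<bar> \<le> M2"
    by (rule cutoff_gauss_bounded[of "bump R 4" R e c]) (use assms bz in \<open>auto intro!: continuous_intros\<close>)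
  obtain M3 where M3: "M3 \<ge> 0" "\<And>s y. t0 \<le> s \<Longrightarrow> s \<le> T \<Longrightarrow> \<bar>bump R 4 y * gauss_deriv 3 (?v s) (y - x)\<bar> \<le> M3"
    by (rule cutoff_gauss_bounded[of "bump R 4" R e c]) (use assms bz in \<open>auto intro!: continuous_intros\<close>)
  obtain M4 where M4: "M4 \<ge> 0" "\<And>s y. t0 \<le> s \<Longrightarrow> s \<le> T \<Longrightarrow> \<bar>bump R 4 y * gauss_deriv 4 (?v s) (y - x)\<bar> \<le> M4"
    by (rule cutoff_gauss_bounded[of "bump R 4" R e c]) (use assms bz in \<open>auto intro!: continuous_intros\<close>)
  \<comment> \<open>The first three derivatives of \<open>bump R 4\<close>.\<close>
  let ?b1 = "\<lambda>y. - 8 * y * bump R 3 y"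
  let ?b2 = "\<lambda>y. 48 * y\<^sup>2 * bump R 2 y - 8 * bump R 3 y"
  let ?b3 = "\<lambda>y. 144 * y * bump R 2 y - 192 * y ^ 3 * bump R 1 y"
  obtain N0 where N0: "N0 \<ge> 0" "\<And>s y. t0 \<le> s \<Longrightarrow> s \<le> T \<Longrightarrow> \<bar>?b1 y * gauss_deriv 0 (?v s) (y - x)\<bar> \<le> N0"
    by (rule cutoff_gauss_bounded[of ?b1 R e c]) (use assms bz in \<open>auto intro!: continuous_intros\<close>)
  obtain N1 where N1: "N1 \<ge> 0" "\<And>s y. t0 \<le> s \<Longrightarrow> s \<le> T \<Longrightarrow> \<bar>?b1 y * gauss_deriv 1 (?v s) (y - x)\<bar> \<le> N1"
    by (rule cutoff_gauss_bounded[of ?b1 R e c]) (use assms bz in \<open>auto intro!: continuous_intros\<close>)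
  obtain N2 where N2: "N2 \<ge> 0" "\<And>s y. t0 \<le> s \<Longrightarrow> s \<le> T \<Longrightarrow> \<bar>?b1 y * gauss_deriv 2 (?v s) (y - x)\<bar> \<le> N2"
    by (rule cutoff_gauss_bounded[of ?b1 R e c]) (use assms bz in \<open>auto intro!: continuous_intros\<close>)
  obtain K0 where K0: "K0 \<ge> 0" "\<And>s y. t0 \<le> s \<Longrightarrow> s \<le> T \<Longrightarrow> \<bar>?b2 y * gauss_deriv 0 (?v s) (y - x)\<bar> \<le> K0"
    by (rule cutoff_gauss_bounded[of ?b2 R e c]) (use assms bz in \<open>auto intro!: continuous_intros\<close>)
  obtain K1 where K1: "K1 \<ge> 0" "\<And>s y. t0 \<le> s \<Longrightarrow> s \<le> T \<Longrightarrow> \<bar>?b2 y * gauss_deriv 1 (?v s) (y - x)\<bar> \<le> K1"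
    by (rule cutoff_gauss_bounded[of ?b2 R e c]) (use assms bz in \<open>auto intro!: continuous_intros\<close>)
  obtain L0 where L0: "L0 \<ge> 0" "\<And>s y. t0 \<le> s \<Longrightarrow> s \<le> T \<Longrightarrow> \<bar>?b3 y * gauss_deriv 0 (?v s) (y - x)\<bar> \<le> L0"
    by (rule cutoff_gauss_bounded[of ?b3 R e c]) (use assms bz in \<open>auto intro!: continuous_intros\<close>)
  define M where "M = M0 + c / 2 * M2 + (N0 + M1) + (K0 + 2 * N1 + M2)"
  \<comment> \<open>\<open>Ct\<close>, \<open>Cm\<close> and \<open>Cy\<close> bound the second time
    derivative, the mixed derivative and the third space derivative.\<close>
  define Ct where "Ct = c\<^sup>2 / 4 * M4"
  define Cm where "Cm = c / 2 * (N2 + M3)"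
  define Cy where "Cy = L0 + 3 * K1 + 3 * N2 + M3"
  have pos: "Ct \<ge> 0" "Cm \<ge> 0" "Cy \<ge> 0"
    unfolding Ct_def Cm_def Cy_def using M3 M4 N2 L0 K1 assms by auto
  have b1': "(?b1 has_real_derivative ?b2 y) (at y)" for y
  proof -
    have "((\<lambda>y. - 8 * y) has_real_derivative - 8) (at y)" by (auto intro!: derivative_eq_intros)
    from DERIV_mult[OF this b3] show ?thesis by (rule DERIV_cong) (simp add: power2_eq_square algebra_simps)
  qed
  have b2': "(?b2 has_real_derivative ?b3 y) (at y)" for y
  proof -
    have "((\<lambda>y. 48 * y\<^sup>2) has_real_derivative 96 * y) (at y)" by (auto intro!: derivative_eq_intros)
    from DERIV_diff[OF DERIV_mult[OF this b2] DERIV_cmult[OF b3, of 8]]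
    show ?thesis by (rule DERIV_cong) (simp add: eval_nat_numeral algebra_simps)
  qed
  have dy: "(test_fun R c e T x s has_real_derivative test_fun_y R c e T x s y) (at y)" if "s \<le> T" for s y
    unfolding test_fun_def[abs_def] test_fun_y_def
    using DERIV_mult[OF b4 gu[OF v[OF that]]] by (rule DERIV_cong) simp
  have dyy: "(test_fun_y R c e T x s has_real_derivative test_fun_yy R c e T x s y) (at y)" if "s \<le> T" for s y
    unfolding test_fun_y_def[abs_def] test_fun_yy_def
    using DERIV_add[OF DERIV_mult[OF b1' gu[OF v[OF that]]] DERIV_mult[OF b4 gu[OF v[OF that]]]]
    by (rule DERIV_cong) (simp add: eval_nat_numeral algebra_simps)
  define h3 where "h3 = (\<lambda>s y. ?b3 y * gauss_deriv 0 (?v s) (y - x) + 3 * (?b2 y * gauss_deriv 1 (?v s) (y - x))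
      + 3 * (?b1 y * gauss_deriv 2 (?v s) (y - x)) + bump R 4 y * gauss_deriv 3 (?v s) (y - x))"
  have dyyy: "(test_fun_yy R c e T x s has_real_derivative h3 s y) (at y)" if "s \<le> T" for s y
    unfolding h3_def test_fun_yy_def[abs_def] mult.assoc[of 2]
    using DERIV_add[OF DERIV_add[OF DERIV_mult[OF b2' gu[OF v[OF that]]]
        DERIV_cmult[OF DERIV_mult[OF b1' gu[OF v[OF that]]], of 2]] DERIV_mult[OF b4 gu[OF v[OF that]]]]
    by (rule DERIV_cong) (simp add: eval_nat_numeral algebra_simps)
  have h3b: "\<bar>h3 s y\<bar> \<le> Cy" if "t0 \<le> s" "s \<le> T" for s y
    unfolding h3_def Cy_def
    using L0(2)[OF that, of y] K1(2)[OF that, of y] N2(2)[OF that, of y] M3(2)[OF that, of y] by linarith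
  have ds: "((\<lambda>s. test_fun R c e T x s y) has_real_derivative test_fun_s R c e T x s y) (at s)" if "s \<le> T" for s y
    unfolding test_fun_def test_fun_s_def
    using DERIV_cmult[OF gs[OF that]] by (rule DERIV_cong) (simp add: eval_nat_numeral)
  define h2 where "h2 = (\<lambda>s y. c\<^sup>2 / 4 * (bump R 4 y * gauss_deriv 4 (?v s) (y - x)))"
  have dss: "((\<lambda>s. test_fun_s R c e T x s y) has_real_derivative h2 s y) (at s)" if "s \<le> T" for s y
    unfolding test_fun_s_def h2_def
    using DERIV_cmult[OF DERIV_cmult[OF gs[OF that]]]
    by (rule DERIV_cong) (simp add: eval_nat_numeral power2_eq_square)
  have h2b: "\<bar>h2 s y\<bar> \<le> Ct" if "t0 \<le> s" "s \<le> T" for s y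
    unfolding h2_def Ct_def using M4(2)[OF that, of y] by (auto simp: abs_mult intro!: mult_left_mono)
  define hm where "hm = (\<lambda>s y. - (c / 2) * (?b1 y * gauss_deriv 2 (?v s) (y - x) + bump R 4 y * gauss_deriv 3 (?v s) (y - x)))"
  have dsy: "(test_fun_s R c e T x s has_real_derivative hm s y) (at y)" if "s \<le> T" for s y
    unfolding test_fun_s_def[abs_def] hm_def
    using DERIV_cmult[OF DERIV_mult[OF b4 gu[OF v[OF that]]]]
    by (rule DERIV_cong) (simp add: eval_nat_numeral algebra_simps)
  have hmb: "\<bar>hm s y\<bar> \<le> Cm" if "t0 \<le> s" "s \<le> T" for s y
  proof -
    have "\<bar>?b1 y * gauss_deriv 2 (?v s) (y - x) + bump R 4 y * gauss_deriv 3 (?v s) (y - x)\<bar> \<le> N2 + M3"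
      using N2(2)[OF that, of y] M3(2)[OF that, of y] by linarith
    then have "\<bar>c / 2\<bar> * \<bar>?b1 y * gauss_deriv 2 (?v s) (y - x) + bump R 4 y * gauss_deriv 3 (?v s) (y - x)\<bar> \<le> c / 2 * (N2 + M3)"
      using assms by (intro mult_mono) auto
    then show ?thesis unfolding hm_def Cm_def abs_mult by simp
  qed
  show thesis
  proof (rule that[of M "Ct + Cm + Cy"], unfold_locales)
    fix u w y d assume uw: "t0 \<le> u" "u \<le> w" "w \<le> T"
    let ?h = "test_fun R c e T x" and ?hs = "test_fun_s R c e T x" and ?hy = "test_fun_y R c e T x" and ?hyy = "test_fun_yy R c e T x"
    \<comment> \<open>The three estimates give the three terms of \<open>taylor\<close>: squared
      time step, time step times displacement, and cubed displacement.\<close>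
    have 1: "\<bar>?h w (y + d) - ?h u (y + d) - ?hs u (y + d) * (w - u)\<bar> \<le> Ct * (w - u)\<^sup>2"
      by (rule taylor1_interval[where ?f2.0 = "\<lambda>s. h2 s (y + d)" and a = t0 and b = T])
        (use ds dss h2b uw in auto)
    have 2: "\<bar>?h u (y + d) - ?h u y - ?hy u y * d - ?hyy u y * d\<^sup>2 / 2\<bar> \<le> Cy * \<bar>d\<bar> ^ 3"
      by (rule taylor2[where ?f3.0 = "h3 u"]) (use dy dyy dyyy h3b uw in auto)
    have "norm (?hs u (y + d) - ?hs u y) \<le> Cm * norm ((y + d) - y)"
      by (rule field_differentiable_bound[of UNIV "?hs u" "hm u"]) (use dsy hmb uw in auto)
    then have "\<bar>?hs u (y + d) - ?hs u y\<bar> * (w - u) \<le> Cm * \<bar>d\<bar> * (w - u)"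
      using uw by (intro mult_right_mono) auto
    then have 3: "\<bar>?hs u (y + d) * (w - u) - ?hs u y * (w - u)\<bar> \<le> Cm * ((w - u) * \<bar>d\<bar>)"
      unfolding left_diff_distrib[symmetric] abs_mult using uw by (simp add: mult_ac)
    have "\<bar>?h w (y + d) - ?h u y - ?hs u y * (w - u) - ?hy u y * d - ?hyy u y * d\<^sup>2 / 2\<bar>
        \<le> Ct * (w - u)\<^sup>2 + Cm * ((w - u) * \<bar>d\<bar>) + Cy * \<bar>d\<bar> ^ 3"
      using 1 2 3 by linarith
    also have "\<dots> \<le> (Ct + Cm + Cy) * (w - u)\<^sup>2 + (Ct + Cm + Cy) * ((w - u) * \<bar>d\<bar>) + (Ct + Cm + Cy) * \<bar>d\<bar> ^ 3"
      using pos uw by (intro add_mono mult_right_mono) auto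
    finally show "\<bar>?h w (y + d) - ?h u y - ?hs u y * (w - u) - ?hy u y * d - ?hyy u y * d\<^sup>2 / 2\<bar>
        \<le> (Ct + Cm + Cy) * ((w - u)\<^sup>2 + (w - u) * \<bar>d\<bar> + \<bar>d\<bar> ^ 3)"
      by (simp add: distrib_left)
  next
    fix s y assume s: "t0 \<le> s" "s \<le> T"
    note pos' = M0(1) M1(1) M2(1) N0(1) N1(1) K0(1)
    have c2: "c / 2 * M2 \<ge> 0" using assms M2 by simp
    show "0 \<le> test_fun R c e T x s y"
      unfolding test_fun_def by (intro mult_nonneg_nonneg bump_nonneg gauss_nonneg v s)
    show "test_fun R c e T x s y \<le> M"
      unfolding test_fun_def M_def using abs_le_D1[OF M0(2)[OF s, of y]] pos' c2 by linarith
    have "\<bar>test_fun_y R c e T x s y\<bar> \<le> N0 + M1"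
      unfolding test_fun_y_def by (intro order.trans[OF abs_triangle_ineq] add_mono N0 M1 s)
    also have "\<dots> \<le> M" unfolding M_def using pos' c2 by linarith
    finally show "\<bar>test_fun_y R c e T x s y\<bar> \<le> M" .
    have "\<bar>2 * (?b1 y * gauss_deriv 1 (?v s) (y - x))\<bar> \<le> 2 * N1"
      using N1(2)[OF s, of y] by simp
    then have "\<bar>test_fun_yy R c e T x s y\<bar> \<le> K0 + 2 * N1 + M2"
      unfolding test_fun_yy_def mult.assoc[of 2]
      by (intro order.trans[OF abs_triangle_ineq] add_mono K0 M2 s)
    also have "\<dots> \<le> M" unfolding M_def using pos' c2 by linarith
    finally show "\<bar>test_fun_yy R c e T x s y\<bar> \<le> M" .
    have "\<bar>test_fun_s R c e T x s y\<bar> = c / 2 * \<bar>bump R 4 y * gauss_deriv 2 (?v s) (y - x)\<bar>"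
      unfolding test_fun_s_def abs_mult[of "- (c / 2)"] using assms by simp
    also have "\<dots> \<le> c / 2 * M2" using M2(2)[OF s] assms by (intro mult_left_mono) auto
    also have "\<dots> \<le> M" unfolding M_def using pos' c2 by linarith
    finally show "\<bar>test_fun_s R c e T x s y\<bar> \<le> M" .
  next
    show "continuous_on ({t0..T} \<times> UNIV) (\<lambda>(s, y). test_fun R c e T x s y)"
      "continuous_on ({t0..T} \<times> UNIV) (\<lambda>(s, y). test_fun_s R c e T x s y)"
      "continuous_on ({t0..T} \<times> UNIV) (\<lambda>(s, y). test_fun_y R c e T x s y)"
      "continuous_on ({t0..T} \<times> UNIV) (\<lambda>(s, y). test_fun_yy R c e T x s y)"
      unfolding test_fun_def test_fun_s_def test_fun_y_def test_fun_yy_def case_prod_beta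
      by (intro continuous_intros continuous_on_gauss_deriv; use v in auto)+
  next
    have "c / 2 * M2 \<ge> 0" using assms M2 by simp
    then show "0 \<le> M" unfolding M_def using M0(1) M1(1) M2(1) N0(1) N1(1) K0(1) by linarith
  qed (use assms pos in auto)
qed

text \<open>
  With \<open>c = \<sigma>(x)\<^sup>2\<close> the time derivative cancels the second-order term at \<open>y = x\<close>; the remaining factor
  \<open>\<sigma>(y)\<^sup>2 - c\<close> is of order \<open>y - x\<close>, which compensates one square root of the variance.
\<close>

lemma test_fun_generator_bound:
  fixes R :: real
  assumes R: "R > 0" and Lc: "\<bar>sg2 - c\<bar> \<le> L * \<bar>y - x\<bar>"
    and b: "\<bar>b\<bar> \<le> B" and sg: "0 \<le> sg2" "sg2 \<le> S" and y: "\<bar>y\<bar> \<le> R"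
    and v: "v = e + c * (T - s)" "0 < v" "v \<le> V" and L: "L \<ge> 0"
  shows "test_fun_s R c e T x s y + b * test_fun_y R c e T x s y + sg2 / 2 * test_fun_yy R c e T x s y
      \<le> 46 * (R ^ 8 * L + B * (8 * R ^ 7 * sqrt V + R ^ 8) + S * (56 * R ^ 6 * sqrt V + 16 * R ^ 7))
          * v powr (-1/2) * gauss_deriv 0 (2 * v) (y - x)"
proof -
  note [simp del] = gauss_deriv.simps
  define G where "G = gauss_deriv 0 (2 * v) (y - x)"
  define r where "r = v powr (-1/2)"
  have r: "r > 0" using v by (simp add: r_def)
  have G: "G \<ge> 0" unfolding G_def using v by (intro gauss_nonneg) auto
  \<comment> \<open>The undifferentiated kernel carries no v^(-1/2). The factor is inserted at the
    price of \<open>sqrt V\<close>, so that all terms have the same shape.\<close>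
  have rV: "1 \<le> sqrt V * r"
    using v by (simp add: r_def powr_minus_divide powr_half_sqrt)
  have R2: "R\<^sup>2 ^ 4 = R ^ 8" "R\<^sup>2 ^ 3 = R ^ 6" "R\<^sup>2 ^ 2 = R ^ 4" by (simp_all flip: power_mult)
  define H where "H = 46 * (r * G)"
  have H: "H \<ge> 0" using r G by (simp add: H_def)
  have g0: "\<bar>gauss_deriv 0 v (y - x)\<bar> \<le> sqrt V * H"
  proof -
    have "\<bar>gauss_deriv 0 v (y - x)\<bar> \<le> 46 * G * 1"
      using gauss_deriv_bounds(1)[OF v(2), of "y - x"] gauss_nonneg[OF v(2), of "y - x"] by (simp add: G_def)
    also have "\<dots> \<le> 46 * G * (sqrt V * r)" using rV G by (intro mult_left_mono) auto
    finally show ?thesis by (simp add: H_def mult_ac)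
  qed
  have g1: "\<bar>gauss_deriv 1 v (y - x)\<bar> \<le> H"
    using gauss_deriv_bounds(2)[OF v(2), of "y - x"] by (simp add: H_def r_def G_def mult_ac)
  have g2: "\<bar>y - x\<bar> * \<bar>gauss_deriv 2 v (y - x)\<bar> \<le> H"
    using gauss_deriv_bounds(3)[OF v(2), of "y - x"] by (simp add: H_def r_def G_def mult_ac abs_mult)
  have b4: "\<bar>bump R 4 y\<bar> \<le> R ^ 8" and b3: "\<bar>bump R 3 y\<bar> \<le> R ^ 6" and b2: "\<bar>bump R 2 y\<bar> \<le> R ^ 4"
    using bump_le[of R 4 y] bump_le[of R 3 y] bump_le[of R 2 y] bump_nonneg[of R _ y] R2 by auto
  have y3: "\<bar>8 * y * bump R 3 y\<bar> \<le> 8 * R ^ 7"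
  proof -
    have "\<bar>y\<bar> * \<bar>bump R 3 y\<bar> \<le> R * R ^ 6" using b3 y R by (intro mult_mono) auto
    then show ?thesis by (simp add: abs_mult eval_nat_numeral)
  qed
  have y2: "\<bar>48 * y\<^sup>2 * bump R 2 y - 8 * bump R 3 y\<bar> \<le> 56 * R ^ 6"
  proof -
    have "y\<^sup>2 \<le> R\<^sup>2" using y by (metis abs_le_square_iff abs_of_pos R)
    then have "y\<^sup>2 * \<bar>bump R 2 y\<bar> \<le> R\<^sup>2 * R ^ 4" using b2 by (intro mult_mono) auto
    then have "\<bar>y\<^sup>2 * bump R 2 y\<bar> \<le> R ^ 6" by (simp add: abs_mult flip: power_add)
    then show ?thesis using b3 by linarith
  qed
  \<comment> \<open>The cancellation: the time derivative is -c/2 times the second space derivative,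
    so the only occurrence of \<open>gauss_deriv 2\<close> is multiplied by (sg2 - c) / 2.\<close>
  have A: "test_fun_s R c e T x s y + b * test_fun_y R c e T x s y + sg2 / 2 * test_fun_yy R c e T x s y
     = (sg2 - c) / 2 * (bump R 4 y * gauss_deriv 2 v (y - x))
       + b * (- (8 * y * bump R 3 y * gauss_deriv 0 v (y - x)) + bump R 4 y * gauss_deriv 1 v (y - x))
       + sg2 / 2 * ((48 * y\<^sup>2 * bump R 2 y - 8 * bump R 3 y) * gauss_deriv 0 v (y - x)
          - 2 * (8 * y * bump R 3 y * gauss_deriv 1 v (y - x)))"
    unfolding test_fun_s_def test_fun_y_def test_fun_yy_def v(1) by (simp add: field_simps)
  have m: "\<bar>p * q\<bar> \<le> P * Q" if "\<bar>p\<bar> \<le> P" "\<bar>q\<bar> \<le> Q" for p q P Q :: real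
    using that by (simp add: abs_mult mult_mono')
  have t1: "\<bar>(sg2 - c) / 2 * (bump R 4 y * gauss_deriv 2 v (y - x))\<bar> \<le> R ^ 8 * L * H"
  proof -
    have "\<bar>(sg2 - c) * gauss_deriv 2 v (y - x)\<bar> \<le> (L * \<bar>y - x\<bar>) * \<bar>gauss_deriv 2 v (y - x)\<bar>"
      unfolding abs_mult using Lc by (intro mult_right_mono) auto
    also have "\<dots> \<le> L * H" using g2 L by (simp add: mult.assoc mult_left_mono)
    finally have "\<bar>bump R 4 y * ((sg2 - c) * gauss_deriv 2 v (y - x))\<bar> \<le> R ^ 8 * (L * H)"
      by (rule m[OF b4])
    moreover have "\<bar>(sg2 - c) / 2 * (bump R 4 y * gauss_deriv 2 v (y - x))\<bar> = \<bar>bump R 4 y * ((sg2 - c) * gauss_deriv 2 v (y - x))\<bar> / 2"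
      by (simp add: abs_mult mult_ac)
    ultimately show ?thesis by (simp add: mult_ac)
  qed
  have t2: "\<bar>b * (- (8 * y * bump R 3 y * gauss_deriv 0 v (y - x)) + bump R 4 y * gauss_deriv 1 v (y - x))\<bar>
      \<le> B * (8 * R ^ 7 * (sqrt V * H) + R ^ 8 * H)"
    using m[OF y3 g0] m[OF b4 g1] by (intro m b) linarith
  have t3: "\<bar>sg2 / 2 * ((48 * y\<^sup>2 * bump R 2 y - 8 * bump R 3 y) * gauss_deriv 0 v (y - x)
          - 2 * (8 * y * bump R 3 y * gauss_deriv 1 v (y - x)))\<bar>
      \<le> S * (56 * R ^ 6 * (sqrt V * H) + 2 * (8 * R ^ 7 * H))"
    using m[OF y2 g0] m[OF y3 g1] sg by (intro m) linarith+
  have "46 * (R ^ 8 * L + B * (8 * R ^ 7 * sqrt V + R ^ 8) + S * (56 * R ^ 6 * sqrt V + 16 * R ^ 7)) * r * G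
      = R ^ 8 * L * H + B * (8 * R ^ 7 * (sqrt V * H) + R ^ 8 * H) + S * (56 * R ^ 6 * (sqrt V * H) + 2 * (8 * R ^ 7 * H))"
    by (simp add: H_def algebra_simps)
  then show ?thesis
    unfolding A r_def[symmetric] G_def[symmetric] using t1 t2 t3 by linarith
qed

section \<open>Brownian sums and simple integrals\<close>

lemma abs_add_cube_le: "\<bar>a + b\<bar> ^ 3 \<le> 4 * (\<bar>a\<bar> ^ 3 + \<bar>b\<bar> ^ 3)" for a b :: real
proof -
  define x y where "x = \<bar>a\<bar>" and "y = \<bar>b\<bar>"
  have xy: "x \<ge> 0" "y \<ge> 0" by (auto simp: x_def y_def)
  have "4 * (x ^ 3 + y ^ 3) - (x + y) ^ 3 = 3 * ((x + y) * (x - y)\<^sup>2)"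
    by (simp add: power2_eq_square power3_eq_cube algebra_simps)
  moreover have "(x + y) * (x - y)\<^sup>2 \<ge> 0" using xy by auto
  ultimately have **: "(x + y) ^ 3 \<le> 4 * (x ^ 3 + y ^ 3)" by linarith
  have "\<bar>a + b\<bar> ^ 3 \<le> (x + y) ^ 3" unfolding x_def y_def by (intro power_mono abs_triangle_ineq) auto
  also note **
  finally show ?thesis by (simp only: x_def y_def)
qed

lemma le_one_plus_cube: "\<bar>x\<bar> \<le> 1 + \<bar>x\<bar> ^ 3" "x\<^sup>2 \<le> 1 + \<bar>x\<bar> ^ 3" for x :: real
proof -
  have "\<bar>x\<bar> \<le> 1 + \<bar>x\<bar> ^ 3 \<and> \<bar>x\<bar>\<^sup>2 \<le> 1 + \<bar>x\<bar> ^ 3"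
  proof (cases "\<bar>x\<bar> \<le> 1")
    case True
    then have "\<bar>x\<bar>\<^sup>2 \<le> 1" by (simp add: abs_square_le_1)
    with True show ?thesis by (smt (verit) zero_le_power abs_ge_zero)
  next
    case False
    then have "\<bar>x\<bar> ^ 1 \<le> \<bar>x\<bar> ^ 3" "\<bar>x\<bar> ^ 2 \<le> \<bar>x\<bar> ^ 3" by (intro power_increasing; simp)+
    then show ?thesis by simp
  qed
  then show "\<bar>x\<bar> \<le> 1 + \<bar>x\<bar> ^ 3" "x\<^sup>2 \<le> 1 + \<bar>x\<bar> ^ 3" by simp_all
qed

section \<open>Independence and moments of Brownian increments\<close>

locale brownian_basis = stochastic_basis P F for P :: "'a measure" and F :: "real \<Rightarrow> 'a measure" +
  fixes W :: "real \<Rightarrow> 'a \<Rightarrow> real"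
  assumes W_bm: "brownian_motion P F W"
begin

lemma space_F: "0 \<le> t \<Longrightarrow> space (F t) = space P"
  using subalgebra_F by (simp add: subalgebra_def)

lemma measurable_F_imp: "0 \<le> t \<Longrightarrow> X \<in> borel_measurable (F t) \<Longrightarrow> X \<in> borel_measurable P"
  using measurable_from_subalg[OF subalgebra_F] .

lemma measurable_F_mono: "0 \<le> s \<Longrightarrow> s \<le> t \<Longrightarrow> X \<in> borel_measurable (F s) \<Longrightarrow> X \<in> borel_measurable (F t)"
  by (rule measurable_from_subalg[of "F t" "F s"]) (auto simp: subalgebra_def space_F F_mono subsetD[OF F_mono])

lemma W_adapted: "0 \<le> t \<Longrightarrow> W t \<in> borel_measurable (F t)"
  using W_bm by (simp add: brownian_motion_def adapted_def)

lemma W_measurable [measurable]: "0 \<le> t \<Longrightarrow> W t \<in> borel_measurable P"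
  using W_adapted measurable_F_imp by blast

lemma bounded_integrable:
  fixes X :: "'a \<Rightarrow> real"
  assumes "X \<in> borel_measurable P" "\<And>\<omega>. \<omega> \<in> space P \<Longrightarrow> \<bar>X \<omega>\<bar> \<le> B"
  shows "integrable P X"
  using assms by (intro integrable_const_bound[where B = B]) auto

text \<open>The case u = v is separate because \<open>brownian_motion\<close> speaks of s < t only.
  It does occur, since partition times clamped to an interval may coincide.\<close>

lemma increment_independent:
  fixes Z :: "'a \<Rightarrow> real" and g :: "real \<Rightarrow> real"
  assumes uv: "0 \<le> u" "u \<le> v"
    and Z: "Z \<in> borel_measurable (F u)" "integrable P Z"
    and g: "g \<in> borel_measurable borel" "integrable P (\<lambda>\<omega>. g (W v \<omega> - W u \<omega>))"
  shows "integrable P (\<lambda>\<omega>. Z \<omega> * g (W v \<omega> - W u \<omega>))"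
    and "expectation (\<lambda>\<omega>. Z \<omega> * g (W v \<omega> - W u \<omega>)) = expectation Z * expectation (\<lambda>\<omega>. g (W v \<omega> - W u \<omega>))"
proof -
  have "integrable P (\<lambda>\<omega>. Z \<omega> * g (W v \<omega> - W u \<omega>)) \<and>
    expectation (\<lambda>\<omega>. Z \<omega> * g (W v \<omega> - W u \<omega>)) = expectation Z * expectation (\<lambda>\<omega>. g (W v \<omega> - W u \<omega>))"
  proof (cases "u = v")
    case True
    then show ?thesis using Z by (simp add: prob_space)
  next
    case False
    let ?B = "\<lambda>\<omega>. W v \<omega> - W u \<omega>"
    have B: "?B \<in> borel_measurable P" using uv by auto
    have ind: "indep_set (sets (F u)) (sets (vimage_algebra (space P) ?B borel))"
      using W_bm uv False unfolding brownian_motion_def by auto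
    have "indep_var borel Z borel (\<lambda>\<omega>. g (?B \<omega>))"
      unfolding indep_var_eq
    proof (intro conjI)
      show "indep_set (sigma_sets (space P) {Z -` A \<inter> space P |A. A \<in> sets borel})
          (sigma_sets (space P) {(\<lambda>\<omega>. g (?B \<omega>)) -` A \<inter> space P |A. A \<in> sets borel})"
        using ind unfolding indep_set_def
      proof (rule indep_sets_mono_sets)
        fix i :: bool
        have "sigma_sets (space P) {Z -` A \<inter> space P |A. A \<in> sets borel} \<subseteq> sets (F u)"
          unfolding space_F[OF uv(1), symmetric] using Z(1)
          by (intro sets.sigma_sets_subset) (auto dest: measurable_sets)
        moreover have "sigma_sets (space P) {(\<lambda>\<omega>. g (?B \<omega>)) -` A \<inter> space P |A. A \<in> sets borel}
            \<subseteq> sets (vimage_algebra (space P) ?B borel)"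
        proof -
          have "(\<lambda>\<omega>. g (?B \<omega>)) \<in> borel_measurable (vimage_algebra (space P) ?B borel)"
            by (rule measurable_compose[OF measurable_vimage_algebra1 g(1)]) auto
          then have "\<And>A. A \<in> sets borel \<Longrightarrow> (\<lambda>\<omega>. g (?B \<omega>)) -` A \<inter> space P \<in> sets (vimage_algebra (space P) ?B borel)"
            by (auto dest: measurable_sets)
          then show ?thesis
            using sets.sigma_sets_subset[of "{(\<lambda>\<omega>. g (?B \<omega>)) -` A \<inter> space P |A. A \<in> sets borel}" "vimage_algebra (space P) ?B borel"]
            by auto
        qed
        ultimately show "case_bool (sigma_sets (space P) {Z -` A \<inter> space P |A. A \<in> sets borel})
            (sigma_sets (space P) {(\<lambda>\<omega>. g (?B \<omega>)) -` A \<inter> space P |A. A \<in> sets borel}) i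
          \<subseteq> case_bool (sets (F u)) (sets (vimage_algebra (space P) ?B borel)) i"
          by (cases i) auto
      qed
    qed (use Z g in \<open>auto dest: borel_measurable_integrable\<close>)
    from indep_var_integrable[OF this Z(2) g(2)] indep_var_lebesgue_integral[OF this Z(2) g(2)]
    show ?thesis by simp
  qed
  then show "integrable P (\<lambda>\<omega>. Z \<omega> * g (W v \<omega> - W u \<omega>))"
    "expectation (\<lambda>\<omega>. Z \<omega> * g (W v \<omega> - W u \<omega>)) = expectation Z * expectation (\<lambda>\<omega>. g (W v \<omega> - W u \<omega>))"
    by auto
qed

text \<open>The third absolute moment of a centred normal variable with deviation s is 2 s^3 sqrt (2
  / \<pi>), and sqrt (2 / \<pi>) is at most 1. Third moments suffice, since the Taylor expansion is
  of second order in space.\<close>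

lemma increment_moments:
  assumes uv: "0 \<le> u" "u \<le> v"
  shows "integrable P (\<lambda>\<omega>. \<bar>W v \<omega> - W u \<omega>\<bar> ^ 3)"
    and "expectation (\<lambda>\<omega>. \<bar>W v \<omega> - W u \<omega>\<bar> ^ 3) \<le> 2 * sqrt (v - u) ^ 3"
    and "expectation (\<lambda>\<omega>. W v \<omega> - W u \<omega>) = 0"
    and "expectation (\<lambda>\<omega>. (W v \<omega> - W u \<omega>)\<^sup>2) = v - u"
    and "integrable P (\<lambda>\<omega>. W v \<omega> - W u \<omega>)"
    and "integrable P (\<lambda>\<omega>. (W v \<omega> - W u \<omega>)\<^sup>2)"
proof -
  have "integrable P (\<lambda>\<omega>. \<bar>W v \<omega> - W u \<omega>\<bar> ^ 3)
    \<and> expectation (\<lambda>\<omega>. \<bar>W v \<omega> - W u \<omega>\<bar> ^ 3) \<le> 2 * sqrt (v - u) ^ 3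
    \<and> expectation (\<lambda>\<omega>. W v \<omega> - W u \<omega>) = 0
    \<and> expectation (\<lambda>\<omega>. (W v \<omega> - W u \<omega>)\<^sup>2) = v - u
    \<and> integrable P (\<lambda>\<omega>. W v \<omega> - W u \<omega>)
    \<and> integrable P (\<lambda>\<omega>. (W v \<omega> - W u \<omega>)\<^sup>2)"
  proof (cases "u = v")
    case False
    define s where "s = sqrt (v - u)"
    have s: "s > 0" "s\<^sup>2 = v - u" using False uv by (auto simp: s_def)
    let ?B = "\<lambda>\<omega>. W v \<omega> - W u \<omega>"
    have D: "distributed P lborel ?B (\<lambda>x. ennreal (normal_density 0 s x))"
      using W_bm uv False unfolding brownian_motion_def s_def by auto
    have tr: "integrable P (\<lambda>\<omega>. g (?B \<omega>)) \<longleftrightarrow> integrable lborel (\<lambda>x. normal_density 0 s x * g x)"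
      "expectation (\<lambda>\<omega>. g (?B \<omega>)) = (\<integral>x. normal_density 0 s x * g x \<partial>lborel)"
      if "g \<in> borel_measurable borel" for g :: "real \<Rightarrow> real"
      using distributed_integrable[OF D, of g] distributed_integral[OF D, of g] that by auto
    have 3: "has_bochner_integral lborel (\<lambda>x. normal_density 0 s x * \<bar>x\<bar> ^ 3) (2 * s ^ 3 * sqrt (2 / pi))"
      using normal_moment_abs_odd[where \<mu> = 0 and \<sigma> = s and k = 1] s by (simp add: mult_ac)
    have 1: "has_bochner_integral lborel (\<lambda>x. normal_density 0 s x * x) 0"
      using normal_moment_odd[where \<mu> = 0 and \<sigma> = s and k = 0] s by simp
    have 2: "has_bochner_integral lborel (\<lambda>x. normal_density 0 s x * x\<^sup>2) (s\<^sup>2)"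
      using normal_moment_even[where \<mu> = 0 and \<sigma> = s and k = 1] s by (simp add: power2_eq_square)
    have "sqrt (2 / pi) \<le> 1" using pi_gt3 by (auto simp: real_sqrt_le_1_iff)
    then have "2 * s ^ 3 * sqrt (2 / pi) \<le> 2 * s ^ 3 * 1" using s by (intro mult_left_mono) auto
    then show ?thesis
      using tr[of "\<lambda>x. \<bar>x\<bar> ^ 3"] tr[of "\<lambda>x. x"] tr[of "\<lambda>x. x\<^sup>2"] 1 2 3 s
      unfolding s_def[symmetric] by (auto simp: has_bochner_integral_iff)
  qed (simp add: prob_space)
  then show "integrable P (\<lambda>\<omega>. \<bar>W v \<omega> - W u \<omega>\<bar> ^ 3)"
    "expectation (\<lambda>\<omega>. \<bar>W v \<omega> - W u \<omega>\<bar> ^ 3) \<le> 2 * sqrt (v - u) ^ 3"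
    "expectation (\<lambda>\<omega>. W v \<omega> - W u \<omega>) = 0"
    "expectation (\<lambda>\<omega>. (W v \<omega> - W u \<omega>)\<^sup>2) = v - u"
    "integrable P (\<lambda>\<omega>. W v \<omega> - W u \<omega>)"
    "integrable P (\<lambda>\<omega>. (W v \<omega> - W u \<omega>)\<^sup>2)"
    by blast+
qed

lemma integrable_of_cube:
  fixes X :: "'a \<Rightarrow> real"
  assumes "X \<in> borel_measurable P" "integrable P (\<lambda>\<omega>. \<bar>X \<omega>\<bar> ^ 3)"
  shows "integrable P X" "integrable P (\<lambda>\<omega>. (X \<omega>)\<^sup>2)" "integrable P (\<lambda>\<omega>. \<bar>X \<omega>\<bar>)"
proof -
  have i: "integrable P (\<lambda>\<omega>. 1 + \<bar>X \<omega>\<bar> ^ 3)" using assms by auto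
  show *: "integrable P X"
    by (rule Bochner_Integration.integrable_bound[OF i assms(1)]) (use le_one_plus_cube in \<open>auto simp: abs_of_nonneg add_nonneg_nonneg\<close>)
  then show "integrable P (\<lambda>\<omega>. \<bar>X \<omega>\<bar>)" by auto
  show "integrable P (\<lambda>\<omega>. (X \<omega>)\<^sup>2)"
    by (rule Bochner_Integration.integrable_bound[OF i]) (use le_one_plus_cube assms(1) in \<open>auto simp: abs_of_nonneg add_nonneg_nonneg\<close>)
qed

lemma integrable_bounded_mult:
  fixes X Z :: "'a \<Rightarrow> real"
  assumes "integrable P X" "Z \<in> borel_measurable P" "\<And>\<omega>. \<omega> \<in> space P \<Longrightarrow> \<bar>Z \<omega>\<bar> \<le> B"
  shows "integrable P (\<lambda>\<omega>. Z \<omega> * X \<omega>)"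
proof (rule Bochner_Integration.integrable_bound)
  show "integrable P (\<lambda>\<omega>. B * X \<omega>)" using assms by auto
  show "AE \<omega> in P. norm (Z \<omega> * X \<omega>) \<le> norm (B * X \<omega>)"
  proof (rule AE_I2)
    fix \<omega> assume "\<omega> \<in> space P"
    then have "\<bar>Z \<omega>\<bar> \<le> \<bar>B\<bar>" using assms(3)[of \<omega>] by linarith
    then show "norm (Z \<omega> * X \<omega>) \<le> norm (B * X \<omega>)" by (simp add: abs_mult mult_right_mono)
  qed
qed (use assms in auto)

text \<open>A discrete stochastic integral with its quadratic variation \<open>Q\<close>. Testing
  against bounded \<open>F u\<close>-measurable Z expresses that, conditionally on
  \<open>F u\<close>, the sum has mean zero and S^2 has the mean of Q. The factor 4 ^ n comes from
  applying \<open>abs_add_cube_le\<close> at each summand; it is harmless because n belongs to the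
  integrand and does not grow when the grid is refined.\<close>

lemma brownian_sum:
  fixes c :: "nat \<Rightarrow> real" and \<eta> :: "nat \<Rightarrow> 'a \<Rightarrow> real"
  defines "S \<equiv> \<lambda>k \<omega>. \<Sum>i<k. \<eta> i \<omega> * (W (c (Suc i)) \<omega> - W (c i) \<omega>)"
    and "Q \<equiv> \<lambda>k \<omega>. \<Sum>i<k. (\<eta> i \<omega>)\<^sup>2 * (c (Suc i) - c i)"
  assumes u: "0 \<le> u" "u \<le> c 0" and c: "\<And>i. i < n \<Longrightarrow> c i \<le> c (Suc i)" "\<And>i. i \<le> n \<Longrightarrow> c i \<le> v"
    and \<eta>: "\<And>i. i < n \<Longrightarrow> \<eta> i \<in> borel_measurable (F (c i))"
    and M: "\<And>i \<omega>. i < n \<Longrightarrow> \<omega> \<in> space P \<Longrightarrow> \<bar>\<eta> i \<omega>\<bar> \<le> M" "0 \<le> M"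
  shows "S n \<in> borel_measurable (F (c n))" and "Q n \<in> borel_measurable (F v)" and "Q n \<in> borel_measurable P"
    and "integrable P (\<lambda>\<omega>. \<bar>S n \<omega>\<bar> ^ 3)"
    and "expectation (\<lambda>\<omega>. \<bar>S n \<omega>\<bar> ^ 3) \<le> 2 * real n * 4 ^ n * M ^ 3 * sqrt (v - u) ^ 3"
    and "\<And>Z B. Z \<in> borel_measurable (F u) \<Longrightarrow> (\<And>\<omega>. \<omega> \<in> space P \<Longrightarrow> \<bar>Z \<omega>\<bar> \<le> B) \<Longrightarrow>
        expectation (\<lambda>\<omega>. Z \<omega> * S n \<omega>) = 0 \<and>
        expectation (\<lambda>\<omega>. Z \<omega> * (S n \<omega>)\<^sup>2) = expectation (\<lambda>\<omega>. Z \<omega> * Q n \<omega>)"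
proof -
  have cu: "u \<le> c i" if "i \<le> n" for i
    using that by (induction i) (use u c(1) in \<open>auto intro: order.trans\<close>)
  have c0: "0 \<le> c i" if "i \<le> n" for i using cu[OF that] u by linarith
  have QF: "Q k \<in> borel_measurable (F v)" if "k \<le> n" for k
    unfolding Q_def using that
    by (intro borel_measurable_sum borel_measurable_times borel_measurable_power
        measurable_F_mono[OF c0 c(2) \<eta>] borel_measurable_const) auto
  have Q: "Q k \<in> borel_measurable P" if "k \<le> n" for k
    using measurable_F_imp[OF _ QF[OF that]] c0[of n] c(2)[of n] by auto
  have Qb: "\<bar>Q k \<omega>\<bar> \<le> (\<Sum>i<k. M\<^sup>2 * (c (Suc i) - c i))" if "k \<le> n" "\<omega> \<in> space P" for k \<omega>
  proof -
    have "\<bar>\<eta> i \<omega>\<bar>\<^sup>2 \<le> M\<^sup>2" if "i < k" for i using M that \<open>k \<le> n\<close> \<open>\<omega> \<in> space P\<close> by (intro power_mono) auto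
    then show ?thesis
      unfolding Q_def using c(1) \<open>k \<le> n\<close> by (intro order.trans[OF sum_abs] sum_mono) (auto simp: abs_mult intro!: mult_mono)
  qed
  have main: "S k \<in> borel_measurable (F (c k)) \<and> integrable P (\<lambda>\<omega>. \<bar>S k \<omega>\<bar> ^ 3)
     \<and> expectation (\<lambda>\<omega>. \<bar>S k \<omega>\<bar> ^ 3) \<le> 2 * real k * 4 ^ k * M ^ 3 * sqrt (v - u) ^ 3
     \<and> (\<forall>Z B. Z \<in> borel_measurable (F u) \<longrightarrow> (\<forall>\<omega>\<in>space P. \<bar>Z \<omega>\<bar> \<le> B) \<longrightarrow>
        expectation (\<lambda>\<omega>. Z \<omega> * S k \<omega>) = 0 \<and>
        expectation (\<lambda>\<omega>. Z \<omega> * (S k \<omega>)\<^sup>2) = expectation (\<lambda>\<omega>. Z \<omega> * Q k \<omega>))"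
    if "k \<le> n" for k
    using that
  proof (induction k)
    case 0
    then show ?case by (simp add: S_def Q_def)
  next
    case (Suc k)
    then have k: "k < n" "k \<le> n" by auto
    note IH = Suc.IH[OF k(2)]
    define B where "B = (\<lambda>\<omega>. W (c (Suc k)) \<omega> - W (c k) \<omega>)"
    have B: "W (c (Suc k)) \<omega> - W (c k) \<omega> = B \<omega>" for \<omega> by (simp add: B_def)
    have S_Suc: "S (Suc k) = (\<lambda>\<omega>. S k \<omega> + \<eta> k \<omega> * B \<omega>)" by (simp add: S_def B_def fun_eq_iff)
    have Q_Suc: "Q (Suc k) = (\<lambda>\<omega>. Q k \<omega> + (\<eta> k \<omega>)\<^sup>2 * (c (Suc k) - c k))" by (simp add: Q_def fun_eq_iff)
    have ck: "0 \<le> c k" "c k \<le> c (Suc k)" "0 \<le> c (Suc k)" "c (Suc k) \<le> v" "u \<le> c k"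
      using c0 c k cu Suc.prems by auto
    note mom = increment_moments[OF ck(1,2), unfolded B]
    have Sk[measurable]: "S k \<in> borel_measurable (F (c k))" and Sk3: "integrable P (\<lambda>\<omega>. \<bar>S k \<omega>\<bar> ^ 3)" using IH by auto
    have SkP[measurable]: "S k \<in> borel_measurable P" using measurable_F_imp[OF ck(1) Sk] .
    have \<eta>k[measurable]: "\<eta> k \<in> borel_measurable (F (c k))" "\<eta> k \<in> borel_measurable P"
      using \<eta>[OF k(1)] measurable_F_imp[OF ck(1)] by auto
    have B_meas[measurable]: "B \<in> borel_measurable P" using ck unfolding B_def by auto
    have 1: "S (Suc k) \<in> borel_measurable (F (c (Suc k)))"
      unfolding S_Suc B_def
      by (intro borel_measurable_add borel_measurable_times borel_measurable_diff
          measurable_F_mono[OF ck(1,2) Sk] measurable_F_mono[OF ck(1,2) \<eta>k(1)] W_adapted ck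
          measurable_F_mono[OF ck(1,2) W_adapted])
    have S1P[measurable]: "S (Suc k) \<in> borel_measurable P" using measurable_F_imp[OF ck(3) 1] .
    have bd: "\<bar>S (Suc k) \<omega>\<bar> ^ 3 \<le> 4 * (\<bar>S k \<omega>\<bar> ^ 3 + M ^ 3 * \<bar>B \<omega>\<bar> ^ 3)" if "\<omega> \<in> space P" for \<omega>
    proof -
      have "\<bar>\<eta> k \<omega> * B \<omega>\<bar> ^ 3 \<le> (M * \<bar>B \<omega>\<bar>) ^ 3"
        unfolding abs_mult using M(1)[OF k(1) that] by (intro power_mono mult_right_mono) auto
      then show ?thesis
        unfolding S_Suc using abs_add_cube_le[of "S k \<omega>" "\<eta> k \<omega> * B \<omega>"] by (simp add: power_mult_distrib)
    qed
    have int: "integrable P (\<lambda>\<omega>. 4 * (\<bar>S k \<omega>\<bar> ^ 3 + M ^ 3 * \<bar>B \<omega>\<bar> ^ 3))"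
      by (intro Bochner_Integration.integrable_add integrable_mult_right Sk3 mom(1))
    have 2: "integrable P (\<lambda>\<omega>. \<bar>S (Suc k) \<omega>\<bar> ^ 3)"
      by (rule Bochner_Integration.integrable_bound[OF int]) (use bd M in \<open>auto intro!: AE_I2\<close>)
    have 3: "expectation (\<lambda>\<omega>. \<bar>S (Suc k) \<omega>\<bar> ^ 3) \<le> 2 * real (Suc k) * 4 ^ Suc k * M ^ 3 * sqrt (v - u) ^ 3"
    proof -
      let ?r = "M ^ 3 * sqrt (v - u) ^ 3"
      have r: "?r \<ge> 0" using M ck by (intro mult_nonneg_nonneg) auto
      have "expectation (\<lambda>\<omega>. \<bar>S (Suc k) \<omega>\<bar> ^ 3) \<le> expectation (\<lambda>\<omega>. 4 * (\<bar>S k \<omega>\<bar> ^ 3 + M ^ 3 * \<bar>B \<omega>\<bar> ^ 3))"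
        by (intro integral_mono 2 int bd)
      also have "\<dots> = 4 * (expectation (\<lambda>\<omega>. \<bar>S k \<omega>\<bar> ^ 3) + M ^ 3 * expectation (\<lambda>\<omega>. \<bar>B \<omega>\<bar> ^ 3))"
        using Sk3 mom(1) by simp
      also have "\<dots> \<le> 4 * (2 * real k * 4 ^ k * M ^ 3 * sqrt (v - u) ^ 3 + M ^ 3 * (2 * sqrt (v - u) ^ 3))"
      proof -
        have "sqrt (c (Suc k) - c k) ^ 3 \<le> sqrt (v - u) ^ 3" using ck by (intro power_mono) auto
        then have "M ^ 3 * expectation (\<lambda>\<omega>. \<bar>B \<omega>\<bar> ^ 3) \<le> M ^ 3 * (2 * sqrt (v - u) ^ 3)"
          using mom(2) M by (intro mult_left_mono) auto
        moreover have "expectation (\<lambda>\<omega>. \<bar>S k \<omega>\<bar> ^ 3) \<le> 2 * real k * 4 ^ k * M ^ 3 * sqrt (v - u) ^ 3" using IH by blast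
        ultimately show ?thesis by (intro mult_left_mono[OF add_mono]) auto
      qed
      also have "\<dots> = 2 * (real k * 4 ^ Suc k + 4) * ?r" by (simp add: algebra_simps)
      also have "\<dots> \<le> 2 * (real k * 4 ^ Suc k + 4 ^ Suc k) * ?r"
      proof -
        have "(4::real) ^ 1 \<le> 4 ^ Suc k" by (rule power_increasing) auto
        then show ?thesis using r by (intro mult_right_mono) auto
      qed
      finally show ?thesis by (simp add: algebra_simps)
    qed
    have 4: "expectation (\<lambda>\<omega>. Z \<omega> * S (Suc k) \<omega>) = 0 \<and>
        expectation (\<lambda>\<omega>. Z \<omega> * (S (Suc k) \<omega>)\<^sup>2) = expectation (\<lambda>\<omega>. Z \<omega> * Q (Suc k) \<omega>)"
      if Z: "Z \<in> borel_measurable (F u)" and Zb: "\<forall>\<omega>\<in>space P. \<bar>Z \<omega>\<bar> \<le> b" for Z b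
    proof
      have Zk[measurable]: "Z \<in> borel_measurable (F (c k))" "Z \<in> borel_measurable P"
        using measurable_F_mono[OF u(1) ck(5) Z] measurable_F_imp[OF u(1) Z] by auto
      note iS = integrable_of_cube[OF SkP Sk3]
      have Zb': "\<And>\<omega>. \<omega> \<in> space P \<Longrightarrow> \<bar>Z \<omega>\<bar> \<le> b" using Zb by auto
      have b0: "0 \<le> b" using Zb not_empty by (auto intro: order.trans[OF abs_ge_zero])
      have Z\<eta>: "\<bar>Z \<omega> * \<eta> k \<omega>\<bar> \<le> b * M" if "\<omega> \<in> space P" for \<omega>
        unfolding abs_mult using Zb'[OF that] M(1)[OF k(1) that] M b0 by (intro mult_mono) auto
      have Z\<eta>2: "\<bar>Z \<omega> * (\<eta> k \<omega>)\<^sup>2\<bar> \<le> b * M * M" if "\<omega> \<in> space P" for \<omega>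
        unfolding power2_eq_square mult.assoc[symmetric] abs_mult[of "_ * _"] using Z\<eta>[OF that] M(1)[OF k(1) that] M b0 by (intro mult_mono) auto
      have i1: "integrable P (\<lambda>\<omega>. Z \<omega> * \<eta> k \<omega>)" by (rule bounded_integrable[OF _ Z\<eta>]) auto
      have i2: "integrable P (\<lambda>\<omega>. Z \<omega> * (\<eta> k \<omega>)\<^sup>2)" by (rule bounded_integrable[OF _ Z\<eta>2]) auto
      have i3: "integrable P (\<lambda>\<omega>. Z \<omega> * \<eta> k \<omega> * S k \<omega>)"
        by (rule integrable_bounded_mult[OF iS(1) _ Z\<eta>]) auto
      have i4: "integrable P (\<lambda>\<omega>. Z \<omega> * S k \<omega>)" by (rule integrable_bounded_mult[OF iS(1) _ Zb']) auto
      have i5: "integrable P (\<lambda>\<omega>. Z \<omega> * (S k \<omega>)\<^sup>2)" by (rule integrable_bounded_mult[OF iS(2) _ Zb']) auto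
      have mb: "(\<lambda>x::real. x) \<in> borel_measurable borel" "(\<lambda>x::real. x\<^sup>2) \<in> borel_measurable borel" by auto
      have m1: "(\<lambda>\<omega>. Z \<omega> * \<eta> k \<omega>) \<in> borel_measurable (F (c k))"
        and m2: "(\<lambda>\<omega>. Z \<omega> * (\<eta> k \<omega>)\<^sup>2) \<in> borel_measurable (F (c k))"
        and m3: "(\<lambda>\<omega>. Z \<omega> * \<eta> k \<omega> * S k \<omega>) \<in> borel_measurable (F (c k))" by measurable
      note e1 = increment_independent[OF ck(1,2) m1 i1 mb(1), unfolded B, OF mom(5), unfolded mom(3) mult_zero_right]
      note e3 = increment_independent[OF ck(1,2) m3 i3 mb(1), unfolded B, OF mom(5), unfolded mom(3) mult_zero_right]
      note e2 = increment_independent[OF ck(1,2) m2 i2 mb(2), unfolded B, OF mom(6), unfolded mom(4)]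
      have "expectation (\<lambda>\<omega>. Z \<omega> * S (Suc k) \<omega>) = expectation (\<lambda>\<omega>. Z \<omega> * S k \<omega> + (Z \<omega> * \<eta> k \<omega>) * B \<omega>)"
        unfolding S_Suc by (simp add: algebra_simps)
      also have "\<dots> = 0" using e1 i4 IH Z Zb by (subst Bochner_Integration.integral_add) auto
      finally show "expectation (\<lambda>\<omega>. Z \<omega> * S (Suc k) \<omega>) = 0" .
      have iQ: "integrable P (\<lambda>\<omega>. Z \<omega> * Q k \<omega>)"
        by (rule integrable_bounded_mult[OF bounded_integrable[OF Q Qb] _ Zb']) (use k in auto)
      \<comment> \<open>Expand the square of S + \<eta> B. The mixed term has expectation 0, because
        B is centred and independent of everything known at time \<open>c k\<close>, and
        \<open>(B \<omega>)\<^sup>2\<close> may be replaced by the length of the time step.\<close>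
      have "expectation (\<lambda>\<omega>. Z \<omega> * (S (Suc k) \<omega>)\<^sup>2) = expectation (\<lambda>\<omega>. Z \<omega> * (S k \<omega>)\<^sup>2
          + 2 * ((Z \<omega> * \<eta> k \<omega> * S k \<omega>) * B \<omega>) + (Z \<omega> * (\<eta> k \<omega>)\<^sup>2) * (B \<omega>)\<^sup>2)"
        unfolding S_Suc by (simp add: algebra_simps power2_eq_square)
      also have "\<dots> = expectation (\<lambda>\<omega>. Z \<omega> * (S k \<omega>)\<^sup>2) + expectation (\<lambda>\<omega>. (Z \<omega> * (\<eta> k \<omega>)\<^sup>2) * (B \<omega>)\<^sup>2)"
        using i5 e3 e2(1) by simp
      also have "\<dots> = expectation (\<lambda>\<omega>. Z \<omega> * Q k \<omega>) + expectation (\<lambda>\<omega>. (Z \<omega> * (\<eta> k \<omega>)\<^sup>2) * (c (Suc k) - c k))"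
        using IH Z Zb e2(2) i2 by auto
      also have "\<dots> = expectation (\<lambda>\<omega>. Z \<omega> * Q k \<omega> + (Z \<omega> * (\<eta> k \<omega>)\<^sup>2) * (c (Suc k) - c k))"
        using iQ i2 by (subst Bochner_Integration.integral_add) auto
      also have "\<dots> = expectation (\<lambda>\<omega>. Z \<omega> * Q (Suc k) \<omega>)"
        unfolding Q_Suc by (simp add: algebra_simps)
      finally show "expectation (\<lambda>\<omega>. Z \<omega> * (S (Suc k) \<omega>)\<^sup>2) = expectation (\<lambda>\<omega>. Z \<omega> * Q (Suc k) \<omega>)" .
    qed
    show ?case using 1 2 3 4 by blast
  qed
  show "S n \<in> borel_measurable (F (c n))" "Q n \<in> borel_measurable (F v)" "Q n \<in> borel_measurable P" "integrable P (\<lambda>\<omega>. \<bar>S n \<omega>\<bar> ^ 3)"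
    "expectation (\<lambda>\<omega>. \<bar>S n \<omega>\<bar> ^ 3) \<le> 2 * real n * 4 ^ n * M ^ 3 * sqrt (v - u) ^ 3"
    using main[of n] Q[of n] QF[of n] by auto
  show "expectation (\<lambda>\<omega>. Z \<omega> * S n \<omega>) = 0 \<and> expectation (\<lambda>\<omega>. Z \<omega> * (S n \<omega>)\<^sup>2) = expectation (\<lambda>\<omega>. Z \<omega> * Q n \<omega>)"
    if "Z \<in> borel_measurable (F u)" "\<And>\<omega>. \<omega> \<in> space P \<Longrightarrow> \<bar>Z \<omega>\<bar> \<le> B" for Z B
    using main[of n] that by blast
qed

end

context test_function
begin

lemma slice_cont:
  assumes "continuous_on ({t0..t1} \<times> UNIV) (\<lambda>(s, y). g s y)" "t0 \<le> s" "s \<le> t1"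
  shows "continuous_on UNIV (g s :: real \<Rightarrow> real)"
proof -
  have "continuous_on UNIV (\<lambda>y. case (s, y) of (s, y) \<Rightarrow> g s y)"
    by (rule continuous_on_compose2[OF assms(1)]) (use assms(2,3) in \<open>auto intro!: continuous_intros\<close>)
  then show ?thesis by simp
qed

lemma slice_measurable:
  assumes "t0 \<le> s" "s \<le> t1"
  shows "h s \<in> borel_measurable borel" "hs s \<in> borel_measurable borel"
    "hy s \<in> borel_measurable borel" "hyy s \<in> borel_measurable borel"
  using assms slice_cont[OF h_cont] slice_cont[OF hs_cont] slice_cont[OF hy_cont] slice_cont[OF hyy_cont]
  by (auto intro!: borel_measurable_continuous_onI)

end

text \<open>The intervals between consecutive times are disjoint, so all mixed products
  vanish.\<close>

lemma simple_process_square: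
  assumes mono: "\<And>i. i < n \<Longrightarrow> \<tau> i \<le> \<tau> (Suc i)"
  shows "(simple_process n \<tau> \<xi> s \<omega>)\<^sup>2 = (\<Sum>i<n. (\<xi> i \<omega>)\<^sup>2 * indicator {\<tau> i<..\<tau> (Suc i)} s)"
  using assms
proof (induction n)
  case (Suc n)
  have mon: "i \<le> j \<Longrightarrow> j \<le> n \<Longrightarrow> \<tau> i \<le> \<tau> j" for i j
    by (induction j) (use Suc.prems in \<open>auto simp: le_Suc_eq intro: order.trans\<close>)
  have "simple_process n \<tau> \<xi> s \<omega> * (\<xi> n \<omega> * indicator {\<tau> n<..\<tau> (Suc n)} s) = 0"
  proof (cases "s \<in> {\<tau> n<..\<tau> (Suc n)}")
    case True
    then have "s \<notin> {\<tau> i<..\<tau> (Suc i)}" if "i < n" for i using mon[of "Suc i" n] that by auto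
    then show ?thesis by (simp add: simple_process_def)
  qed simp
  moreover have "simple_process (Suc n) \<tau> \<xi> s \<omega> = simple_process n \<tau> \<xi> s \<omega> + \<xi> n \<omega> * indicator {\<tau> n<..\<tau> (Suc n)} s"
    by (simp add: simple_process_def)
  ultimately have "(simple_process (Suc n) \<tau> \<xi> s \<omega>)\<^sup>2
      = (simple_process n \<tau> \<xi> s \<omega>)\<^sup>2 + (\<xi> n \<omega>)\<^sup>2 * indicator {\<tau> n<..\<tau> (Suc n)} s"
    by (cases "s \<in> {\<tau> n<..\<tau> (Suc n)}") (auto simp: power2_sum)
  then show ?case using Suc by simp
qed (simp add: simple_process_def)

text \<open>The quadratic variation of the simple integral over (u, v], that is, the time integral
  of the squared integrand, as a finite sum whose measurability in \<omega> is evident.\<close>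

definition clamp_sum :: "nat \<Rightarrow> (nat \<Rightarrow> real) \<Rightarrow> (nat \<Rightarrow> 'a \<Rightarrow> real) \<Rightarrow> real \<Rightarrow> real \<Rightarrow> 'a \<Rightarrow> real" where
  "clamp_sum n \<tau> \<xi> u v \<omega> =
    (\<Sum>i<n. (\<xi> i \<omega>)\<^sup>2 * (max u (min (\<tau> (Suc i)) v) - max u (min (\<tau> i) v)))"

lemma clamp_sum_eq:
  assumes mono: "\<And>i. i < n \<Longrightarrow> \<tau> i \<le> \<tau> (Suc i)" and uv: "u \<le> v"
  shows "has_bochner_integral lborel (\<lambda>s. indicator {u<..v} s *\<^sub>R (simple_process n \<tau> \<xi> s \<omega>)\<^sup>2) (clamp_sum n \<tau> \<xi> u v \<omega>)"
proof -
  have sq: "(simple_process n \<tau> \<xi> s \<omega>)\<^sup>2 = (\<Sum>i<n. (\<xi> i \<omega>)\<^sup>2 * indicator {\<tau> i<..\<tau> (Suc i)} s)" for s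
    by (rule simple_process_square) (rule mono)
  have fin: "emeasure lborel {a<..b} < \<infinity>" for a b :: real by (cases "a \<le> b") auto
  have 1: "has_bochner_integral lborel (\<lambda>s. (\<xi> i \<omega>)\<^sup>2 * indicator ({u<..v} \<inter> {\<tau> i<..\<tau> (Suc i)}) s)
      ((\<xi> i \<omega>)\<^sup>2 * (max u (min (\<tau> (Suc i)) v) - max u (min (\<tau> i) v)))" if "i < n" for i
  proof -
    have eq: "{u<..v} \<inter> {\<tau> i<..\<tau> (Suc i)} = {max u (\<tau> i)<..min v (\<tau> (Suc i))}" by auto
    have "measure lborel {max u (\<tau> i)<..min v (\<tau> (Suc i))} = max u (min (\<tau> (Suc i)) v) - max u (min (\<tau> i) v)"
      using mono[OF that] uv by (cases "max u (\<tau> i) \<le> min v (\<tau> (Suc i))") (auto simp: measure_def)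
    moreover have "has_bochner_integral lborel (indicator {max u (\<tau> i)<..min v (\<tau> (Suc i))} :: real \<Rightarrow> real)
        (measure lborel {max u (\<tau> i)<..min v (\<tau> (Suc i))})"
      by (rule has_bochner_integral_real_indicator)
        (simp_all only: fin sets_lborel greaterThanAtMost_borel)
    ultimately show ?thesis unfolding eq by (intro has_bochner_integral_mult_right) auto
  qed
  have "has_bochner_integral lborel (\<lambda>s. \<Sum>i<n. (\<xi> i \<omega>)\<^sup>2 * indicator ({u<..v} \<inter> {\<tau> i<..\<tau> (Suc i)}) s)
     (clamp_sum n \<tau> \<xi> u v \<omega>)"
    unfolding clamp_sum_def by (rule has_bochner_integral_sum) (use 1 in auto)
  also have "(\<lambda>s. \<Sum>i<n. (\<xi> i \<omega>)\<^sup>2 * indicator ({u<..v} \<inter> {\<tau> i<..\<tau> (Suc i)}) s)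
     = (\<lambda>s. indicator {u<..v} s *\<^sub>R (simple_process n \<tau> \<xi> s \<omega>)\<^sup>2)"
    unfolding sq by (auto simp: fun_eq_iff sum_distrib_left indicator_def intro!: sum.cong)
  finally show ?thesis .
qed

context brownian_basis
begin

text \<open>Clamping the partition times to [u, v] turns an increment of the simple integral into
  the sum treated by \<open>brownian_sum\<close>, with the same number of terms for all u and v.
  Hence \<open>C\<close> and \<open>M\<close> depend on the integrand only, and the third moment
  scales like (v - u)^(3/2).\<close>

lemma simple_integral_increment:
  assumes sd: "simple_data F n \<tau> \<xi>"
  obtains C M where "C \<ge> 0" "M \<ge> 0"
    "\<And>t. 0 \<le> t \<Longrightarrow> simple_integral W n \<tau> \<xi> t \<in> borel_measurable (F t)"
    "\<And>u v. 0 \<le> u \<Longrightarrow> u \<le> v \<Longrightarrow> clamp_sum n \<tau> \<xi> u v \<in> borel_measurable (F v)"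
    "\<And>u v \<omega>. 0 \<le> u \<Longrightarrow> u \<le> v \<Longrightarrow> \<omega> \<in> space P \<Longrightarrow> 0 \<le> clamp_sum n \<tau> \<xi> u v \<omega> \<and> clamp_sum n \<tau> \<xi> u v \<omega> \<le> M * (v - u)"
    "\<And>u v. 0 \<le> u \<Longrightarrow> u \<le> v \<Longrightarrow> integrable P (\<lambda>\<omega>. \<bar>simple_integral W n \<tau> \<xi> v \<omega> - simple_integral W n \<tau> \<xi> u \<omega>\<bar> ^ 3)"
    "\<And>u v. 0 \<le> u \<Longrightarrow> u \<le> v \<Longrightarrow> expectation (\<lambda>\<omega>. \<bar>simple_integral W n \<tau> \<xi> v \<omega> - simple_integral W n \<tau> \<xi> u \<omega>\<bar> ^ 3) \<le> C * sqrt (v - u) ^ 3"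
    "\<And>u v Z B. 0 \<le> u \<Longrightarrow> u \<le> v \<Longrightarrow> Z \<in> borel_measurable (F u) \<Longrightarrow> (\<And>\<omega>. \<omega> \<in> space P \<Longrightarrow> \<bar>Z \<omega>\<bar> \<le> B) \<Longrightarrow>
        expectation (\<lambda>\<omega>. Z \<omega> * (simple_integral W n \<tau> \<xi> v \<omega> - simple_integral W n \<tau> \<xi> u \<omega>)) = 0 \<and>
        expectation (\<lambda>\<omega>. Z \<omega> * (simple_integral W n \<tau> \<xi> v \<omega> - simple_integral W n \<tau> \<xi> u \<omega>)\<^sup>2)
          = expectation (\<lambda>\<omega>. Z \<omega> * clamp_sum n \<tau> \<xi> u v \<omega>)"
proof -
  have mono: "\<And>i. i < n \<Longrightarrow> \<tau> i \<le> \<tau> (Suc i)" and \<tau>0: "0 \<le> \<tau> 0"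
    and \<xi>: "\<And>i. i < n \<Longrightarrow> \<xi> i \<in> borel_measurable (F (\<tau> i))"
    and bdd: "\<And>i. i < n \<Longrightarrow> bounded (\<xi> i ` space (F (\<tau> i)))"
    using sd by (auto simp: simple_data_def)
  have \<tau>pos: "0 \<le> \<tau> i" if "i \<le> n" for i
    using that by (induction i) (use mono \<tau>0 in \<open>auto intro: order.trans\<close>)
  have "\<exists>m. \<forall>\<omega>\<in>space P. \<bar>\<xi> i \<omega>\<bar> \<le> m" if "i < n" for i
    using bdd[OF that] space_F[OF \<tau>pos, of i] that by (auto simp: bounded_iff)
  then obtain m where m: "\<And>i \<omega>. i < n \<Longrightarrow> \<omega> \<in> space P \<Longrightarrow> \<bar>\<xi> i \<omega>\<bar> \<le> m i" by metis
  define M where "M = (\<Sum>i<n. \<bar>m i\<bar>)"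
  have M0: "M \<ge> 0" unfolding M_def by (intro sum_nonneg) auto
  have M: "\<bar>\<xi> i \<omega>\<bar> \<le> M" if "i < n" "\<omega> \<in> space P" for i \<omega>
  proof -
    have "\<bar>m i\<bar> \<le> M" unfolding M_def using that by (intro member_le_sum) auto
    with m[OF that] show ?thesis by linarith
  qed
  define c where "c = (\<lambda>u v i. max u (min (\<tau> i) v))"
  \<comment> \<open>If \<tau> i \<ge> v, the clamped time is v, and \<xi> i need not be measurable
    at that time. Its increment is zero anyway, so the coefficient is set to 0.\<close>
  define \<eta> where "\<eta> = (\<lambda>v i. if \<tau> i < v then \<xi> i else (\<lambda>_. 0))"
  have S_eq: "simple_integral W n \<tau> \<xi> v \<omega> - simple_integral W n \<tau> \<xi> u \<omega>
      = (\<Sum>i<n. \<eta> v i \<omega> * (W (c u v (Suc i)) \<omega> - W (c u v i) \<omega>))" if "u \<le> v" for u v \<omega>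
    unfolding simple_integral_def sum_subtractf[symmetric]
  proof (rule sum.cong[OF refl])
    fix i assume "i \<in> {..<n}"
    then have "\<tau> i \<le> \<tau> (Suc i)" using mono by auto
    with that show "\<xi> i \<omega> * (W (min (\<tau> (Suc i)) v) \<omega> - W (min (\<tau> i) v) \<omega>) - \<xi> i \<omega> * (W (min (\<tau> (Suc i)) u) \<omega> - W (min (\<tau> i) u) \<omega>)
        = \<eta> v i \<omega> * (W (c u v (Suc i)) \<omega> - W (c u v i) \<omega>)"
      unfolding c_def \<eta>_def by (auto simp: min_def max_def algebra_simps)
  qed
  have Q_eq: "clamp_sum n \<tau> \<xi> u v \<omega> = (\<Sum>i<n. (\<eta> v i \<omega>)\<^sup>2 * (c u v (Suc i) - c u v i))" if "u \<le> v" for u v \<omega>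
    unfolding clamp_sum_def
  proof (rule sum.cong[OF refl])
    fix i assume "i \<in> {..<n}"
    then have "\<tau> i \<le> \<tau> (Suc i)" using mono by auto
    with that show "(\<xi> i \<omega>)\<^sup>2 * (max u (min (\<tau> (Suc i)) v) - max u (min (\<tau> i) v)) = (\<eta> v i \<omega>)\<^sup>2 * (c u v (Suc i) - c u v i)"
      unfolding c_def \<eta>_def by (auto simp: min_def max_def)
  qed
  have c: "u \<le> c u v 0" "\<And>i. i < n \<Longrightarrow> c u v i \<le> c u v (Suc i)" "\<And>i. i \<le> n \<Longrightarrow> c u v i \<le> v" if "u \<le> v" for u v
  proof -
    show "u \<le> c u v 0" "\<And>i. i \<le> n \<Longrightarrow> c u v i \<le> v" using that by (auto simp: c_def)
    show "c u v i \<le> c u v (Suc i)" if "i < n" for i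
      unfolding c_def by (intro max.mono min.mono order.refl mono that)
  qed
  have \<eta>: "\<eta> v i \<in> borel_measurable (F (c u v i))" if "i < n" "0 \<le> u" "u \<le> v" for i u v
  proof (cases "\<tau> i < v")
    case True
    then have "\<tau> i \<le> c u v i" by (auto simp: c_def)
    then show ?thesis using measurable_F_mono[OF \<tau>pos _ \<xi>, of i "c u v i"] that True by (simp add: \<eta>_def)
  qed (simp add: \<eta>_def)
  have \<eta>M: "\<bar>\<eta> v i \<omega>\<bar> \<le> M" if "i < n" "\<omega> \<in> space P" for v i \<omega>
    using M[OF that] M0 by (auto simp: \<eta>_def)
  show thesis
  proof (rule that[of "2 * real n * 4 ^ n * M ^ 3" "M\<^sup>2"])
    show "simple_integral W n \<tau> \<xi> t \<in> borel_measurable (F t)" if t: "0 \<le> t" for t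
    proof -
      have z: "simple_integral W n \<tau> \<xi> 0 \<omega> = 0" for \<omega>
        unfolding simple_integral_def by (intro sum.neutral) (simp add: min_absorb2 \<tau>pos)
      have "(\<lambda>\<omega>. simple_integral W n \<tau> \<xi> t \<omega> - simple_integral W n \<tau> \<xi> 0 \<omega>) \<in> borel_measurable (F t)"
        unfolding S_eq[OF t]
      proof (rule measurable_F_mono[OF _ c(3)[OF t order.refl]])
        show "(\<lambda>\<omega>. \<Sum>i<n. \<eta> t i \<omega> * (W (c 0 t (Suc i)) \<omega> - W (c 0 t i) \<omega>)) \<in> borel_measurable (F (c 0 t n))"
          by (rule brownian_sum(1)[where u = 0 and v = t, OF order.refl c(1)[OF t] c(2)[OF t] c(3)[OF t] \<eta> \<eta>M M0])
            (use t in auto)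
      qed (simp add: c_def)
      then show ?thesis by (simp add: z)
    qed
    fix u v :: real assume uv: "0 \<le> u" "u \<le> v"
    note BS = brownian_sum[where c = "c u v" and \<eta> = "\<eta> v" and n = n and u = u and v = v and M = M,
        OF uv(1) c(1)[OF uv(2)] c(2)[OF uv(2)] c(3)[OF uv(2)] \<eta>[OF _ uv] \<eta>M M0]
    show "clamp_sum n \<tau> \<xi> u v \<in> borel_measurable (F v)"
      unfolding Q_eq[OF uv(2), abs_def] by (rule BS(2))
    show "integrable P (\<lambda>\<omega>. \<bar>simple_integral W n \<tau> \<xi> v \<omega> - simple_integral W n \<tau> \<xi> u \<omega>\<bar> ^ 3)"
      unfolding S_eq[OF uv(2)] by (rule BS(4))
    show "expectation (\<lambda>\<omega>. \<bar>simple_integral W n \<tau> \<xi> v \<omega> - simple_integral W n \<tau> \<xi> u \<omega>\<bar> ^ 3) \<le> 2 * real n * 4 ^ n * M ^ 3 * sqrt (v - u) ^ 3"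
      unfolding S_eq[OF uv(2)] by (rule BS(5))
    show "expectation (\<lambda>\<omega>. Z \<omega> * (simple_integral W n \<tau> \<xi> v \<omega> - simple_integral W n \<tau> \<xi> u \<omega>)) = 0 \<and>
        expectation (\<lambda>\<omega>. Z \<omega> * (simple_integral W n \<tau> \<xi> v \<omega> - simple_integral W n \<tau> \<xi> u \<omega>)\<^sup>2)
          = expectation (\<lambda>\<omega>. Z \<omega> * clamp_sum n \<tau> \<xi> u v \<omega>)"
      if "Z \<in> borel_measurable (F u)" "\<And>\<omega>. \<omega> \<in> space P \<Longrightarrow> \<bar>Z \<omega>\<bar> \<le> B" for Z B
      unfolding S_eq[OF uv(2)] Q_eq[OF uv(2)] by (rule BS(6)[OF _ _ _ _ _ that])
    fix \<omega> assume \<omega>: "\<omega> \<in> space P"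
    have "0 \<le> clamp_sum n \<tau> \<xi> u v \<omega>"
      unfolding Q_eq[OF uv(2)] using c(2)[OF uv(2)] by (intro sum_nonneg) auto
    moreover have "clamp_sum n \<tau> \<xi> u v \<omega> \<le> (\<Sum>i<n. M\<^sup>2 * (c u v (Suc i) - c u v i))"
      unfolding Q_eq[OF uv(2)]
    proof (rule sum_mono)
      fix i assume "i \<in> {..<n}"
      then have "(\<eta> v i \<omega>)\<^sup>2 \<le> M\<^sup>2" "c u v i \<le> c u v (Suc i)"
        using \<eta>M[of i \<omega> v] \<omega> M0 c(2)[OF uv(2)] by (auto simp: abs_le_square_iff[symmetric])
      then show "(\<eta> v i \<omega>)\<^sup>2 * (c u v (Suc i) - c u v i) \<le> M\<^sup>2 * (c u v (Suc i) - c u v i)"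
        by (intro mult_right_mono) auto
    qed
    moreover have "(\<Sum>i<n. M\<^sup>2 * (c u v (Suc i) - c u v i)) = M\<^sup>2 * (c u v n - c u v 0)"
      by (simp add: sum_distrib_left[symmetric] sum_lessThan_telescope)
    moreover have "M\<^sup>2 * (c u v n - c u v 0) \<le> M\<^sup>2 * (v - u)"
      using c(1)[OF uv(2)] c(3)[OF uv(2), of n] by (intro mult_left_mono) auto
    ultimately show "0 \<le> clamp_sum n \<tau> \<xi> u v \<omega> \<and> clamp_sum n \<tau> \<xi> u v \<omega> \<le> M\<^sup>2 * (v - u)" by linarith
  qed (use M0 in auto)
qed

end

section \<open>Second-order expansion over one time step\<close>

locale brownian_test = brownian_basis P F W + test_function t0 t1 M C h hs hy hyy
  for P :: "'a measure" and F W t0 t1 M C h hs hy hyy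
begin

text \<open>The weight Z is known at time u, so the term linear in \<open>S\<close> vanishes and
  \<open>(S \<omega>)\<^sup>2\<close> becomes \<open>Q\<close> in expectation. The drift increment
  \<open>D\<close> need not be known at time u; hence the product D S is not centred and has to be
  estimated. Being of size K (v - u), \<open>D\<close> makes all leftover terms of order (v -
  u)^(3/2), which is summable over a grid with vanishing total.\<close>

lemma one_step:
  fixes Yu D S Q Z :: "'a \<Rightarrow> real"
  assumes uv: "t0 \<le> u" "u < v" "v \<le> t1" "v - u \<le> 1"
    and Yu: "Yu \<in> borel_measurable (F u)" and Z: "Z \<in> borel_measurable (F u)"
    and Zb: "\<And>\<omega>. \<omega> \<in> space P \<Longrightarrow> 0 \<le> Z \<omega> \<and> Z \<omega> \<le> 1"
    and D: "D \<in> borel_measurable P" "\<And>\<omega>. \<omega> \<in> space P \<Longrightarrow> \<bar>D \<omega>\<bar> \<le> K * (v - u)"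
    and K: "K \<ge> 0" "CS \<ge> 0" "MQ \<ge> 0"
    and S: "S \<in> borel_measurable P" "integrable P (\<lambda>\<omega>. \<bar>S \<omega>\<bar> ^ 3)" "expectation (\<lambda>\<omega>. \<bar>S \<omega>\<bar> ^ 3) \<le> CS * sqrt (v - u) ^ 3"
    and Q: "Q \<in> borel_measurable P" "\<And>\<omega>. \<omega> \<in> space P \<Longrightarrow> 0 \<le> Q \<omega> \<and> Q \<omega> \<le> MQ * (v - u)"
    and mart: "\<And>Z B. Z \<in> borel_measurable (F u) \<Longrightarrow> (\<And>\<omega>. \<omega> \<in> space P \<Longrightarrow> \<bar>Z \<omega>\<bar> \<le> B) \<Longrightarrow>
        expectation (\<lambda>\<omega>. Z \<omega> * S \<omega>) = 0 \<and> expectation (\<lambda>\<omega>. Z \<omega> * (S \<omega>)\<^sup>2) = expectation (\<lambda>\<omega>. Z \<omega> * Q \<omega>)"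
  shows "expectation (\<lambda>\<omega>. Z \<omega> * h v (Yu \<omega> + D \<omega> + S \<omega>)) - expectation (\<lambda>\<omega>. Z \<omega> * h u (Yu \<omega>))
    \<le> expectation (\<lambda>\<omega>. Z \<omega> * (hs u (Yu \<omega>) * (v - u) + hy u (Yu \<omega>) * D \<omega> + hyy u (Yu \<omega>) * Q \<omega> / 2))
      + (M * K\<^sup>2 + M * K * (1 + MQ) + C * (2 + K + MQ + 4 * K ^ 3 + 4 * CS)) * ((v - u) * sqrt (v - u))"
proof -
  define \<delta> where "\<delta> = v - u"
  have \<delta>: "0 < \<delta>" "\<delta> \<le> 1" using uv by (auto simp: \<delta>_def)
  have u0: "0 \<le> u" "u \<le> t1" "t0 \<le> v" using uv times by auto
  note sm = slice_measurable[OF uv(1) u0(2)] slice_measurable[OF u0(3) uv(3)]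
  note [measurable] = sm
  have YP[measurable]: "Yu \<in> borel_measurable P" and ZP[measurable]: "Z \<in> borel_measurable P"
    using Yu Z measurable_F_imp u0 by auto
  note [measurable] = D(1) S(1) Q(1)
  note bM = hs_bound[OF uv(1) u0(2)] hy_bound[OF uv(1) u0(2)] hyy_bound[OF uv(1) u0(2)]
  note iS = integrable_of_cube[OF S(1,2)]
  have Zabs: "\<bar>Z \<omega>\<bar> \<le> 1" if "\<omega> \<in> space P" for \<omega> using Zb[OF that] by auto
  have Zm: "\<bar>Z \<omega> * g\<bar> \<le> B" if "\<omega> \<in> space P" "\<bar>g\<bar> \<le> B" for \<omega> g B
    using mult_mono[OF Zabs[OF that(1)] that(2)] by (simp add: abs_mult)
  have Zhyy: "\<bar>Z \<omega> * (hyy u (Yu \<omega>) / 2)\<bar> \<le> M" if "\<omega> \<in> space P" for \<omega>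
    using bM(3)[of "Yu \<omega>"] M_pos by (intro Zm that) auto
  \<comment> \<open>Everything to be discarded: the parts of the squared increment that contain
    \<open>D\<close>, and the Taylor remainder, with \<open>D\<close> replaced by its bound.\<close>
  define R where "R = (\<lambda>\<omega>. M / 2 * (K\<^sup>2 * \<delta>\<^sup>2 + 2 * K * \<delta> * \<bar>S \<omega>\<bar>)
      + C * (\<delta>\<^sup>2 + K * \<delta>\<^sup>2 + \<delta> * \<bar>S \<omega>\<bar> + 4 * (K ^ 3 * \<delta> ^ 3) + 4 * \<bar>S \<omega>\<bar> ^ 3))"
  define G1 where "G1 = (\<lambda>\<omega>. Z \<omega> * (hs u (Yu \<omega>) * \<delta> + hy u (Yu \<omega>) * D \<omega>))"
  define G2 where "G2 = (\<lambda>\<omega>. (Z \<omega> * hy u (Yu \<omega>)) * S \<omega>)"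
  define G3 where "G3 = (\<lambda>\<omega>. (Z \<omega> * (hyy u (Yu \<omega>) / 2)) * (S \<omega>)\<^sup>2)"
  have point: "Z \<omega> * h v (Yu \<omega> + D \<omega> + S \<omega>) - Z \<omega> * h u (Yu \<omega>) \<le> G1 \<omega> + G2 \<omega> + G3 \<omega> + R \<omega>"
    if \<omega>: "\<omega> \<in> space P" for \<omega>
  proof -
    let ?y = "Yu \<omega>" let ?d = "D \<omega> + S \<omega>"
    have Db: "\<bar>D \<omega>\<bar> \<le> K * \<delta>" using D(2)[OF \<omega>] by (simp add: \<delta>_def)
    have t: "h v (?y + ?d) - h u ?y \<le> hs u ?y * \<delta> + hy u ?y * ?d + hyy u ?y * ?d\<^sup>2 / 2 + C * (\<delta>\<^sup>2 + \<delta> * \<bar>?d\<bar> + \<bar>?d\<bar> ^ 3)"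
      using taylor[OF uv(1) order.strict_implies_order[OF uv(2)] uv(3), of ?y ?d] unfolding \<delta>_def by linarith
    have e: "hyy u ?y * ?d\<^sup>2 / 2 = hyy u ?y / 2 * (S \<omega>)\<^sup>2 + hyy u ?y / 2 * ((D \<omega>)\<^sup>2 + 2 * D \<omega> * S \<omega>)"
      by (simp add: power2_eq_square field_simps)
    have "\<bar>(D \<omega>)\<^sup>2 + 2 * D \<omega> * S \<omega>\<bar> \<le> K\<^sup>2 * \<delta>\<^sup>2 + 2 * K * \<delta> * \<bar>S \<omega>\<bar>"
    proof -
      have "(D \<omega>)\<^sup>2 \<le> (K * \<delta>)\<^sup>2" using Db by (metis abs_le_square_iff abs_of_nonneg abs_ge_zero order.trans)
      moreover have "\<bar>D \<omega>\<bar> * \<bar>S \<omega>\<bar> \<le> K * \<delta> * \<bar>S \<omega>\<bar>" using Db by (intro mult_right_mono) auto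
      moreover have "\<bar>(D \<omega>)\<^sup>2 + 2 * D \<omega> * S \<omega>\<bar> \<le> (D \<omega>)\<^sup>2 + 2 * (\<bar>D \<omega>\<bar> * \<bar>S \<omega>\<bar>)"
        by (rule order.trans[OF abs_triangle_ineq]) (simp add: abs_mult)
      ultimately show ?thesis by (simp add: power_mult_distrib)
    qed
    then have "\<bar>hyy u ?y / 2 * ((D \<omega>)\<^sup>2 + 2 * D \<omega> * S \<omega>)\<bar> \<le> M / 2 * (K\<^sup>2 * \<delta>\<^sup>2 + 2 * K * \<delta> * \<bar>S \<omega>\<bar>)"
      unfolding abs_mult[of "hyy u ?y / 2"] using bM(3)[of ?y] by (intro mult_mono) auto
    then have r1: "hyy u ?y / 2 * ((D \<omega>)\<^sup>2 + 2 * D \<omega> * S \<omega>) \<le> M / 2 * (K\<^sup>2 * \<delta>\<^sup>2 + 2 * K * \<delta> * \<bar>S \<omega>\<bar>)" by linarith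
    have r2: "\<delta>\<^sup>2 + \<delta> * \<bar>?d\<bar> + \<bar>?d\<bar> ^ 3 \<le> \<delta>\<^sup>2 + K * \<delta>\<^sup>2 + \<delta> * \<bar>S \<omega>\<bar> + 4 * (K ^ 3 * \<delta> ^ 3) + 4 * \<bar>S \<omega>\<bar> ^ 3"
    proof -
      have "\<bar>?d\<bar> \<le> K * \<delta> + \<bar>S \<omega>\<bar>" using Db by linarith
      then have "\<delta> * \<bar>?d\<bar> \<le> \<delta> * (K * \<delta> + \<bar>S \<omega>\<bar>)" using \<delta> by (intro mult_left_mono) auto
      moreover have "\<delta> * (K * \<delta> + \<bar>S \<omega>\<bar>) = K * \<delta>\<^sup>2 + \<delta> * \<bar>S \<omega>\<bar>" by (simp add: power2_eq_square algebra_simps)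
      moreover have "\<bar>D \<omega>\<bar> ^ 3 \<le> (K * \<delta>) ^ 3" using Db by (intro power_mono) auto
      moreover note abs_add_cube_le[of "D \<omega>" "S \<omega>"]
      ultimately show ?thesis by (simp add: power_mult_distrib)
    qed
    have r2': "C * (\<delta>\<^sup>2 + \<delta> * \<bar>?d\<bar> + \<bar>?d\<bar> ^ 3) \<le> C * (\<delta>\<^sup>2 + K * \<delta>\<^sup>2 + \<delta> * \<bar>S \<omega>\<bar> + 4 * (K ^ 3 * \<delta> ^ 3) + 4 * \<bar>S \<omega>\<bar> ^ 3)"
      using r2 C_pos by (intro mult_left_mono) auto
    have Rpos: "R \<omega> \<ge> 0" unfolding R_def using M_pos C_pos K \<delta> by (intro add_nonneg_nonneg mult_nonneg_nonneg) auto
    have "h v (?y + ?d) - h u ?y \<le> (hs u ?y * \<delta> + hy u ?y * D \<omega>) + hy u ?y * S \<omega> + hyy u ?y / 2 * (S \<omega>)\<^sup>2 + R \<omega>"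
      using t r1 r2' unfolding e R_def distrib_left[of "hy u ?y"] by linarith
    then have "Z \<omega> * (h v (?y + ?d) - h u ?y) \<le> Z \<omega> * ((hs u ?y * \<delta> + hy u ?y * D \<omega>) + hy u ?y * S \<omega> + hyy u ?y / 2 * (S \<omega>)\<^sup>2 + R \<omega>)"
      using Zb[OF \<omega>] by (intro mult_left_mono) auto
    also have "\<dots> = G1 \<omega> + G2 \<omega> + G3 \<omega> + Z \<omega> * R \<omega>" by (simp add: G1_def G2_def G3_def algebra_simps)
    also have "\<dots> \<le> G1 \<omega> + G2 \<omega> + G3 \<omega> + R \<omega>" using Zb[OF \<omega>] Rpos mult_right_mono[of "Z \<omega>" 1 "R \<omega>"] by auto
    finally show ?thesis by (simp add: algebra_simps add.assoc)
  qed
  have iR: "integrable P R" unfolding R_def using iS S(2) by auto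
  have iG1: "integrable P G1"
    unfolding G1_def
  proof (rule bounded_integrable[OF _ Zm])
    show "\<bar>hs u (Yu \<omega>) * \<delta> + hy u (Yu \<omega>) * D \<omega>\<bar> \<le> M * \<delta> + M * (K * (v - u))" if "\<omega> \<in> space P" for \<omega>
      by (rule order.trans[OF abs_triangle_ineq], unfold abs_mult) (use bM[of "Yu \<omega>"] D(2)[OF that] \<delta> M_pos in \<open>auto intro!: add_mono mult_mono\<close>)
  qed measurable
  have iG2: "integrable P G2" unfolding G2_def
    by (rule integrable_bounded_mult[OF iS(1) _ Zm[OF _ bM(2)]]) measurable
  have iG3: "integrable P G3" unfolding G3_def
    by (rule integrable_bounded_mult[OF iS(2) _ Zhyy]) measurable
  have hb: "\<bar>h s y\<bar> \<le> M" if "t0 \<le> s" "s \<le> t1" for s y using h_nonneg[OF that, of y] h_bound[OF that, of y] by simp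
  have ih: "integrable P (\<lambda>\<omega>. Z \<omega> * h v (Yu \<omega> + D \<omega> + S \<omega>))" "integrable P (\<lambda>\<omega>. Z \<omega> * h u (Yu \<omega>))"
    by (rule bounded_integrable[OF _ Zm[OF _ hb]]; use uv u0 in \<open>auto intro!: borel_measurable_times measurable_compose[OF _ sm(1)] measurable_compose[OF _ sm(5)]\<close>)+
  have "expectation (\<lambda>\<omega>. Z \<omega> * h v (Yu \<omega> + D \<omega> + S \<omega>)) - expectation (\<lambda>\<omega>. Z \<omega> * h u (Yu \<omega>))
      = expectation (\<lambda>\<omega>. Z \<omega> * h v (Yu \<omega> + D \<omega> + S \<omega>) - Z \<omega> * h u (Yu \<omega>))"
    using ih by simp
  also have "\<dots> \<le> expectation (\<lambda>\<omega>. G1 \<omega> + G2 \<omega> + G3 \<omega> + R \<omega>)"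
    by (intro integral_mono Bochner_Integration.integrable_diff ih Bochner_Integration.integrable_add iG1 iG2 iG3 iR point)
  also have "\<dots> = expectation G1 + expectation G2 + expectation G3 + expectation R"
    using iG1 iG2 iG3 iR by simp
  also have "expectation G2 = 0"
    unfolding G2_def using mart[of "\<lambda>\<omega>. Z \<omega> * hy u (Yu \<omega>)" M] Zm[OF _ bM(2)] Z measurable_compose[OF Yu sm(3)] by auto
  also have "expectation G3 = expectation (\<lambda>\<omega>. (Z \<omega> * (hyy u (Yu \<omega>) / 2)) * Q \<omega>)"
  proof -
    have "(\<lambda>\<omega>. Z \<omega> * (hyy u (Yu \<omega>) / 2)) \<in> borel_measurable (F u)"
      using Z measurable_compose[OF Yu sm(4)] by auto
    then show ?thesis unfolding G3_def using mart Zhyy by blast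
  qed
  also have "expectation R \<le> (M * K\<^sup>2 + M * K * (1 + MQ) + C * (2 + K + MQ + 4 * K ^ 3 + 4 * CS)) * (\<delta> * sqrt \<delta>)"
  proof -
    let ?q = "\<delta> * sqrt \<delta>"
    have s: "0 < sqrt \<delta>" "sqrt \<delta> \<le> 1" "sqrt \<delta> * sqrt \<delta> = \<delta>" using \<delta> by auto
    have "expectation (\<lambda>\<omega>. 1 * (S \<omega>)\<^sup>2) = expectation (\<lambda>\<omega>. 1 * Q \<omega>)" using mart[of "\<lambda>_. 1" 1] by auto
    also have "\<dots> \<le> expectation (\<lambda>\<omega>. MQ * \<delta>)"
      using Q(1) Q(2)[folded \<delta>_def] by (intro integral_mono bounded_integrable[where B = "MQ * \<delta>"]) (auto simp: abs_le_iff intro: order.trans)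
    finally have S2: "expectation (\<lambda>\<omega>. (S \<omega>)\<^sup>2) \<le> MQ * \<delta>" by (simp add: prob_space)
    \<comment> \<open>Young's inequality with weight sqrt \<delta> takes the place of Cauchy-Schwarz
      and gives the first absolute moment of order sqrt \<delta>.\<close>
    have "expectation (\<lambda>\<omega>. \<bar>S \<omega>\<bar>) \<le> expectation (\<lambda>\<omega>. sqrt \<delta> + (S \<omega>)\<^sup>2 / sqrt \<delta>)"
    proof (intro integral_mono)
      fix \<omega>
      have "0 \<le> (sqrt \<delta> - \<bar>S \<omega>\<bar> / 2)\<^sup>2" by simp
      then have "sqrt \<delta> * \<bar>S \<omega>\<bar> \<le> \<delta> + (S \<omega>)\<^sup>2 / 4"
        using s by (simp add: power2_eq_square algebra_simps)
      also have "\<dots> \<le> sqrt \<delta> * (sqrt \<delta> + (S \<omega>)\<^sup>2 / sqrt \<delta>)" using s by (simp add: distrib_left)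
      finally show "\<bar>S \<omega>\<bar> \<le> sqrt \<delta> + (S \<omega>)\<^sup>2 / sqrt \<delta>" using s by simp
    qed (use iS in auto)
    also have "\<dots> = sqrt \<delta> + expectation (\<lambda>\<omega>. (S \<omega>)\<^sup>2) / sqrt \<delta>" using iS by (simp add: prob_space)
    also have "\<dots> \<le> sqrt \<delta> + MQ * \<delta> / sqrt \<delta>" using S2 s by (intro add_left_mono divide_right_mono) auto
    also have "MQ * \<delta> / sqrt \<delta> = MQ * sqrt \<delta>" using s(3) s(1) by (simp add: field_simps)
    finally have S1: "expectation (\<lambda>\<omega>. \<bar>S \<omega>\<bar>) \<le> (1 + MQ) * sqrt \<delta>" by (simp add: algebra_simps)
    have q3: "sqrt \<delta> ^ 3 = ?q" using s by (simp add: power3_eq_cube)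
    have d2: "\<delta>\<^sup>2 \<le> ?q" "\<delta> ^ 3 \<le> ?q"
    proof -
      have "\<delta> \<le> sqrt \<delta>" using mult_left_mono[OF s(2), of "sqrt \<delta>"] s by simp
      then show d: "\<delta>\<^sup>2 \<le> ?q" unfolding power2_eq_square using \<delta> by (intro mult_left_mono) auto
      have "\<delta> ^ 3 \<le> \<delta> ^ 2" using \<delta> by (intro power_decreasing) auto
      with d show "\<delta> ^ 3 \<le> ?q" by linarith
    qed
    have S1': "\<delta> * expectation (\<lambda>\<omega>. \<bar>S \<omega>\<bar>) \<le> (1 + MQ) * ?q"
      using mult_left_mono[OF S1, of \<delta>] \<delta> by (simp add: mult_ac)
    have S3: "expectation (\<lambda>\<omega>. \<bar>S \<omega>\<bar> ^ 3) \<le> CS * ?q" using S(3) q3 by (simp add: \<delta>_def)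
    have q0: "?q \<ge> 0" using \<delta> by auto
    have "expectation R = M / 2 * (K\<^sup>2 * \<delta>\<^sup>2 + 2 * K * (\<delta> * expectation (\<lambda>\<omega>. \<bar>S \<omega>\<bar>)))
      + C * (\<delta>\<^sup>2 + K * \<delta>\<^sup>2 + \<delta> * expectation (\<lambda>\<omega>. \<bar>S \<omega>\<bar>) + 4 * (K ^ 3 * \<delta> ^ 3) + 4 * expectation (\<lambda>\<omega>. \<bar>S \<omega>\<bar> ^ 3))"
      unfolding R_def using iS S(2) by (simp add: prob_space algebra_simps)
    also have "\<dots> \<le> M / 2 * (K\<^sup>2 * ?q + 2 * K * ((1 + MQ) * ?q))
      + C * (?q + K * ?q + (1 + MQ) * ?q + 4 * (K ^ 3 * ?q) + 4 * (CS * ?q))"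
      using d2 S1' S3 K M_pos C_pos by (intro add_mono mult_left_mono) auto
    also have "\<dots> = (M / 2 * K\<^sup>2 + M * K * (1 + MQ) + C * (2 + K + MQ + 4 * K ^ 3 + 4 * CS)) * ?q"
      by (simp add: algebra_simps)
    also have "\<dots> \<le> (M * K\<^sup>2 + M * K * (1 + MQ) + C * (2 + K + MQ + 4 * K ^ 3 + 4 * CS)) * ?q"
      using mult_nonneg_nonneg[OF M_pos zero_le_power2[of K]] by (intro mult_right_mono q0) simp
    finally show ?thesis .
  qed
  also have "expectation G1 + 0 + expectation (\<lambda>\<omega>. (Z \<omega> * (hyy u (Yu \<omega>) / 2)) * Q \<omega>)
     = expectation (\<lambda>\<omega>. Z \<omega> * (hs u (Yu \<omega>) * (v - u) + hy u (Yu \<omega>) * D \<omega> + hyy u (Yu \<omega>) * Q \<omega> / 2))"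
  proof -
    have "integrable P (\<lambda>\<omega>. (Z \<omega> * (hyy u (Yu \<omega>) / 2)) * Q \<omega>)"
    proof (rule integrable_bounded_mult[OF bounded_integrable[OF Q(1)]])
      show "\<bar>Q \<omega>\<bar> \<le> MQ * (v - u)" if "\<omega> \<in> space P" for \<omega> using Q(2)[OF that] by auto
    qed (use Zhyy in auto)
    then have "expectation G1 + 0 + expectation (\<lambda>\<omega>. (Z \<omega> * (hyy u (Yu \<omega>) / 2)) * Q \<omega>)
        = expectation (\<lambda>\<omega>. G1 \<omega> + (Z \<omega> * (hyy u (Yu \<omega>) / 2)) * Q \<omega>)" using iG1 by simp
    also have "\<dots> = expectation (\<lambda>\<omega>. Z \<omega> * (hs u (Yu \<omega>) * (v - u) + hy u (Yu \<omega>) * D \<omega> + hyy u (Yu \<omega>) * Q \<omega> / 2))"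
      unfolding G1_def \<delta>_def by (intro Bochner_Integration.integral_cong) (auto simp: field_simps)
    finally show ?thesis .
  qed
  finally show ?thesis by (simp add: \<delta>_def)
qed

end

section \<open>Uniform grids and summation over their cells\<close>

definition grid :: "real \<Rightarrow> real \<Rightarrow> nat \<Rightarrow> nat \<Rightarrow> real" where
  "grid a b m j = a + real j * ((b - a) / real m)"

lemma grid_0: "grid a b m 0 = a" and grid_end: "m > 0 \<Longrightarrow> grid a b m m = b"
  and grid_Suc: "grid a b m (Suc j) - grid a b m j = (b - a) / real m"
  by (simp_all add: grid_def distrib_right add_divide_distrib)

lemma grid_mono: "a \<le> b \<Longrightarrow> i \<le> j \<Longrightarrow> grid a b m i \<le> grid a b m j"
  unfolding grid_def by (intro add_left_mono mult_right_mono) auto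

lemma grid_bounds:
  assumes "a \<le> b" "m > 0" "j \<le> m"
  shows "a \<le> grid a b m j" "grid a b m j \<le> b"
  using grid_mono[OF assms(1), of 0 j m] grid_mono[OF assms(1), of j m m] assms
  by (simp_all add: grid_0 grid_end)

text \<open>Cells are open on the left, as for simple processes, so a point of (a, b] lies in
  exactly one of them, and a step function takes the coefficient of that cell.\<close>

lemma grid_cell:
  assumes "m > 0" "a < s" "s \<le> b"
  obtains j where "j < m" "grid a b m j < s" "s \<le> grid a b m (Suc j)"
    "\<And>c :: nat \<Rightarrow> real. (\<Sum>i<m. c i * indicator {grid a b m i<..grid a b m (Suc i)} s) = c j"
proof -
  let ?p = "grid a b m"
  have ab: "a \<le> b" using assms by simp
  define j where "j = (LEAST i. s \<le> ?p (Suc i))"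
  have ex: "s \<le> ?p (Suc (m - 1))" using assms grid_end[of m a b] by simp
  have j1: "s \<le> ?p (Suc j)" unfolding j_def by (rule LeastI[of "\<lambda>i. s \<le> ?p (Suc i)", OF ex])
  have "j \<le> m - 1" unfolding j_def by (rule Least_le[of "\<lambda>i. s \<le> ?p (Suc i)", OF ex])
  then have j2: "j < m" using assms by simp
  have j3: "?p j < s"
  proof (cases j)
    case 0 then show ?thesis using assms by (simp add: grid_0)
  next
    case (Suc i)
    then have "\<not> s \<le> ?p (Suc i)" unfolding j_def using not_less_Least[of i "\<lambda>i. s \<le> ?p (Suc i)"] by simp
    then show ?thesis using Suc by simp
  qed
  have "indicator {?p i<..?p (Suc i)} s = (if i = j then 1 else 0 :: real)" for i
  proof (cases i j rule: linorder_cases)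
    case less
    then have "?p (Suc i) \<le> ?p j" using grid_mono[OF ab] by simp
    then show ?thesis using less j3 by simp
  next
    case greater
    then have "?p (Suc j) \<le> ?p i" using grid_mono[OF ab] by simp
    then show ?thesis using greater j1 by simp
  qed (use j1 j3 in auto)
  then have "(\<Sum>i<m. c i * indicator {?p i<..?p (Suc i)} s) = c j" for c :: "nat \<Rightarrow> real"
    using j2 by (simp add: if_distrib[where f = "\<lambda>x. c _ * x"] cong: if_cong)
  then show thesis using that j1 j2 j3 by blast
qed

context brownian_test
begin

text \<open>The m errors of order (mesh)^(3/2) add up to order (mesh)^(1/2). \<open>C'\<close> may
  depend on the simple integrand and on \<open>K\<close> but not on m, so the error disappears when
  the grid is refined for a fixed integrand. \<Theta> is any decreasing adapted weight; the clock
  weight is inserted later.\<close>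

lemma grid_inequality:
  fixes V Y \<Theta> :: "real \<Rightarrow> 'a \<Rightarrow> real"
  assumes sd: "simple_data F n \<tau> \<xi>"
    and V: "\<And>s. 0 \<le> s \<Longrightarrow> V s \<in> borel_measurable (F s)" and K: "K \<ge> 0"
    and VK: "\<And>u v \<omega>. 0 \<le> u \<Longrightarrow> u \<le> v \<Longrightarrow> \<omega> \<in> space P \<Longrightarrow> \<bar>V v \<omega> - V u \<omega>\<bar> \<le> K * (v - u)"
    and \<Theta>: "\<And>s. 0 \<le> s \<Longrightarrow> \<Theta> s \<in> borel_measurable (F s)"
    and \<Theta>b: "\<And>s \<omega>. 0 \<le> s \<Longrightarrow> \<omega> \<in> space P \<Longrightarrow> 0 \<le> \<Theta> s \<omega> \<and> \<Theta> s \<omega> \<le> 1"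
    and \<Theta>d: "\<And>u v \<omega>. 0 \<le> u \<Longrightarrow> u \<le> v \<Longrightarrow> \<omega> \<in> space P \<Longrightarrow> \<Theta> v \<omega> \<le> \<Theta> u \<omega>"
    and Y_def: "Y = (\<lambda>s \<omega>. V s \<omega> + simple_integral W n \<tau> \<xi> s \<omega>)"
  defines "G \<equiv> \<lambda>m \<omega>. \<Sum>j<m. \<Theta> (grid t0 t1 m j) \<omega> *
          (hs (grid t0 t1 m j) (Y (grid t0 t1 m j) \<omega>) * (grid t0 t1 m (Suc j) - grid t0 t1 m j)
          + hy (grid t0 t1 m j) (Y (grid t0 t1 m j) \<omega>) * (V (grid t0 t1 m (Suc j)) \<omega> - V (grid t0 t1 m j) \<omega>)
          + hyy (grid t0 t1 m j) (Y (grid t0 t1 m j) \<omega>) * clamp_sum n \<tau> \<xi> (grid t0 t1 m j) (grid t0 t1 m (Suc j)) \<omega> / 2)"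
  obtains C' where "C' \<ge> 0"
    "\<And>m. 0 < m \<Longrightarrow> (t1 - t0) / real m \<le> 1 \<Longrightarrow> G m \<in> borel_measurable P \<and>
       expectation (\<lambda>\<omega>. \<Theta> t1 \<omega> * h t1 (Y t1 \<omega>))
         \<le> expectation (\<lambda>\<omega>. \<Theta> t0 \<omega> * h t0 (Y t0 \<omega>)) + expectation (G m) + C' * sqrt ((t1 - t0) / real m)"
proof -
  let ?X = "simple_integral W n \<tau> \<xi>" and ?Q = "clamp_sum n \<tau> \<xi>"
  obtain CS MQ where CS: "CS \<ge> 0" and MQ: "MQ \<ge> 0"
    and X: "\<And>t. 0 \<le> t \<Longrightarrow> ?X t \<in> borel_measurable (F t)"
    and QF: "\<And>u v. 0 \<le> u \<Longrightarrow> u \<le> v \<Longrightarrow> ?Q u v \<in> borel_measurable (F v)"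
    and Qb: "\<And>u v \<omega>. 0 \<le> u \<Longrightarrow> u \<le> v \<Longrightarrow> \<omega> \<in> space P \<Longrightarrow> 0 \<le> ?Q u v \<omega> \<and> ?Q u v \<omega> \<le> MQ * (v - u)"
    and i3: "\<And>u v. 0 \<le> u \<Longrightarrow> u \<le> v \<Longrightarrow> integrable P (\<lambda>\<omega>. \<bar>?X v \<omega> - ?X u \<omega>\<bar> ^ 3)"
    and e3: "\<And>u v. 0 \<le> u \<Longrightarrow> u \<le> v \<Longrightarrow> expectation (\<lambda>\<omega>. \<bar>?X v \<omega> - ?X u \<omega>\<bar> ^ 3) \<le> CS * sqrt (v - u) ^ 3"
    and mart: "\<And>u v Z B. 0 \<le> u \<Longrightarrow> u \<le> v \<Longrightarrow> Z \<in> borel_measurable (F u) \<Longrightarrow> (\<And>\<omega>. \<omega> \<in> space P \<Longrightarrow> \<bar>Z \<omega>\<bar> \<le> B) \<Longrightarrow>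
        expectation (\<lambda>\<omega>. Z \<omega> * (?X v \<omega> - ?X u \<omega>)) = 0 \<and>
        expectation (\<lambda>\<omega>. Z \<omega> * (?X v \<omega> - ?X u \<omega>)\<^sup>2) = expectation (\<lambda>\<omega>. Z \<omega> * ?Q u v \<omega>)"
    by (rule simple_integral_increment[OF sd]) blast
  have YF: "Y s \<in> borel_measurable (F s)" if "0 \<le> s" for s
    unfolding Y_def using V[OF that] X[OF that] by measurable
  note VP = measurable_F_imp[OF _ V] and XP = measurable_F_imp[OF _ X] and \<Theta>P = measurable_F_imp[OF _ \<Theta>] and YP = measurable_F_imp[OF _ YF]
  define c0 where "c0 = M * K\<^sup>2 + M * K * (1 + MQ) + C * (2 + K + MQ + 4 * K ^ 3 + 4 * CS)"
  have c0: "c0 \<ge> 0" unfolding c0_def using M_pos C_pos K MQ CS by (intro add_nonneg_nonneg mult_nonneg_nonneg) auto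
  show thesis
  proof (rule that[of "c0 * (t1 - t0)"])
    show "c0 * (t1 - t0) \<ge> 0" using c0 times by auto
    fix m :: nat assume m: "0 < m" and \<Delta>1: "(t1 - t0) / real m \<le> 1"
    let ?p = "grid t0 t1 m"
    define \<Delta> where "\<Delta> = (t1 - t0) / real m"
    have \<Delta>: "0 < \<Delta>" "\<Delta> \<le> 1" using m \<Delta>1 times by (auto simp: \<Delta>_def)
    have p\<Delta>: "?p (Suc j) - ?p j = \<Delta>" for j by (simp add: grid_Suc \<Delta>_def)
    have p: "t0 \<le> ?p j" "?p j \<le> t1" "0 \<le> ?p j" if "j \<le> m" for j
      using grid_bounds[of t0 t1 m j] m that times by auto
    define g where "g = (\<lambda>j \<omega>. \<Theta> (?p j) \<omega> * (hs (?p j) (Y (?p j) \<omega>) * \<Delta>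
          + hy (?p j) (Y (?p j) \<omega>) * (V (?p (Suc j)) \<omega> - V (?p j) \<omega>)
          + hyy (?p j) (Y (?p j) \<omega>) * ?Q (?p j) (?p (Suc j)) \<omega> / 2))"
    have G: "G m = (\<lambda>\<omega>. \<Sum>j<m. g j \<omega>)" unfolding G_def g_def p\<Delta> ..
    have gm: "g j \<in> borel_measurable P" if "j < m" for j
    proof -
      have pj: "t0 \<le> ?p j" "?p j \<le> t1" "0 \<le> ?p j" "0 \<le> ?p (Suc j)" using p[of j] p[of "Suc j"] that by auto
      have le: "?p j \<le> ?p (Suc j)" using p\<Delta>[of j] \<Delta> by linarith
      note [measurable] = YP[OF pj(3) pj(3)] VP[OF pj(3) pj(3)] VP[OF pj(4) pj(4)] \<Theta>P[OF pj(3) pj(3)]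
        measurable_F_imp[OF pj(4) QF[OF pj(3) le]] slice_measurable[OF pj(1,2)]
      show ?thesis unfolding g_def by measurable
    qed
    have gi: "integrable P (g j)" if "j < m" for j
    proof (rule bounded_integrable[OF gm[OF that]])
      fix \<omega> assume \<omega>: "\<omega> \<in> space P"
      let ?y = "Y (?p j) \<omega>"
      have pj: "t0 \<le> ?p j" "?p j \<le> t1" "0 \<le> ?p j" using p[of j] that by auto
      have le: "?p j \<le> ?p (Suc j)" using p\<Delta>[of j] \<Delta> by linarith
      have 1: "\<bar>hs (?p j) ?y * \<Delta>\<bar> \<le> M * \<Delta>"
        using hs_bound[OF pj(1,2), of ?y] \<Delta> by (simp add: abs_mult)
      have 2: "\<bar>hy (?p j) ?y * (V (?p (Suc j)) \<omega> - V (?p j) \<omega>)\<bar> \<le> M * (K * \<Delta>)"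
        unfolding abs_mult using hy_bound[OF pj(1,2), of ?y] VK[OF pj(3) le \<omega>] p\<Delta>[of j] M_pos by (intro mult_mono) auto
      have 3: "\<bar>hyy (?p j) ?y * ?Q (?p j) (?p (Suc j)) \<omega>\<bar> \<le> M * (MQ * \<Delta>)"
        unfolding abs_mult using hyy_bound[OF pj(1,2), of ?y] Qb[OF pj(3) le \<omega>] p\<Delta>[of j] M_pos by (intro mult_mono) auto
      have "\<bar>hs (?p j) ?y * \<Delta> + hy (?p j) ?y * (V (?p (Suc j)) \<omega> - V (?p j) \<omega>) + hyy (?p j) ?y * ?Q (?p j) (?p (Suc j)) \<omega> / 2\<bar>
          \<le> M * \<Delta> + M * (K * \<Delta>) + M * (MQ * \<Delta>)"
        using 1 2 3 by linarith
      then have "\<bar>\<Theta> (?p j) \<omega>\<bar> * \<bar>hs (?p j) ?y * \<Delta> + hy (?p j) ?y * (V (?p (Suc j)) \<omega> - V (?p j) \<omega>) + hyy (?p j) ?y * ?Q (?p j) (?p (Suc j)) \<omega> / 2\<bar>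
          \<le> 1 * (M * \<Delta> + M * (K * \<Delta>) + M * (MQ * \<Delta>))"
        using \<Theta>b[OF pj(3) \<omega>] by (intro mult_mono) auto
      then show "\<bar>g j \<omega>\<bar> \<le> M * \<Delta> + M * (K * \<Delta>) + M * (MQ * \<Delta>)" by (simp add: g_def abs_mult)
    qed
    have ih: "integrable P (\<lambda>\<omega>. \<Theta> u \<omega> * h v (Y v \<omega>))" if "t0 \<le> u" "u \<le> t1" "t0 \<le> v" "v \<le> t1" for u v
    proof (rule bounded_integrable)
      have uv: "0 \<le> u" "0 \<le> v" using that times by auto
      note [measurable] = YP[OF uv(2) uv(2)] \<Theta>P[OF uv(1) uv(1)] slice_measurable[OF that(3,4)]
      show "(\<lambda>\<omega>. \<Theta> u \<omega> * h v (Y v \<omega>)) \<in> borel_measurable P" by measurable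
      fix \<omega> assume "\<omega> \<in> space P"
      then have "\<bar>\<Theta> u \<omega>\<bar> * \<bar>h v (Y v \<omega>)\<bar> \<le> 1 * M"
        using \<Theta>b[of u \<omega>] h_bound[of v "Y v \<omega>"] h_nonneg[of v "Y v \<omega>"] that times by (intro mult_mono) auto
      then show "\<bar>\<Theta> u \<omega> * h v (Y v \<omega>)\<bar> \<le> M" by (simp add: abs_mult)
    qed
    have step: "expectation (\<lambda>\<omega>. \<Theta> (?p (Suc j)) \<omega> * h (?p (Suc j)) (Y (?p (Suc j)) \<omega>))
        \<le> expectation (\<lambda>\<omega>. \<Theta> (?p j) \<omega> * h (?p j) (Y (?p j) \<omega>)) + expectation (g j) + c0 * (\<Delta> * sqrt \<Delta>)"
      if j: "j < m" for j
    proof -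
      have pj: "t0 \<le> ?p j" "?p j \<le> t1" "0 \<le> ?p j" using p[of j] j by auto
      have ps: "t0 \<le> ?p (Suc j)" "?p (Suc j) \<le> t1" "0 \<le> ?p (Suc j)" using p[of "Suc j"] j by auto
      have lt: "?p j < ?p (Suc j)" using p\<Delta>[of j] \<Delta> by linarith
      \<comment> \<open>Since \<Theta> decreases and h is nonnegative, the weight may be frozen at
        the left end of the cell, where it is known at the start of the step as
        \<open>one_step\<close> requires. This turns the formula into an inequality.\<close>
      have "expectation (\<lambda>\<omega>. \<Theta> (?p (Suc j)) \<omega> * h (?p (Suc j)) (Y (?p (Suc j)) \<omega>))
          \<le> expectation (\<lambda>\<omega>. \<Theta> (?p j) \<omega> * h (?p (Suc j)) (Y (?p (Suc j)) \<omega>))"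
        using lt pj ps h_nonneg[OF ps(1,2)] by (intro integral_mono ih mult_right_mono \<Theta>d) auto
      also have "expectation (\<lambda>\<omega>. \<Theta> (?p j) \<omega> * h (?p (Suc j)) (Y (?p (Suc j)) \<omega>))
          = expectation (\<lambda>\<omega>. \<Theta> (?p j) \<omega> * h (?p (Suc j)) (Y (?p j) \<omega> + (V (?p (Suc j)) \<omega> - V (?p j) \<omega>) + (?X (?p (Suc j)) \<omega> - ?X (?p j) \<omega>)))"
        unfolding Y_def by (simp add: algebra_simps)
      also have "expectation (\<lambda>\<omega>. \<Theta> (?p j) \<omega> * h (?p (Suc j)) (Y (?p j) \<omega> + (V (?p (Suc j)) \<omega> - V (?p j) \<omega>) + (?X (?p (Suc j)) \<omega> - ?X (?p j) \<omega>)))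
         \<le> expectation (\<lambda>\<omega>. \<Theta> (?p j) \<omega> * h (?p j) (Y (?p j) \<omega>)) + expectation (g j) + c0 * (\<Delta> * sqrt \<Delta>)"
      proof -
        have "expectation (\<lambda>\<omega>. \<Theta> (?p j) \<omega> * h (?p (Suc j)) (Y (?p j) \<omega> + (V (?p (Suc j)) \<omega> - V (?p j) \<omega>) + (?X (?p (Suc j)) \<omega> - ?X (?p j) \<omega>)))
           - expectation (\<lambda>\<omega>. \<Theta> (?p j) \<omega> * h (?p j) (Y (?p j) \<omega>))
          \<le> expectation (\<lambda>\<omega>. \<Theta> (?p j) \<omega> * (hs (?p j) (Y (?p j) \<omega>) * (?p (Suc j) - ?p j)
              + hy (?p j) (Y (?p j) \<omega>) * (V (?p (Suc j)) \<omega> - V (?p j) \<omega>)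
              + hyy (?p j) (Y (?p j) \<omega>) * ?Q (?p j) (?p (Suc j)) \<omega> / 2))
            + c0 * ((?p (Suc j) - ?p j) * sqrt (?p (Suc j) - ?p j))"
          unfolding c0_def
        proof (rule one_step[OF pj(1) lt ps(2)])
          show "(\<lambda>\<omega>. V (?p (Suc j)) \<omega> - V (?p j) \<omega>) \<in> borel_measurable P"
            using VP[OF pj(3) pj(3)] VP[OF ps(3) ps(3)] by measurable
          show "(\<lambda>\<omega>. ?X (?p (Suc j)) \<omega> - ?X (?p j) \<omega>) \<in> borel_measurable P"
            using XP[OF pj(3) pj(3)] XP[OF ps(3) ps(3)] by measurable
          show "?Q (?p j) (?p (Suc j)) \<in> borel_measurable P"
            using measurable_F_imp[OF ps(3) QF[OF pj(3)]] lt by auto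
          fix Z :: "'a \<Rightarrow> real" and B :: real
          assume "Z \<in> borel_measurable (F (?p j))" "\<And>\<omega>. \<omega> \<in> space P \<Longrightarrow> \<bar>Z \<omega>\<bar> \<le> B"
          then show "expectation (\<lambda>\<omega>. Z \<omega> * (?X (?p (Suc j)) \<omega> - ?X (?p j) \<omega>)) = 0 \<and>
              expectation (\<lambda>\<omega>. Z \<omega> * (?X (?p (Suc j)) \<omega> - ?X (?p j) \<omega>)\<^sup>2) = expectation (\<lambda>\<omega>. Z \<omega> * ?Q (?p j) (?p (Suc j)) \<omega>)"
            by (rule mart[OF pj(3) less_imp_le[OF lt]])
        qed (use YF[OF pj(3)] \<Theta>[OF pj(3)] \<Theta>b[OF pj(3)] VK[OF pj(3) less_imp_le[OF lt]] K CS MQ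
            i3[OF pj(3) less_imp_le[OF lt]] e3[OF pj(3) less_imp_le[OF lt]] Qb[OF pj(3) less_imp_le[OF lt]]
            p\<Delta>[of j] \<Delta> in \<open>simp_all\<close>)
        then show ?thesis unfolding p\<Delta> g_def by linarith
      qed
      finally show ?thesis .
    qed
    have ind: "expectation (\<lambda>\<omega>. \<Theta> (?p k) \<omega> * h (?p k) (Y (?p k) \<omega>))
        \<le> expectation (\<lambda>\<omega>. \<Theta> t0 \<omega> * h t0 (Y t0 \<omega>)) + expectation (\<lambda>\<omega>. \<Sum>j<k. g j \<omega>) + real k * (c0 * (\<Delta> * sqrt \<Delta>))"
      if "k \<le> m" for k
      using that
    proof (induction k)
      case (Suc k)
      have "expectation (\<lambda>\<omega>. \<Sum>j<Suc k. g j \<omega>) = expectation (\<lambda>\<omega>. \<Sum>j<k. g j \<omega>) + expectation (g k)"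
        unfolding sum.lessThan_Suc using Suc.prems gi
        by (intro Bochner_Integration.integral_add Bochner_Integration.integrable_sum) auto
      then show ?case using Suc.IH Suc.prems step[of k] by (simp add: algebra_simps)
    qed (simp add: grid_0)
    have "real m * (c0 * (\<Delta> * sqrt \<Delta>)) = c0 * (t1 - t0) * sqrt \<Delta>"
      using m by (simp add: \<Delta>_def)
    moreover have "?p m = t1" using m by (rule grid_end)
    moreover have "G m \<in> borel_measurable P" unfolding G by (intro borel_measurable_sum gm) auto
    ultimately show "G m \<in> borel_measurable P \<and>
       expectation (\<lambda>\<omega>. \<Theta> t1 \<omega> * h t1 (Y t1 \<omega>))
         \<le> expectation (\<lambda>\<omega>. \<Theta> t0 \<omega> * h t0 (Y t0 \<omega>)) + expectation (G m) + c0 * (t1 - t0) * sqrt ((t1 - t0) / real m)"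
      using ind[of m] unfolding G[symmetric] \<Delta>_def by simp
  qed
qed

end

section \<open>The It\^o inequality\<close>

lemma set_integrable_Icc_Ioc:
  fixes f :: "real \<Rightarrow> real"
  shows "set_integrable lborel {a..b} f \<longleftrightarrow> set_integrable lborel {a<..b} f"
proof (cases "a \<le> b")
  case True
  have pt: "set_integrable lborel {a} f"
  proof -
    have "(\<lambda>x. indicat_real {a} x *\<^sub>R f x) = (\<lambda>x. f a * indicat_real {a} x)" by (auto simp: indicator_def)
    then show ?thesis unfolding set_integrable_def by simp
  qed
  have eq: "{a..b} = {a} \<union> {a<..b}" using True by auto
  show ?thesis
  proof
    assume "set_integrable lborel {a<..b} f"
    with pt show "set_integrable lborel {a..b} f" unfolding eq by (intro set_integrable_Un) auto
  qed (auto elim: set_integrable_subset)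
qed simp

text \<open>Integrability is not assumed: it holds on both intervals or on neither, and in the
  second case both integrals are 0 by convention.\<close>

lemma set_integral_Icc_Ioc:
  fixes f :: "real \<Rightarrow> real"
  shows "(LINT x:{a..b}|lborel. f x) = (LINT x:{a<..b}|lborel. f x)"
proof (cases "a \<le> b")
  case True
  have pt: "(\<lambda>x. indicat_real {a} x *\<^sub>R f x) = (\<lambda>x. f a * indicat_real {a} x)" by (auto simp: indicator_def)
  have eq: "{a..b} = {a} \<union> {a<..b}" using True by auto
  show ?thesis
  proof (cases "set_integrable lborel {a<..b} f")
    case int: True
    have "set_integrable lborel {a} f" unfolding set_integrable_def pt by simp
    then have "(LINT x:{a} \<union> {a<..b}|lborel. f x) = (LINT x:{a}|lborel. f x) + (LINT x:{a<..b}|lborel. f x)"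
      using int by (intro set_integral_Un) auto
    moreover have "(LINT x:{a}|lborel. f x) = 0" unfolding set_lebesgue_integral_def pt by simp
    ultimately show ?thesis unfolding eq by simp
  next
    case False
    moreover have "\<not> set_integrable lborel {a..b} f" using False set_integrable_Icc_Ioc by simp
    ultimately show ?thesis
      unfolding set_lebesgue_integral_def set_integrable_def by (simp add: not_integrable_integral_eq)
  qed
qed simp

lemma set_integral_Icc_diff:
  fixes f :: "real \<Rightarrow> real"
  assumes "set_integrable lborel {0..T} f" "0 \<le> u" "u \<le> v" "v \<le> T"
  shows "(LINT x:{0..v}|lborel. f x) - (LINT x:{0..u}|lborel. f x) = (LINT x:{u<..v}|lborel. f x)"
proof -
  have "{0..v} = {0..u} \<union> {u<..v}" using assms by auto
  moreover have "(LINT x:{0..u} \<union> {u<..v}|lborel. f x) = (LINT x:{0..u}|lborel. f x) + (LINT x:{u<..v}|lborel. f x)"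
    by (rule set_integral_Un; (rule set_integrable_subset[OF assms(1)])?) (use assms in auto)
  ultimately show ?thesis by simp
qed

lemma continuous_on_set_integral:
  fixes f :: "real \<Rightarrow> real"
  assumes f: "set_integrable lborel {0..T} f"
  shows "continuous_on {0..T} (\<lambda>s. LINT x:{0..s}|lborel. f x)"
proof -
  have "continuous_on {0..T} (\<lambda>s. integral {0..s} f)"
    using set_borel_integral_eq_integral(1)[OF f] by (rule indefinite_integral_continuous_1)
  then show ?thesis
  proof (rule continuous_on_cong[THEN iffD1, rotated -1, OF _ refl])
    fix s assume "s \<in> {0..T}"
    then have "set_integrable lborel {0..s} f" by (intro set_integrable_subset[OF f]) auto
    then show "integral {0..s} f = (LINT x:{0..s}|lborel. f x)" by (rule set_borel_integral_eq_integral(2)[symmetric])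
  qed
qed

text \<open>Split r_k f_k - r_0 f_0 into r_k (f_k - f_0), which is small by the L1 convergence and
  the uniform bound \<open>M\<close>, and (r_k - r_0) f_0, which is handled by dominated
  convergence.\<close>

lemma set_integral_product_limit:
  fixes f r :: "nat \<Rightarrow> real \<Rightarrow> real"
  assumes A: "A \<in> sets lborel"
    and f: "\<And>k. set_integrable lborel A (f k)" "set_integrable lborel A f0"
    and lim: "(\<lambda>k. LINT s:A|lborel. \<bar>f k s - f0 s\<bar>) \<longlonglongrightarrow> 0"
    and r: "\<And>k. r k \<in> borel_measurable lborel" "\<And>k s. s \<in> A \<Longrightarrow> \<bar>r k s\<bar> \<le> M"
    and rlim: "\<And>s. s \<in> A \<Longrightarrow> (\<lambda>k. r k s) \<longlonglongrightarrow> r0 s"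
  shows "(\<lambda>k. LINT s:A|lborel. r k s * f k s) \<longlonglongrightarrow> (LINT s:A|lborel. r0 s * f0 s)"
proof -
  let ?g = "\<lambda>s. indicat_real A s * f0 s"
  have g: "integrable lborel ?g" using f(2) by (simp add: set_integrable_def)
  have gk: "integrable lborel (\<lambda>s. indicat_real A s * f k s)" for k using f(1) by (simp add: set_integrable_def)
  have [measurable]: "?g \<in> borel_measurable lborel" using g by auto
  have int_r: "integrable lborel (\<lambda>s. r k s * (indicat_real A s * u s))"
    if "integrable lborel (\<lambda>s. indicat_real A s * u s)" for k u
  proof (rule Bochner_Integration.integrable_bound[OF integrable_mult_right[OF that, of M]])
    show "(\<lambda>s. r k s * (indicat_real A s * u s)) \<in> borel_measurable lborel"
      by (rule borel_measurable_times[OF r(1) borel_measurable_integrable[OF that]])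
    show "AE s in lborel. norm (r k s * (indicat_real A s * u s)) \<le> norm (M * (indicat_real A s * u s))"
    proof (rule AE_I2)
      fix s
      show "norm (r k s * (indicat_real A s * u s)) \<le> norm (M * (indicat_real A s * u s))"
      proof (cases "s \<in> A")
        case True
        then have "\<bar>r k s\<bar> \<le> \<bar>M\<bar>" using r(2)[OF True, of k] by linarith
        then show ?thesis by (simp add: abs_mult mult_right_mono)
      qed simp
    qed
  qed
  have 2: "(\<lambda>k. \<integral>s. r k s * ?g s \<partial>lborel) \<longlonglongrightarrow> (\<integral>s. r0 s * ?g s \<partial>lborel)"
  proof (rule integral_dominated_convergence[where w = "\<lambda>s. \<bar>M\<bar> * \<bar>?g s\<bar>"])
    have lim_pt: "(\<lambda>k. r k s * ?g s) \<longlonglongrightarrow> r0 s * ?g s" for s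
      by (cases "s \<in> A") (auto intro!: tendsto_intros rlim)
    then show "AE s in lborel. (\<lambda>k. r k s * ?g s) \<longlonglongrightarrow> r0 s * ?g s" by simp
    show m: "(\<lambda>s. r k s * ?g s) \<in> borel_measurable lborel" for k using r(1) by measurable
    show "(\<lambda>s. r0 s * ?g s) \<in> borel_measurable lborel"
      by (rule borel_measurable_LIMSEQ_real[OF lim_pt m])
    show "integrable lborel (\<lambda>s. \<bar>M\<bar> * \<bar>?g s\<bar>)" using g by auto
    show "AE s in lborel. norm (r k s * ?g s) \<le> \<bar>M\<bar> * \<bar>?g s\<bar>" for k
    proof (rule AE_I2)
      fix s
      show "norm (r k s * ?g s) \<le> \<bar>M\<bar> * \<bar>?g s\<bar>"
      proof (cases "s \<in> A")
        case True
        then have "\<bar>r k s\<bar> \<le> \<bar>M\<bar>" using r(2)[OF True, of k] by linarith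
        then show ?thesis by (simp add: abs_mult mult_right_mono)
      qed simp
    qed
  qed
  have d: "integrable lborel (\<lambda>s. indicat_real A s * (f k s - f0 s))" for k
    using gk[of k] g by (simp add: right_diff_distrib)
  have 1: "(\<lambda>k. \<integral>s. r k s * (indicat_real A s * (f k s - f0 s)) \<partial>lborel) \<longlonglongrightarrow> 0"
  proof (rule Lim_null_comparison)
    show "\<forall>\<^sub>F k in sequentially. norm (\<integral>s. r k s * (indicat_real A s * (f k s - f0 s)) \<partial>lborel)
        \<le> \<bar>M\<bar> * (LINT s:A|lborel. \<bar>f k s - f0 s\<bar>)"
    proof (rule always_eventually, rule allI)
      fix k
      have "norm (\<integral>s. r k s * (indicat_real A s * (f k s - f0 s)) \<partial>lborel)
          \<le> (\<integral>s. norm (r k s * (indicat_real A s * (f k s - f0 s))) \<partial>lborel)"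
        by (rule integral_norm_bound)
      also have "\<dots> \<le> (\<integral>s. \<bar>M\<bar> * (indicat_real A s * \<bar>f k s - f0 s\<bar>) \<partial>lborel)"
      proof (rule integral_mono)
        show "integrable lborel (\<lambda>s. norm (r k s * (indicat_real A s * (f k s - f0 s))))"
          by (intro integrable_norm int_r d)
        have "integrable lborel (\<lambda>s. \<bar>indicat_real A s * (f k s - f0 s)\<bar>)" using d[of k] by (rule integrable_abs)
        then show "integrable lborel (\<lambda>s. \<bar>M\<bar> * (indicat_real A s * \<bar>f k s - f0 s\<bar>))" by (simp add: abs_mult)
        fix s
        show "norm (r k s * (indicat_real A s * (f k s - f0 s))) \<le> \<bar>M\<bar> * (indicat_real A s * \<bar>f k s - f0 s\<bar>)"
        proof (cases "s \<in> A")
          case True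
          then have "\<bar>r k s\<bar> \<le> \<bar>M\<bar>" using r(2)[OF True, of k] by linarith
          then show ?thesis using True by (simp add: abs_mult mult_right_mono)
        qed simp
      qed
      also have "\<dots> = \<bar>M\<bar> * (LINT s:A|lborel. \<bar>f k s - f0 s\<bar>)" by (simp add: set_lebesgue_integral_def)
      finally show "norm (\<integral>s. r k s * (indicat_real A s * (f k s - f0 s)) \<partial>lborel)
        \<le> \<bar>M\<bar> * (LINT s:A|lborel. \<bar>f k s - f0 s\<bar>)" .
    qed
    show "(\<lambda>k. \<bar>M\<bar> * (LINT s:A|lborel. \<bar>f k s - f0 s\<bar>)) \<longlonglongrightarrow> 0"
      using tendsto_mult[OF tendsto_const lim, of "\<bar>M\<bar>"] by simp
  qed
  have "(\<integral>s. r k s * (indicat_real A s * (f k s - f0 s)) \<partial>lborel) + (\<integral>s. r k s * ?g s \<partial>lborel)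
      = (LINT s:A|lborel. r k s * f k s)" for k
    using int_r[OF d, of k k] int_r[OF g, of k]
    by (subst Bochner_Integration.integral_add[symmetric]) (auto simp: set_lebesgue_integral_def algebra_simps)
  moreover have "(\<integral>s. r0 s * ?g s \<partial>lborel) = (LINT s:A|lborel. r0 s * f0 s)"
    by (simp add: set_lebesgue_integral_def algebra_simps)
  ultimately show ?thesis using tendsto_add[OF 1 2] by simp
qed

text \<open>The drift is only integrable along paths. Truncating it at level k makes its primitive
  Lipschitz in time, as the grid estimate requires; the lemma removes the truncation in the
  limit.\<close>

lemma truncation_L1_limit:
  fixes f :: "real \<Rightarrow> real"
  assumes "set_integrable lborel A f" "A \<in> sets lborel" "f \<in> borel_measurable lborel"
  shows "(\<lambda>k. LINT s:A|lborel. \<bar>max (- real k) (min (real k) (f s)) - f s\<bar>) \<longlonglongrightarrow> 0"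
proof -
  have "(\<lambda>k. \<integral>s. indicat_real A s * \<bar>max (- real k) (min (real k) (f s)) - f s\<bar> \<partial>lborel) \<longlonglongrightarrow> (\<integral>s. 0 \<partial>(lborel :: real measure))"
  proof (rule integral_dominated_convergence[where w = "\<lambda>s. \<bar>indicat_real A s * f s\<bar>"])
    show "integrable lborel (\<lambda>s. \<bar>indicat_real A s * f s\<bar>)"
      using assms by (intro integrable_abs) (simp add: set_integrable_def)
    show "AE s in lborel. (\<lambda>k. indicat_real A s * \<bar>max (- real k) (min (real k) (f s)) - f s\<bar>) \<longlonglongrightarrow> 0"
    proof (rule AE_I2)
      fix s
      obtain n where n: "\<bar>f s\<bar> \<le> real n" using real_arch_simple by blast
      have "\<forall>\<^sub>F k in sequentially. indicat_real A s * \<bar>max (- real k) (min (real k) (f s)) - f s\<bar> = 0"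
        using eventually_ge_at_top[of n] by eventually_elim (use n in \<open>auto simp: max_def min_def\<close>)
      then show "(\<lambda>k. indicat_real A s * \<bar>max (- real k) (min (real k) (f s)) - f s\<bar>) \<longlonglongrightarrow> 0"
        by (rule tendsto_eventually)
    qed
    show "AE s in lborel. norm (indicat_real A s * \<bar>max (- real k) (min (real k) (f s)) - f s\<bar>) \<le> \<bar>indicat_real A s * f s\<bar>" for k
      by (rule AE_I2) (auto simp: indicator_def max_def min_def)
    show "(\<lambda>s. indicat_real A s * \<bar>max (- real k) (min (real k) (f s)) - f s\<bar>) \<in> borel_measurable lborel" for k
      using assms(2,3) by measurable
  qed simp
  then show ?thesis by (simp add: set_lebesgue_integral_def)
qed

text \<open>With x = H - g the difference of squares is x^2 + 2 x g. Young's inequality bounds the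
  mixed term by x^2 / \<eta> + \<eta> g^2, where \<eta> tends to 0 slowly enough that the integral
  of x^2 divided by \<eta> still vanishes.\<close>

lemma square_L1_limit:
  fixes H :: "nat \<Rightarrow> real \<Rightarrow> real" and g :: "real \<Rightarrow> real"
  assumes A: "A \<in> sets lborel" and H: "\<And>k. H k \<in> borel_measurable lborel" "g \<in> borel_measurable lborel"
    and int: "\<And>k. set_integrable lborel A (\<lambda>s. (H k s)\<^sup>2)" "set_integrable lborel A (\<lambda>s. (g s)\<^sup>2)"
    and lim: "(\<lambda>k. \<integral>\<^sup>+s\<in>A. ennreal ((H k s - g s)\<^sup>2) \<partial>lborel) \<longlonglongrightarrow> 0"
  shows "(\<lambda>k. LINT s:A|lborel. \<bar>(H k s)\<^sup>2 - (g s)\<^sup>2\<bar>) \<longlonglongrightarrow> 0"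
proof -
  note [measurable] = A H
  define q where "q = (\<lambda>k. LINT s:A|lborel. (H k s - g s)\<^sup>2)"
  define I where "I = (LINT s:A|lborel. (g s)\<^sup>2)"
  have dint: "set_integrable lborel A (\<lambda>s. (H k s - g s)\<^sup>2)" for k
    unfolding set_integrable_def
  proof (rule Bochner_Integration.integrable_bound)
    show "integrable lborel (\<lambda>s. 2 * (indicat_real A s *\<^sub>R (H k s)\<^sup>2) + 2 * (indicat_real A s *\<^sub>R (g s)\<^sup>2))"
      using int(1)[of k] int(2) unfolding set_integrable_def by (intro Bochner_Integration.integrable_add integrable_mult_right)
    show "AE s in lborel. norm (indicat_real A s *\<^sub>R (H k s - g s)\<^sup>2) \<le> norm (2 * (indicat_real A s *\<^sub>R (H k s)\<^sup>2) + 2 * (indicat_real A s *\<^sub>R (g s)\<^sup>2))"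
    proof (rule AE_I2)
      fix s
      have "0 \<le> (H k s + g s)\<^sup>2" by simp
      then have "(H k s - g s)\<^sup>2 \<le> 2 * (H k s)\<^sup>2 + 2 * (g s)\<^sup>2" by (simp add: power2_eq_square algebra_simps)
      then show "norm (indicat_real A s *\<^sub>R (H k s - g s)\<^sup>2) \<le> norm (2 * (indicat_real A s *\<^sub>R (H k s)\<^sup>2) + 2 * (indicat_real A s *\<^sub>R (g s)\<^sup>2))"
        by (simp add: indicator_def)
    qed
  qed measurable
  have q0: "q k \<ge> 0" for k unfolding q_def set_lebesgue_integral_def by (intro Bochner_Integration.integral_nonneg) auto
  have "(\<integral>\<^sup>+s\<in>A. ennreal ((H k s - g s)\<^sup>2) \<partial>lborel) = ennreal (q k)" for k
  proof -
    have "(\<integral>\<^sup>+s\<in>A. ennreal ((H k s - g s)\<^sup>2) \<partial>lborel) = (\<integral>\<^sup>+s. ennreal (indicat_real A s *\<^sub>R (H k s - g s)\<^sup>2) \<partial>lborel)"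
      by (intro nn_integral_cong) (auto simp: indicator_def)
    also have "\<dots> = ennreal (q k)" unfolding q_def set_lebesgue_integral_def
      by (rule nn_integral_eq_integral) (use dint in \<open>auto simp: set_integrable_def\<close>)
    finally show ?thesis .
  qed
  then have "(\<lambda>k. ennreal (q k)) \<longlonglongrightarrow> ennreal 0" using lim by simp
  then have qlim: "q \<longlonglongrightarrow> 0" using tendsto_ennreal_iff[of q sequentially 0] q0 by (simp del: ennreal_0)
  \<comment> \<open>The square root gives q / \<eta> \<le> sqrt q; the second summand keeps \<eta>
    positive when q is 0.\<close>
  define \<eta> where "\<eta> = (\<lambda>k. sqrt (q k) + 1 / real (Suc k))"
  have \<eta>0: "\<eta> k > 0" for k using q0[of k] by (auto simp: \<eta>_def intro!: add_nonneg_pos)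
  have bound: "(LINT s:A|lborel. \<bar>(H k s)\<^sup>2 - (g s)\<^sup>2\<bar>) \<le> q k + sqrt (q k) + \<eta> k * I" for k
  proof -
    have "(LINT s:A|lborel. \<bar>(H k s)\<^sup>2 - (g s)\<^sup>2\<bar>) \<le> (LINT s:A|lborel. (1 + 1 / \<eta> k) * (H k s - g s)\<^sup>2 + \<eta> k * (g s)\<^sup>2)"
    proof (rule set_integral_mono)
      show "set_integrable lborel A (\<lambda>s. \<bar>(H k s)\<^sup>2 - (g s)\<^sup>2\<bar>)"
        using int(1)[of k] int(2) by (intro set_integrable_abs set_integral_diff(1))
      show "set_integrable lborel A (\<lambda>s. (1 + 1 / \<eta> k) * (H k s - g s)\<^sup>2 + \<eta> k * (g s)\<^sup>2)"
        using dint int(2) by (intro set_integral_add(1) set_integrable_mult_right)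
      fix s
      define x y where "x = H k s - g s" and "y = g s"
      have "0 \<le> (1 / sqrt (\<eta> k) * \<bar>x\<bar> - sqrt (\<eta> k) * \<bar>y\<bar>)\<^sup>2" by simp
      also have "\<dots> = 1 / \<eta> k * x\<^sup>2 + \<eta> k * y\<^sup>2 - 2 * (\<bar>x\<bar> * \<bar>y\<bar>)"
        using \<eta>0[of k] by (simp add: power2_diff power_mult_distrib power_divide)
      finally have "2 * (\<bar>x\<bar> * \<bar>y\<bar>) \<le> 1 / \<eta> k * x\<^sup>2 + \<eta> k * y\<^sup>2" by simp
      moreover have "\<bar>x\<^sup>2 + 2 * x * y\<bar> \<le> x\<^sup>2 + 2 * (\<bar>x\<bar> * \<bar>y\<bar>)"
        by (rule order.trans[OF abs_triangle_ineq]) (simp add: abs_mult)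
      moreover have "(H k s)\<^sup>2 - (g s)\<^sup>2 = x\<^sup>2 + 2 * x * y" by (simp add: x_def y_def power2_eq_square algebra_simps)
      ultimately have "\<bar>(H k s)\<^sup>2 - (g s)\<^sup>2\<bar> \<le> (1 + 1 / \<eta> k) * x\<^sup>2 + \<eta> k * y\<^sup>2"
        by (simp add: distrib_right)
      then show "\<bar>(H k s)\<^sup>2 - (g s)\<^sup>2\<bar> \<le> (1 + 1 / \<eta> k) * (H k s - g s)\<^sup>2 + \<eta> k * (g s)\<^sup>2"
        by (simp only: x_def y_def)
    qed
    also have "\<dots> = (1 + 1 / \<eta> k) * q k + \<eta> k * I"
      unfolding q_def I_def using dint[of k] int(2)
      by (subst set_integral_add(2)) (auto intro!: set_integrable_mult_right)
    also have "\<dots> \<le> q k + sqrt (q k) + \<eta> k * I"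
    proof -
      have "q k = sqrt (q k) * sqrt (q k)" using q0 by simp
      also have "\<dots> \<le> sqrt (q k) * \<eta> k" unfolding \<eta>_def using q0[of k] by (intro mult_left_mono) auto
      finally have "q k / \<eta> k \<le> sqrt (q k)" using \<eta>0[of k] by (simp add: pos_divide_le_eq)
      then show ?thesis by (simp add: distrib_right)
    qed
    finally show ?thesis .
  qed
  have "\<eta> \<longlonglongrightarrow> sqrt 0 + 0"
    unfolding \<eta>_def by (intro tendsto_add tendsto_real_sqrt qlim LIMSEQ_Suc[OF lim_1_over_n])
  then have "(\<lambda>k. q k + sqrt (q k) + \<eta> k * I) \<longlonglongrightarrow> 0 + sqrt 0 + (sqrt 0 + 0) * I"
    by (intro tendsto_intros qlim)
  then have lim0: "(\<lambda>k. q k + sqrt (q k) + \<eta> k * I) \<longlonglongrightarrow> 0" by simp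
  show ?thesis
  proof (rule Lim_null_comparison[OF always_eventually lim0], rule allI)
    fix k
    have "(LINT s:A|lborel. \<bar>(H k s)\<^sup>2 - (g s)\<^sup>2\<bar>) \<ge> 0"
      unfolding set_lebesgue_integral_def by (intro Bochner_Integration.integral_nonneg) auto
    then show "norm (LINT s:A|lborel. \<bar>(H k s)\<^sup>2 - (g s)\<^sup>2\<bar>) \<le> q k + sqrt (q k) + \<eta> k * I" using bound[of k] by simp
  qed
qed

lemma set_integral_step:
  fixes f :: "real \<Rightarrow> real" and c :: "nat \<Rightarrow> real"
  assumes f: "set_integrable lborel {a<..b} f" and ab: "a \<le> b" "m > 0"
  shows "(\<Sum>j<m. c j * (LINT s:{grid a b m j<..grid a b m (Suc j)}|lborel. f s))
     = (LINT s:{a<..b}|lborel. (\<Sum>j<m. c j * indicator {grid a b m j<..grid a b m (Suc j)} s) * f s)"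
proof -
  let ?I = "\<lambda>j. {grid a b m j<..grid a b m (Suc j)}"
  have sub: "?I j \<subseteq> {a<..b}" if "j < m" for j
    using grid_bounds[of a b m j] grid_bounds[of a b m "Suc j"] ab that by auto
  have int: "integrable lborel (\<lambda>s. c j * (indicat_real (?I j) s * f s))" if "j < m" for j
    using set_integrable_subset[OF f _ sub[OF that]] by (intro integrable_mult_right) (simp add: set_integrable_def)
  have "(LINT s:{a<..b}|lborel. (\<Sum>j<m. c j * indicator (?I j) s) * f s)
      = (\<integral>s. (\<Sum>j<m. c j * (indicat_real (?I j) s * f s)) \<partial>lborel)"
    unfolding set_lebesgue_integral_def
  proof (intro Bochner_Integration.integral_cong refl)
    fix s
    have "indicat_real {a<..b} s * (c j * indicat_real (?I j) s * f s) = c j * (indicat_real (?I j) s * f s)" if "j < m" for j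
      using sub[OF that] by (auto simp: indicator_def)
    then show "indicat_real {a<..b} s *\<^sub>R ((\<Sum>j<m. c j * indicator (?I j) s) * f s) = (\<Sum>j<m. c j * (indicat_real (?I j) s * f s))"
      unfolding real_scaleR_def sum_distrib_right sum_distrib_left
      by (intro sum.cong refl) (simp only: lessThan_iff mult.assoc)
  qed
  also have "\<dots> = (\<Sum>j<m. \<integral>s. c j * (indicat_real (?I j) s * f s) \<partial>lborel)"
    by (rule Bochner_Integration.integral_sum) (use int in auto)
  finally show ?thesis by (simp add: set_lebesgue_integral_def)
qed

text \<open>
  Evaluated at the clock \<open>\<integral> \<bar>\<beta>\<bar> + H\<^sup>2 ds\<close>, this weight bounds the approximating sums uniformly in \<open>\<omega>\<close>;
  as it decreases in time and test functions are nonnegative, it may be frozen at the left end point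
  of each grid cell.
\<close>

definition clock_weight :: "real \<Rightarrow> real \<Rightarrow> real" where
  "clock_weight N a = max 0 (min 1 (N + 1 - a))"

lemma clock_weight_bounds: "0 \<le> clock_weight N a" "clock_weight N a \<le> 1"
  and clock_weight_antimono: "a \<le> b \<Longrightarrow> clock_weight N b \<le> clock_weight N a"
  and clock_weight_1: "a \<le> N \<Longrightarrow> clock_weight N a = 1"
  and clock_weight_0: "N + 1 \<le> a \<Longrightarrow> clock_weight N a = 0"
  by (auto simp: clock_weight_def)

lemma tendsto_clock_weight: "(f \<longlongrightarrow> a) G \<Longrightarrow> ((\<lambda>x. clock_weight N (f x)) \<longlongrightarrow> clock_weight N a) G"
  unfolding clock_weight_def by (intro tendsto_intros)

lemma measurable_clock_weight [measurable]: "clock_weight N \<in> borel_measurable borel"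
  unfolding clock_weight_def by measurable

text \<open>Until the clock reaches N + 1 the sum is at most the clock itself; afterwards the weight
  is 0. The increment that crosses the level adds at most 1, whence N + 2.\<close>

lemma clock_sum_bound:
  fixes A :: "nat \<Rightarrow> real"
  assumes "A 0 \<ge> 0" and "\<And>j. j < m \<Longrightarrow> A j \<le> A (Suc j) \<and> A (Suc j) \<le> A j + 1" and N: "N \<ge> 0"
  shows "(\<Sum>j<m. clock_weight N (A j) * (A (Suc j) - A j)) \<le> N + 2"
proof -
  have "(\<Sum>j<k. clock_weight N (A j) * (A (Suc j) - A j)) \<le> min (A k) (N + 2)" if "k \<le> m" for k
    using that
  proof (induction k)
    case (Suc k)
    then have s: "(\<Sum>j<k. clock_weight N (A j) * (A (Suc j) - A j)) \<le> min (A k) (N + 2)"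
      "A k \<le> A (Suc k)" "A (Suc k) \<le> A k + 1" using assms(2)[of k] by auto
    show ?case
    proof (cases "A k \<ge> N + 1")
      case True
      then show ?thesis using s by (simp add: clock_weight_0)
    next
      case False
      have "clock_weight N (A k) * (A (Suc k) - A k) \<le> 1 * (A (Suc k) - A k)"
        using s clock_weight_bounds by (intro mult_right_mono) auto
      then show ?thesis using s False by simp
    qed
  qed (use assms in auto)
  from this[of m] show ?thesis by simp
qed

text \<open>The deterministic limit for one path. Approximate paths and clocks converge uniformly to
  continuous limits, so values at left end points of shrinking cells converge to values at s, while
  the increments are integrals of functions converging in L1. Level k uses the truncated drift, the
  k-th simple process and a grid of its own.\<close>

lemma (in test_function) path_limit:
  fixes \<beta> g X Y :: "real \<Rightarrow> real" and H Xk :: "nat \<Rightarrow> real \<Rightarrow> real" and m :: "nat \<Rightarrow> nat"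
  assumes \<beta>: "\<beta> \<in> borel_measurable lborel" "set_integrable lborel {0..t1} \<beta>"
    and g: "g \<in> borel_measurable lborel" "set_integrable lborel {0..t1} (\<lambda>s. (g s)\<^sup>2)"
    and H: "\<And>k. H k \<in> borel_measurable lborel" "\<And>k. set_integrable lborel {0..t1} (\<lambda>s. (H k s)\<^sup>2)"
    and Hlim: "(\<lambda>k. \<integral>\<^sup>+s\<in>{0..t1}. ennreal ((H k s - g s)\<^sup>2) \<partial>lborel) \<longlonglongrightarrow> 0"
    and Xlim: "(\<lambda>k. SUP s\<in>{0..t1}. ennreal \<bar>Xk k s - X s\<bar>) \<longlonglongrightarrow> 0"
    and Xcont: "continuous_on {0..t1} X"
    and Y: "\<And>s. 0 \<le> s \<Longrightarrow> s \<le> t1 \<Longrightarrow> Y s = y0 + (LINT r:{0..s}|lborel. \<beta> r) + X s"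
    and m: "\<And>k. m k > 0" "(\<lambda>k. (t1 - t0) / real (m k)) \<longlonglongrightarrow> 0"
  defines "b \<equiv> \<lambda>k s. max (- real k) (min (real k) (\<beta> s))"
  defines "V \<equiv> \<lambda>k s. y0 + (LINT r:{0..s}|lborel. b k r)"
  defines "A \<equiv> \<lambda>k s. (LINT r:{0..s}|lborel. \<bar>b k r\<bar>) + (LINT r:{0..s}|lborel. (H k r)\<^sup>2)"
  defines "A0 \<equiv> \<lambda>s. (LINT r:{0..s}|lborel. \<bar>\<beta> r\<bar>) + (LINT r:{0..s}|lborel. (g r)\<^sup>2)"
  defines "p \<equiv> \<lambda>k. grid t0 t1 (m k)"
  shows "(\<lambda>k. \<Sum>j<m k. clock_weight N (A k (p k j)) *
          (hs (p k j) (V k (p k j) + Xk k (p k j)) * (p k (Suc j) - p k j)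
          + hy (p k j) (V k (p k j) + Xk k (p k j)) * (V k (p k (Suc j)) - V k (p k j))
          + hyy (p k j) (V k (p k j) + Xk k (p k j)) * (LINT s:{p k j<..p k (Suc j)}|lborel. (H k s)\<^sup>2) / 2))
      \<longlonglongrightarrow> (LINT s:{t0<..t1}|lborel. clock_weight N (A0 s) * (hs s (Y s) + \<beta> s * hy s (Y s) + (g s)\<^sup>2 / 2 * hyy s (Y s)))" (is ?G)
    and "(\<lambda>k. A k t1) \<longlonglongrightarrow> A0 t1" (is ?E)
    and "\<And>s. 0 \<le> s \<Longrightarrow> s \<le> t1 \<Longrightarrow> (\<lambda>k. V k s + Xk k s) \<longlonglongrightarrow> Y s"
    and "set_integrable lborel {t0<..t1} (\<lambda>s. clock_weight N (A0 s) * (hs s (Y s) + \<beta> s * hy s (Y s) + (g s)\<^sup>2 / 2 * hyy s (Y s)))" (is ?I)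
proof -
  have t01: "0 \<le> t1" "t0 \<le> t1" using times by auto
  have sub: "{t0<..t1} \<subseteq> {0..t1}" using times by auto
  have bm: "b k \<in> borel_measurable lborel" for k unfolding b_def using \<beta>(1) by measurable
  have bint: "set_integrable lborel {0..t1} (b k)" for k
    unfolding set_integrable_def
  proof (rule Bochner_Integration.integrable_bound[OF \<beta>(2)[unfolded set_integrable_def]])
    show "(\<lambda>s. indicat_real {0..t1} s *\<^sub>R b k s) \<in> borel_measurable lborel" using bm by measurable
    show "AE s in lborel. norm (indicat_real {0..t1} s *\<^sub>R b k s) \<le> norm (indicat_real {0..t1} s *\<^sub>R \<beta> s)"
      by (rule AE_I2) (auto simp: b_def indicator_def max_def min_def)
  qed
  \<comment> \<open>Two primitives differ by at most the L1 distance of their integrands over the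
    whole interval, so \<open>e1\<close> and \<open>e2\<close> control drift part and clock
    uniformly in time.\<close>
  define e1 where "e1 = (\<lambda>k. LINT s:{0..t1}|lborel. \<bar>b k s - \<beta> s\<bar>)"
  define e2 where "e2 = (\<lambda>k. LINT s:{0..t1}|lborel. \<bar>(H k s)\<^sup>2 - (g s)\<^sup>2\<bar>)"
  have e1: "e1 \<longlonglongrightarrow> 0" unfolding e1_def b_def using truncation_L1_limit[OF \<beta>(2) _ \<beta>(1)] by simp
  have e2: "e2 \<longlonglongrightarrow> 0" unfolding e2_def using square_L1_limit[OF _ H(1) g(1) H(2) g(2) Hlim] by simp
  have diff: "\<bar>(LINT r:{0..s}|lborel. f r) - (LINT r:{0..s}|lborel. f' r)\<bar> \<le> (LINT r:{0..t1}|lborel. \<bar>f r - f' r\<bar>)"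
    if f: "set_integrable lborel {0..t1} f" "set_integrable lborel {0..t1} f'" and s: "s \<le> t1" for f f' :: "real \<Rightarrow> real" and s
  proof -
    have ss: "{0..s} \<subseteq> {0..t1}" using s by auto
    note fs = set_integrable_subset[OF f(1) _ ss] set_integrable_subset[OF f(2) _ ss]
    have "\<bar>(LINT r:{0..s}|lborel. f r) - (LINT r:{0..s}|lborel. f' r)\<bar> = \<bar>LINT r:{0..s}|lborel. f r - f' r\<bar>"
      using fs by (subst set_integral_diff(2)) auto
    also have "\<dots> \<le> (LINT r:{0..s}|lborel. \<bar>f r - f' r\<bar>)"
      using set_integral_norm_bound[of lborel "{0..s}" "\<lambda>r. f r - f' r"] fs by (auto intro!: set_integral_diff(1))
    also have "\<dots> \<le> (LINT r:{0..t1}|lborel. \<bar>f r - f' r\<bar>)"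
      unfolding set_lebesgue_integral_def
    proof (rule integral_mono)
      show "integrable lborel (\<lambda>r. indicat_real {0..s} r *\<^sub>R \<bar>f r - f' r\<bar>)" "integrable lborel (\<lambda>r. indicat_real {0..t1} r *\<^sub>R \<bar>f r - f' r\<bar>)"
        using set_integrable_abs[OF set_integral_diff(1)[OF f]] set_integrable_abs[OF set_integral_diff(1)[OF fs]]
        by (auto simp: set_integrable_def)
    qed (use s in \<open>auto simp: indicator_def\<close>)
    finally show ?thesis .
  qed
  have babs: "set_integrable lborel {0..t1} (\<lambda>s. \<bar>b k s\<bar>)" for k using bint by (rule set_integrable_abs)
  have \<beta>abs: "set_integrable lborel {0..t1} (\<lambda>s. \<bar>\<beta> s\<bar>)" using \<beta>(2) by (rule set_integrable_abs)
  have Adiff: "\<bar>A k s - A0 s\<bar> \<le> e1 k + e2 k" if s: "s \<le> t1" for k s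
  proof -
    have "(LINT r:{0..t1}|lborel. \<bar>\<bar>b k r\<bar> - \<bar>\<beta> r\<bar>\<bar>) \<le> e1 k"
      unfolding e1_def
      by (rule set_integral_mono) (use set_integrable_abs[OF set_integral_diff(1)[OF babs \<beta>abs]] set_integrable_abs[OF set_integral_diff(1)[OF bint \<beta>(2)]] in auto)
    with diff[OF babs[of k] \<beta>abs s] diff[OF H(2)[of k] g(2) s]
    show ?thesis unfolding A_def A0_def e2_def by linarith
  qed
  define S where "S = (\<lambda>k. SUP s\<in>{0..t1}. ennreal \<bar>Xk k s - X s\<bar>)"
  have S: "S \<longlonglongrightarrow> 0" using Xlim unfolding S_def .
  have XS: "\<bar>Xk k s - X s\<bar> \<le> enn2real (S k)" if "0 \<le> s" "s \<le> t1" "S k < \<infinity>" for k s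
  proof -
    have "ennreal \<bar>Xk k s - X s\<bar> \<le> S k" unfolding S_def using that by (intro SUP_upper) auto
    then have "enn2real (ennreal \<bar>Xk k s - X s\<bar>) \<le> enn2real (S k)" using that by (intro enn2real_mono) auto
    then show ?thesis by simp
  qed
  \<comment> \<open>\<open>enn2real\<close> sends infinity to 0, so the real-valued bound by the
    supremum is meaningful only once the supremum is finite, which holds eventually.\<close>
  have Sfin: "\<forall>\<^sub>F k in sequentially. S k < \<infinity>" using order_tendstoD(2)[OF S, of \<infinity>] by simp
  have Sr: "(\<lambda>k. enn2real (S k)) \<longlonglongrightarrow> 0" by (rule tendsto_enn2real) (use S in auto)
  have Ydiff: "\<forall>\<^sub>F k in sequentially. \<forall>s\<in>{0..t1}. \<bar>V k s + Xk k s - Y s\<bar> \<le> e1 k + enn2real (S k)"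
    using Sfin
  proof eventually_elim
    case (elim k)
    show ?case
    proof
      fix s assume s: "s \<in> {0..t1}"
      then show "\<bar>V k s + Xk k s - Y s\<bar> \<le> e1 k + enn2real (S k)"
        using diff[OF bint[of k] \<beta>(2), of s] XS[of s k] Y[of s] elim unfolding V_def e1_def by auto
    qed
  qed
  have A0cont: "continuous_on {0..t1} A0"
    unfolding A0_def by (intro continuous_on_add continuous_on_set_integral \<beta>abs g(2))
  have Ycont: "continuous_on {0..t1} Y"
  proof -
    have "continuous_on {0..t1} (\<lambda>s. y0 + (LINT r:{0..s}|lborel. \<beta> r) + X s)"
      by (intro continuous_on_add continuous_on_const continuous_on_set_integral \<beta>(2) Xcont)
    then show ?thesis by (rule continuous_on_eq) (use Y in auto)
  qed
  have Alim: "(\<lambda>k. A k (q k)) \<longlonglongrightarrow> A0 s" and Ylim: "(\<lambda>k. V k (q k) + Xk k (q k)) \<longlonglongrightarrow> Y s"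
    if q: "q \<longlonglongrightarrow> s" "\<And>k. q k \<in> {0..t1}" "s \<in> {0..t1}" for q s
  proof -
    have 1: "(\<lambda>k. A0 (q k)) \<longlonglongrightarrow> A0 s" "(\<lambda>k. Y (q k)) \<longlonglongrightarrow> Y s"
      by (rule continuous_on_tendsto_compose[OF A0cont q(1)] continuous_on_tendsto_compose[OF Ycont q(1)]; use q in auto)+
    have "(\<lambda>k. A k (q k) - A0 (q k)) \<longlonglongrightarrow> 0"
    proof (rule Lim_null_comparison[OF always_eventually])
      show "\<forall>k. norm (A k (q k) - A0 (q k)) \<le> e1 k + e2 k" using Adiff q(2) by auto
      show "(\<lambda>k. e1 k + e2 k) \<longlonglongrightarrow> 0" using tendsto_add[OF e1 e2] by simp
    qed
    from tendsto_add[OF this 1(1)] show "(\<lambda>k. A k (q k)) \<longlonglongrightarrow> A0 s" by simp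
    have "(\<lambda>k. V k (q k) + Xk k (q k) - Y (q k)) \<longlonglongrightarrow> 0"
    proof (rule Lim_null_comparison)
      show "\<forall>\<^sub>F k in sequentially. norm (V k (q k) + Xk k (q k) - Y (q k)) \<le> e1 k + enn2real (S k)"
        using Ydiff by eventually_elim (use q(2) in auto)
      show "(\<lambda>k. e1 k + enn2real (S k)) \<longlonglongrightarrow> 0" using tendsto_add[OF e1 Sr] by simp
    qed
    from tendsto_add[OF this 1(2)] show "(\<lambda>k. V k (q k) + Xk k (q k)) \<longlonglongrightarrow> Y s" by simp
  qed
  have t1in: "t1 \<in> {0..t1}" using t01 by auto
  show "(\<lambda>k. V k s + Xk k s) \<longlonglongrightarrow> Y s" if "0 \<le> s" "s \<le> t1" for s
    using Ylim[of "\<lambda>_. s" s] that by simp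
  show ?E using Alim[of "\<lambda>_. t1" t1] t1in by simp
  \<comment> \<open>The weight times \<open>f\<close>, frozen on each cell at its left end
    point.\<close>
  define r where "r = (\<lambda>(f :: real \<Rightarrow> real \<Rightarrow> real) k s. \<Sum>j<m k. clock_weight N (A k (p k j)) * f (p k j) (V k (p k j) + Xk k (p k j))
       * indicat_real {p k j<..p k (Suc j)} s)"
  have pin: "t0 \<le> p k j" "p k j \<le> t1" if "j \<le> m k" for k j
    using grid_bounds[of t0 t1 "m k" j] m(1) that t01 unfolding p_def by auto
  have cell: "\<exists>j. j < m k \<and> p k j < s \<and> s \<le> p k (Suc j) \<and> (\<forall>c :: nat \<Rightarrow> real. (\<Sum>i<m k. c i * indicator {p k i<..p k (Suc i)} s) = c j)"
    if s: "s \<in> {t0<..t1}" for k s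
    unfolding p_def
  proof (rule grid_cell[of "m k" t0 s t1])
    show "0 < m k" "t0 < s" "s \<le> t1" using m(1) s by auto
  qed blast
  have rb: "\<bar>r f k s\<bar> \<le> M"
    if f: "\<And>s y. t0 \<le> s \<Longrightarrow> s \<le> t1 \<Longrightarrow> \<bar>f s y\<bar> \<le> M" and s: "s \<in> {t0<..t1}" for f k s
  proof -
    from s obtain j where j: "j < m k" and c: "\<And>c :: nat \<Rightarrow> real. (\<Sum>i<m k. c i * indicator {p k i<..p k (Suc i)} s) = c j"
      using cell[of s k] by blast
    have "r f k s = clock_weight N (A k (p k j)) * f (p k j) (V k (p k j) + Xk k (p k j))" unfolding r_def by (rule c)
    moreover have "\<bar>clock_weight N (A k (p k j)) * f (p k j) (V k (p k j) + Xk k (p k j))\<bar> \<le> 1 * M"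
      unfolding abs_mult using clock_weight_bounds f[OF pin, of j k] j by (intro mult_mono) auto
    ultimately show ?thesis by simp
  qed
  have rlim: "(\<lambda>k. r f k s) \<longlonglongrightarrow> clock_weight N (A0 s) * f s (Y s)"
    if f: "continuous_on ({t0..t1} \<times> UNIV) (\<lambda>(s, y). f s y)" and s: "s \<in> {t0<..t1}" for f s
  proof -
    \<comment> \<open>For every k choose the cell of the k-th grid that contains s. Its left end
      point \<open>q k\<close> tends to s.\<close>
    note cell[OF s]
    then obtain j where j: "\<And>k. j k < m k" "\<And>k. p k (j k) < s" "\<And>k. s \<le> p k (Suc (j k))"
      "\<And>k (c :: nat \<Rightarrow> real). (\<Sum>i<m k. c i * indicator {p k i<..p k (Suc i)} s) = c (j k)" by metis
    define q where "q = (\<lambda>k. p k (j k))"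
    have qin: "t0 \<le> q k" "q k \<le> t1" for k unfolding q_def using pin[of "j k" k] j(1)[of k] by auto
    have "(\<lambda>k. q k - s) \<longlonglongrightarrow> 0"
    proof (rule Lim_null_comparison[OF always_eventually m(2)], rule allI)
      fix k
      have "p k (Suc (j k)) - p k (j k) = (t1 - t0) / real (m k)" unfolding p_def by (rule grid_Suc)
      then show "norm (q k - s) \<le> (t1 - t0) / real (m k)" using j(2,3)[of k] unfolding q_def by auto
    qed
    from tendsto_add[OF this tendsto_const[of s]] have q: "q \<longlonglongrightarrow> s" by simp
    have qs: "\<And>k. q k \<in> {0..t1}" "s \<in> {0..t1}" using qin times s by (auto intro: order.trans)
    have "(\<lambda>k. (case (q k, V k (q k) + Xk k (q k)) of (s, y) \<Rightarrow> f s y)) \<longlonglongrightarrow> (case (s, Y s) of (s, y) \<Rightarrow> f s y)"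
      by (rule continuous_on_tendsto_compose[OF f tendsto_Pair[OF q Ylim[OF q qs]]]) (use qin s in auto)
    then have "(\<lambda>k. clock_weight N (A k (q k)) * f (q k) (V k (q k) + Xk k (q k))) \<longlonglongrightarrow> clock_weight N (A0 s) * f s (Y s)"
      by (intro tendsto_mult tendsto_clock_weight Alim[OF q qs]) simp
    then show ?thesis unfolding r_def j(4) q_def .
  qed
  have rm: "r f k \<in> borel_measurable lborel" for f k unfolding r_def by measurable
  have one: "set_integrable lborel {t0<..t1} (\<lambda>_. 1 :: real)"
    by (simp add: set_integrable_def t01)
  have i\<beta>: "set_integrable lborel {t0<..t1} \<beta>" and ib: "\<And>k. set_integrable lborel {t0<..t1} (b k)"
    and iH: "\<And>k. set_integrable lborel {t0<..t1} (\<lambda>s. (H k s)\<^sup>2)" and ig: "set_integrable lborel {t0<..t1} (\<lambda>s. (g s)\<^sup>2)"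
    using \<beta>(2) bint H(2) g(2) by (auto intro: set_integrable_subset[OF _ _ sub])
  have nonneg_sub: "(\<lambda>k. LINT s:{t0<..t1}|lborel. \<bar>u k s\<bar>) \<longlonglongrightarrow> 0"
    if u: "(\<lambda>k. LINT s:{0..t1}|lborel. \<bar>u k s\<bar>) \<longlonglongrightarrow> 0" and i: "\<And>k. set_integrable lborel {0..t1} (u k)" for u :: "nat \<Rightarrow> real \<Rightarrow> real"
  proof (rule Lim_null_comparison[OF always_eventually u], rule allI)
    fix k
    have ia: "set_integrable lborel {0..t1} (\<lambda>s. \<bar>u k s\<bar>)" using i by (rule set_integrable_abs)
    have "0 \<le> (LINT s:{t0<..t1}|lborel. \<bar>u k s\<bar>)"
      unfolding set_lebesgue_integral_def by (intro Bochner_Integration.integral_nonneg) auto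
    moreover have "(LINT s:{t0<..t1}|lborel. \<bar>u k s\<bar>) \<le> (LINT s:{0..t1}|lborel. \<bar>u k s\<bar>)"
      unfolding set_lebesgue_integral_def
      by (rule integral_mono) (use ia set_integrable_subset[OF ia _ sub] sub in \<open>auto simp: set_integrable_def indicator_def\<close>)
    ultimately show "norm (LINT s:{t0<..t1}|lborel. \<bar>u k s\<bar>) \<le> (LINT s:{0..t1}|lborel. \<bar>u k s\<bar>)" by simp
  qed
  have L1: "(\<lambda>k. LINT s:{t0<..t1}|lborel. r hs k s * 1) \<longlonglongrightarrow> (LINT s:{t0<..t1}|lborel. clock_weight N (A0 s) * hs s (Y s) * 1)"
    by (rule set_integral_product_limit[where M = M]) (use one rm rb[OF hs_bound] rlim[OF hs_cont] in auto)
  have L2: "(\<lambda>k. LINT s:{t0<..t1}|lborel. r hy k s * b k s) \<longlonglongrightarrow> (LINT s:{t0<..t1}|lborel. clock_weight N (A0 s) * hy s (Y s) * \<beta> s)"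
    by (rule set_integral_product_limit[where M = M])
      (use ib i\<beta> nonneg_sub[OF e1[unfolded e1_def] set_integral_diff(1)[OF bint \<beta>(2)]] rm rb[OF hy_bound] rlim[OF hy_cont] in auto)
  have L3: "(\<lambda>k. LINT s:{t0<..t1}|lborel. r hyy k s * (H k s)\<^sup>2) \<longlonglongrightarrow> (LINT s:{t0<..t1}|lborel. clock_weight N (A0 s) * hyy s (Y s) * (g s)\<^sup>2)"
    by (rule set_integral_product_limit[where M = M])
      (use iH ig nonneg_sub[OF e2[unfolded e2_def] set_integral_diff(1)[OF H(2) g(2)]] rm rb[OF hyy_bound] rlim[OF hyy_cont] in auto)
  have limint: "set_integrable lborel {t0<..t1} (\<lambda>s. clock_weight N (A0 s) * f s (Y s) * u s)"
    if f: "continuous_on ({t0..t1} \<times> UNIV) (\<lambda>(s, y). f s y)" "\<And>s y. t0 \<le> s \<Longrightarrow> s \<le> t1 \<Longrightarrow> \<bar>f s y\<bar> \<le> M"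
      and u: "set_integrable lborel {t0<..t1} u" for f u
    unfolding set_integrable_def
  proof (rule Bochner_Integration.integrable_bound[OF integrable_mult_right[OF u[unfolded set_integrable_def], of M]])
    \<comment> \<open>The path \<open>Y\<close> is described on [0, t1] only. Measurability of the
      limit integrand is therefore read off from step functions converging to it pointwise.\<close>
    have "(\<lambda>k. r f k s * (indicat_real {t0<..t1} s *\<^sub>R u s)) \<longlonglongrightarrow> indicat_real {t0<..t1} s *\<^sub>R (clock_weight N (A0 s) * f s (Y s) * u s)" for s
      by (cases "s \<in> {t0<..t1}") (auto intro!: tendsto_intros rlim[OF f(1)])
    then show "(\<lambda>s. indicat_real {t0<..t1} s *\<^sub>R (clock_weight N (A0 s) * f s (Y s) * u s)) \<in> borel_measurable lborel"
      by (rule borel_measurable_LIMSEQ_real)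
        (intro borel_measurable_times rm borel_measurable_integrable[OF u[unfolded set_integrable_def]])
    show "AE s in lborel. norm (indicat_real {t0<..t1} s *\<^sub>R (clock_weight N (A0 s) * f s (Y s) * u s)) \<le> norm (M * (indicat_real {t0<..t1} s *\<^sub>R u s))"
    proof (rule AE_I2)
      fix s
      show "norm (indicat_real {t0<..t1} s *\<^sub>R (clock_weight N (A0 s) * f s (Y s) * u s)) \<le> norm (M * (indicat_real {t0<..t1} s *\<^sub>R u s))"
      proof (cases "s \<in> {t0<..t1}")
        case True
        have "\<bar>clock_weight N (A0 s) * f s (Y s)\<bar> \<le> 1 * M"
          unfolding abs_mult using clock_weight_bounds f(2)[of s "Y s"] True by (intro mult_mono) auto
        then have "\<bar>clock_weight N (A0 s) * f s (Y s)\<bar> * \<bar>u s\<bar> \<le> \<bar>M\<bar> * \<bar>u s\<bar>" by (intro mult_right_mono) auto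
        then show ?thesis using True by (simp add: abs_mult)
      qed simp
    qed
  qed
  note I1 = limint[OF hs_cont hs_bound one] and I2 = limint[OF hy_cont hy_bound i\<beta>] and I3 = limint[OF hyy_cont hyy_bound ig]
  have I_eq: "clock_weight N (A0 s) * (hs s (Y s) + \<beta> s * hy s (Y s) + (g s)\<^sup>2 / 2 * hyy s (Y s))
     = clock_weight N (A0 s) * hs s (Y s) * 1 + clock_weight N (A0 s) * hy s (Y s) * \<beta> s
       + clock_weight N (A0 s) * hyy s (Y s) * (g s)\<^sup>2 * (1 / 2)" for s
    by (simp add: algebra_simps)
  have I3': "set_integrable lborel {t0<..t1} (\<lambda>s. clock_weight N (A0 s) * hyy s (Y s) * (g s)\<^sup>2 * (1 / 2))"
    by (rule set_integrable_mult_left) (use I3 in auto)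
  show ?I unfolding I_eq by (intro set_integral_add(1) I3') (use I1 I2 in auto)
  have lim_eq: "(LINT s:{t0<..t1}|lborel. clock_weight N (A0 s) * (hs s (Y s) + \<beta> s * hy s (Y s) + (g s)\<^sup>2 / 2 * hyy s (Y s)))
      = (LINT s:{t0<..t1}|lborel. clock_weight N (A0 s) * hs s (Y s) * 1)
      + (LINT s:{t0<..t1}|lborel. clock_weight N (A0 s) * hy s (Y s) * \<beta> s)
      + (LINT s:{t0<..t1}|lborel. clock_weight N (A0 s) * hyy s (Y s) * (g s)\<^sup>2) * (1 / 2)"
  proof -
    have "(LINT s:{t0<..t1}|lborel. clock_weight N (A0 s) * hyy s (Y s) * (g s)\<^sup>2 * (1 / 2))
      = (LINT s:{t0<..t1}|lborel. clock_weight N (A0 s) * hyy s (Y s) * (g s)\<^sup>2) * (1 / 2)"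
      by (rule set_integral_mult_left)
    then show ?thesis
      unfolding I_eq using I1 I2 I3' by (subst set_integral_add(2), auto intro!: set_integral_add)
  qed
  \<comment> \<open>Increments of time, of \<open>V\<close> and of the squared integrand are
    integrals over the cell, so each sum is the integral of a step function times the respective
    density.\<close>
  have G_eq: "(\<Sum>j<m k. clock_weight N (A k (p k j)) *
          (hs (p k j) (V k (p k j) + Xk k (p k j)) * (p k (Suc j) - p k j)
          + hy (p k j) (V k (p k j) + Xk k (p k j)) * (V k (p k (Suc j)) - V k (p k j))
          + hyy (p k j) (V k (p k j) + Xk k (p k j)) * (LINT s:{p k j<..p k (Suc j)}|lborel. (H k s)\<^sup>2) / 2))
     = (LINT s:{t0<..t1}|lborel. r hs k s * 1) + (LINT s:{t0<..t1}|lborel. r hy k s * b k s)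
       + (LINT s:{t0<..t1}|lborel. r hyy k s * (H k s)\<^sup>2) * (1 / 2)" for k
  proof -
    have st: "(\<Sum>j<m k. c j * (LINT s:{p k j<..p k (Suc j)}|lborel. f s))
        = (LINT s:{t0<..t1}|lborel. (\<Sum>j<m k. c j * indicator {p k j<..p k (Suc j)} s) * f s)"
      if "set_integrable lborel {t0<..t1} f" for c :: "nat \<Rightarrow> real" and f :: "real \<Rightarrow> real"
      unfolding p_def by (rule set_integral_step[OF that t01(2) m(1)])
    have le: "p k j \<le> p k (Suc j)" for j
      unfolding p_def by (rule grid_mono) (use t01 in auto)
    have s1: "(LINT s:{t0<..t1}|lborel. r hs k s * 1) = (\<Sum>j<m k. clock_weight N (A k (p k j)) * hs (p k j) (V k (p k j) + Xk k (p k j)) * (p k (Suc j) - p k j))"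
      unfolding r_def st[OF one, symmetric]
      by (rule sum.cong) (use le in \<open>auto simp: set_lebesgue_integral_def\<close>)
    have s2: "(LINT s:{t0<..t1}|lborel. r hy k s * b k s) = (\<Sum>j<m k. clock_weight N (A k (p k j)) * hy (p k j) (V k (p k j) + Xk k (p k j)) * (V k (p k (Suc j)) - V k (p k j)))"
      unfolding r_def st[OF ib, symmetric]
    proof (rule sum.cong[OF refl])
      fix j assume "j \<in> {..<m k}"
      then have "0 \<le> p k j" "p k (Suc j) \<le> t1" using pin[of j k] pin[of "Suc j" k] times by auto
      then have "V k (p k (Suc j)) - V k (p k j) = (LINT s:{p k j<..p k (Suc j)}|lborel. b k s)"
        unfolding V_def using set_integral_Icc_diff[OF bint[of k], of "p k j" "p k (Suc j)"] le[of j] by simp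
      then show "clock_weight N (A k (p k j)) * hy (p k j) (V k (p k j) + Xk k (p k j)) * (LINT s:{p k j<..p k (Suc j)}|lborel. b k s)
        = clock_weight N (A k (p k j)) * hy (p k j) (V k (p k j) + Xk k (p k j)) * (V k (p k (Suc j)) - V k (p k j))" by simp
    qed
    have s3: "(LINT s:{t0<..t1}|lborel. r hyy k s * (H k s)\<^sup>2) = (\<Sum>j<m k. clock_weight N (A k (p k j)) * hyy (p k j) (V k (p k j) + Xk k (p k j)) * (LINT s:{p k j<..p k (Suc j)}|lborel. (H k s)\<^sup>2))"
      unfolding r_def st[OF iH, symmetric] ..
    show ?thesis
      unfolding s1 s2 s3 sum_distrib_right sum.distrib[symmetric]
      by (rule sum.cong) (auto simp: algebra_simps)
  qed
  show ?G unfolding G_eq lim_eq by (intro tendsto_add tendsto_mult L1 L2 L3 tendsto_const)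
qed

section \<open>Almost sure subsequences and progressive measurability\<close>

lemma (in prob_space) tendsto_zero_in_prob_AE_subseq:
  assumes Z: "tendsto_zero_in_prob M Z"
  obtains r where "strict_mono r" "AE \<omega> in M. (\<lambda>k. Z (r k) \<omega>) \<longlonglongrightarrow> 0"
proof -
  have [measurable]: "Z k \<in> borel_measurable M" for k
    using Z by (simp add: tendsto_zero_in_prob_def)
  \<comment> \<open>Borel-Cantelli: along a subsequence for which the probability of exceeding
    2^(-k) is below 2^(-k), almost every \<omega> exceeds only finitely often.\<close>
  define A where "A = (\<lambda>k n. {\<omega> \<in> space M. Z n \<omega> > ennreal ((1/2) ^ k)})"
  have Am: "A k n \<in> sets M" for k n unfolding A_def by measurable
  have ev: "\<forall>\<^sub>F n in sequentially. prob (A k n) < (1/2) ^ k" for k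
  proof -
    have "(\<lambda>n. prob (A k n)) \<longlonglongrightarrow> 0"
      using Z unfolding tendsto_zero_in_prob_def A_def by (metis zero_less_divide_1_iff zero_less_numeral zero_less_power)
    then show ?thesis by (rule order_tendstoD(2)) simp
  qed
  have "\<exists>r. \<forall>k. prob (A k (r k)) < (1/2) ^ k \<and> r k < r (Suc k)"
  proof (rule dependent_nat_choice)
    show "\<exists>n. prob (A 0 n) < (1/2) ^ 0" using ev[of 0] by (auto simp: eventually_sequentially)
    fix n k assume "prob (A k n) < (1/2) ^ k"
    from eventually_conj[OF ev[of "Suc k"] eventually_gt_at_top[of n]]
    show "\<exists>y. prob (A (Suc k) y) < (1/2) ^ Suc k \<and> n < y"
      unfolding eventually_sequentially by blast
  qed
  then obtain r where r: "\<And>k. prob (A k (r k)) < (1/2) ^ k" "\<And>k. r k < r (Suc k)" by blast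
  have "AE \<omega> in M. \<forall>\<^sub>F k in sequentially. \<omega> \<in> space M - A k (r k)"
  proof (rule borel_cantelli_AE1[OF Am])
    show "emeasure M (A k (r k)) < \<infinity>" for k by (simp add: less_top[symmetric])
    show "summable (\<lambda>k. prob (A k (r k)))"
    proof (rule summable_comparison_test')
      show "summable (\<lambda>k. (1/2 :: real) ^ k)" by (rule summable_geometric) simp
      show "norm (prob (A k (r k))) \<le> (1/2) ^ k" if "k \<ge> 0" for k using r(1)[of k] by simp
    qed
  qed
  then have "AE \<omega> in M. (\<lambda>k. Z (r k) \<omega>) \<longlonglongrightarrow> 0"
  proof eventually_elim
    case (elim \<omega>)
    have lim: "(\<lambda>k. ennreal ((1/2) ^ k)) \<longlonglongrightarrow> ennreal 0"
      by (intro tendsto_ennrealI LIMSEQ_power_zero) simp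
    have "\<forall>\<^sub>F k in sequentially. Z (r k) \<omega> \<le> ennreal ((1/2) ^ k)"
      using elim by eventually_elim (auto simp: A_def not_less)
    from tendsto_sandwich[OF always_eventually this tendsto_const[of 0]] lim
    show ?case by simp
  qed
  moreover have "strict_mono r" using r(2) by (simp add: strict_mono_Suc_iff)
  ultimately show thesis by (rule that[rotated])
qed

lemma tendsto_zero_in_prob_subseq:
  assumes "tendsto_zero_in_prob M Z" "strict_mono r"
  shows "tendsto_zero_in_prob M (\<lambda>k. Z (r k))"
  using assms LIMSEQ_subseq_LIMSEQ[of _ 0 r] unfolding tendsto_zero_in_prob_def by (auto simp: o_def)

text \<open>Completeness of P enters the measurability of \<open>Y\<close> here: \<open>Y\<close>
  equals a measurable expression only almost surely.\<close>

lemma (in complete_measure) borel_measurable_AE_eq: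
  fixes f g :: "'a \<Rightarrow> real"
  assumes f: "f \<in> borel_measurable M" and eq: "AE x in M. f x = g x"
  shows "g \<in> borel_measurable M"
proof (rule measurableI)
  fix A :: "real set" assume "A \<in> sets borel"
  then have "f -` A \<inter> space M \<in> sets M" using f by (auto dest: measurable_sets)
  then show "g -` A \<inter> space M \<in> sets M"
  proof (rule in_sets_AE[rotated])
    show "AE x in M. (x \<in> f -` A \<inter> space M) = (x \<in> g -` A \<inter> space M)"
      using eq by eventually_elim auto
  qed auto
qed simp

context brownian_basis
begin

text \<open>Composing with the projection \<open>\<rho>\<close> of the line onto [0, s] replaces the
  restricted time space by \<open>lborel\<close>, the form in which parameter integrals are
  measurable. The indicator hides the projected values.\<close>

lemma progressive_joint:
  assumes prog: "progressively_measurable F \<beta>" and s: "0 \<le> s"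
  shows "(\<lambda>(\<omega>, r). indicat_real {0..s} r * \<beta> r \<omega>) \<in> borel_measurable (F s \<Otimes>\<^sub>M lborel)"
proof -
  define \<rho> where "\<rho> = (\<lambda>r. max 0 (min s r))"
  have \<rho>: "\<rho> \<in> measurable lborel (restrict_space borel {0..s})"
    by (rule measurable_restrict_space2) (use s in \<open>auto simp: \<rho>_def\<close>)
  have "(\<lambda>(r, \<omega>). \<beta> r \<omega>) \<in> borel_measurable (restrict_space borel {0..s} \<Otimes>\<^sub>M F s)"
    using prog s by (simp add: progressively_measurable_def)
  moreover have "(\<lambda>z. (\<rho> (snd z), fst z)) \<in> measurable (F s \<Otimes>\<^sub>M lborel) (restrict_space borel {0..s} \<Otimes>\<^sub>M F s)"
    by (intro measurable_Pair measurable_compose[OF measurable_snd \<rho>] measurable_fst)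
  ultimately have "(\<lambda>z. (\<lambda>(r, \<omega>). \<beta> r \<omega>) (\<rho> (snd z), fst z)) \<in> borel_measurable (F s \<Otimes>\<^sub>M lborel)"
    by (rule measurable_compose[rotated])
  then have "(\<lambda>z. indicat_real {0..s} (snd z) * (\<lambda>(r, \<omega>). \<beta> r \<omega>) (\<rho> (snd z), fst z)) \<in> borel_measurable (F s \<Otimes>\<^sub>M lborel)"
    by measurable
  also have "(\<lambda>z. indicat_real {0..s} (snd z) * (\<lambda>(r, \<omega>). \<beta> r \<omega>) (\<rho> (snd z), fst z)) = (\<lambda>(\<omega>, r). indicat_real {0..s} r * \<beta> r \<omega>)"
    by (auto simp: fun_eq_iff \<rho>_def indicator_def max_def min_def)
  finally show ?thesis .
qed

lemma progressive_path:
  assumes prog: "progressively_measurable F \<beta>" and s: "0 \<le> s" and \<omega>: "\<omega> \<in> space P"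
  shows "(\<lambda>r. indicat_real {0..s} r * \<beta> r \<omega>) \<in> borel_measurable lborel"
  using measurable_Pair2[OF progressive_joint[OF prog s], of \<omega>] \<omega> space_F[OF s] by simp

text \<open>Stated with \<open>\<phi>\<close> to cover truncation, absolute value and square in one
  go; these are the ingredients of the drift part and of the clock.\<close>

lemma progressive_integral:
  fixes \<phi> :: "real \<Rightarrow> real"
  assumes prog: "progressively_measurable F \<beta>" and s: "0 \<le> s" and \<phi>: "\<phi> \<in> borel_measurable borel"
  shows "(\<lambda>\<omega>. LINT r:{0..s}|lborel. \<phi> (indicat_real {0..T} r * \<beta> r \<omega>)) \<in> borel_measurable (F s)"
proof -
  note [measurable] = progressive_joint[OF prog s] \<phi>
  have "(\<lambda>z. indicat_real {0..s} (snd z) * \<phi> (indicat_real {0..T} (snd z) * (\<lambda>(\<omega>, r). indicat_real {0..s} r * \<beta> r \<omega>) z))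
      \<in> borel_measurable (F s \<Otimes>\<^sub>M lborel)"
    by measurable
  also have "(\<lambda>z. indicat_real {0..s} (snd z) * \<phi> (indicat_real {0..T} (snd z) * (\<lambda>(\<omega>, r). indicat_real {0..s} r * \<beta> r \<omega>) z))
     = (\<lambda>(\<omega>, r). indicat_real {0..s} r * \<phi> (indicat_real {0..T} r * \<beta> r \<omega>))"
    by (auto simp: fun_eq_iff indicator_def)
  finally show ?thesis
    unfolding set_lebesgue_integral_def real_scaleR_def
    by (rule lborel.borel_measurable_lebesgue_integral)
qed

end

section \<open>The inequality for expectations and its limit\<close>

context brownian_test
begin

text \<open>One level of the approximation: a simple integrand, drift truncated at \<open>K\<close>,
  and a grid fine enough for an error of at most \<delta>. The decisive point is that the bound on
  \<open>G m\<close> depends neither on \<open>K\<close> nor on the integrand, which later makes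
  \<open>G\<close> uniformly bounded over all levels.\<close>

lemma level_inequality:
  fixes n \<tau> \<xi> and \<beta> :: "real \<Rightarrow> 'a \<Rightarrow> real" and K N y0 \<delta> :: real
  assumes sd: "simple_data F n \<tau> \<xi>" and prog: "progressively_measurable F \<beta>"
    and K: "K \<ge> 0" and N: "N \<ge> 0" and \<delta>: "\<delta> > 0"
  defines "b \<equiv> \<lambda>\<omega> s. max (- K) (min K (indicat_real {0..t1} s * \<beta> s \<omega>))"
  defines "V \<equiv> \<lambda>s \<omega>. y0 + (LINT r:{0..s}|lborel. b \<omega> r)"
  defines "A \<equiv> \<lambda>s \<omega>. (LINT r:{0..s}|lborel. \<bar>b \<omega> r\<bar>) + (LINT r:{0..s}|lborel. (simple_process n \<tau> \<xi> r \<omega>)\<^sup>2)"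
  defines "X \<equiv> simple_integral W n \<tau> \<xi>"
  defines "G \<equiv> \<lambda>m \<omega>. \<Sum>j<m. clock_weight N (A (grid t0 t1 m j) \<omega>) *
          (hs (grid t0 t1 m j) (V (grid t0 t1 m j) \<omega> + X (grid t0 t1 m j) \<omega>) * (grid t0 t1 m (Suc j) - grid t0 t1 m j)
          + hy (grid t0 t1 m j) (V (grid t0 t1 m j) \<omega> + X (grid t0 t1 m j) \<omega>) * (V (grid t0 t1 m (Suc j)) \<omega> - V (grid t0 t1 m j) \<omega>)
          + hyy (grid t0 t1 m j) (V (grid t0 t1 m j) \<omega> + X (grid t0 t1 m j) \<omega>)
              * (LINT s:{grid t0 t1 m j<..grid t0 t1 m (Suc j)}|lborel. (simple_process n \<tau> \<xi> s \<omega>)\<^sup>2) / 2)"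
  obtains m where "0 < m" "(t1 - t0) / real m \<le> \<delta>" "G m \<in> borel_measurable P"
    "\<And>\<omega>. \<omega> \<in> space P \<Longrightarrow> \<bar>G m \<omega>\<bar> \<le> M * (t1 - t0) + M * (N + 2)"
    "expectation (\<lambda>\<omega>. clock_weight N (A t1 \<omega>) * h t1 (V t1 \<omega> + X t1 \<omega>))
      \<le> expectation (\<lambda>\<omega>. h t0 (V t0 \<omega> + X t0 \<omega>)) + expectation (G m) + \<delta>"
    "\<And>s. 0 \<le> s \<Longrightarrow> V s \<in> borel_measurable P" "\<And>s. 0 \<le> s \<Longrightarrow> A s \<in> borel_measurable P"
    "\<And>s. 0 \<le> s \<Longrightarrow> X s \<in> borel_measurable P"
proof -
  let ?H = "simple_process n \<tau> \<xi>"
  have mono: "\<And>i. i < n \<Longrightarrow> \<tau> i \<le> \<tau> (Suc i)" using sd by (auto simp: simple_data_def)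
  obtain CS MQ where MQ: "MQ \<ge> 0"
    and XF: "\<And>t. 0 \<le> t \<Longrightarrow> X t \<in> borel_measurable (F t)"
    and QF: "\<And>u v. 0 \<le> u \<Longrightarrow> u \<le> v \<Longrightarrow> clamp_sum n \<tau> \<xi> u v \<in> borel_measurable (F v)"
    and Qb: "\<And>u v \<omega>. 0 \<le> u \<Longrightarrow> u \<le> v \<Longrightarrow> \<omega> \<in> space P \<Longrightarrow> 0 \<le> clamp_sum n \<tau> \<xi> u v \<omega> \<and> clamp_sum n \<tau> \<xi> u v \<omega> \<le> MQ * (v - u)"
    unfolding X_def by (rule simple_integral_increment[OF sd]) blast
  have Q: "set_integrable lborel {u<..v} (\<lambda>s. (?H s \<omega>)\<^sup>2)" "(LINT s:{u<..v}|lborel. (?H s \<omega>)\<^sup>2) = clamp_sum n \<tau> \<xi> u v \<omega>"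
    if "u \<le> v" for u v \<omega>
    using clamp_sum_eq[of n \<tau> u v \<xi> \<omega>, OF mono that]
    by (auto simp: set_integrable_def set_lebesgue_integral_def has_bochner_integral_iff)
  have bF: "(\<lambda>\<omega>. LINT r:{0..s}|lborel. \<phi> (b \<omega> r)) \<in> borel_measurable (F s)"
    if "0 \<le> s" "\<phi> \<in> borel_measurable borel" for s and \<phi> :: "real \<Rightarrow> real"
  proof -
    have "(\<lambda>x. \<phi> (max (- K) (min K x))) \<in> borel_measurable borel" using that(2) by measurable
    from progressive_integral[OF prog that(1) this] show ?thesis unfolding b_def .
  qed
  have VF: "V s \<in> borel_measurable (F s)" if "0 \<le> s" for s
    unfolding V_def using bF[OF that, of "\<lambda>x. x"] by simp
  \<comment> \<open>The closed form \<open>clamp_sum\<close> shows that the quadratic part of the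
    clock is known at time s.\<close>
  have AF: "A s \<in> borel_measurable (F s)" if "0 \<le> s" for s
    unfolding A_def set_integral_Icc_Ioc[of 0 s "\<lambda>r. (?H r _)\<^sup>2"] Q(2)[OF that]
    using bF[OF that, of "\<lambda>x. \<bar>x\<bar>"] QF[OF order.refl that] by simp
  note VP = measurable_F_imp[OF _ VF] and AP = measurable_F_imp[OF _ AF] and XP = measurable_F_imp[OF _ XF]
  have bm: "b \<omega> \<in> borel_measurable lborel" if "\<omega> \<in> space P" for \<omega>
  proof -
    have "0 \<le> t1" using times by simp
    note [measurable] = progressive_path[OF prog this that]
    show ?thesis unfolding b_def by measurable
  qed
  have bb: "\<bar>b \<omega> s\<bar> \<le> K" for \<omega> s unfolding b_def using K by (auto simp: max_def min_def)
  have bint: "set_integrable lborel {u..v} (b \<omega>)" if "\<omega> \<in> space P" for u v \<omega>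
    unfolding set_integrable_def
  proof (rule integrableI_bounded_set_indicator[where B = K])
    show "b \<omega> \<in> borel_measurable lborel" by (rule bm[OF that])
    show "emeasure lborel {u..v} < \<infinity>" by (cases "u \<le> v") auto
  qed (use bb in auto)
  have babs: "set_integrable lborel {u..v} (\<lambda>r. \<bar>b \<omega> r\<bar>)" if "\<omega> \<in> space P" for u v \<omega>
    using bint[OF that] by (rule set_integrable_abs)
  have Vd: "V v \<omega> - V u \<omega> = (LINT r:{u<..v}|lborel. b \<omega> r)" if "0 \<le> u" "u \<le> v" "\<omega> \<in> space P" for u v \<omega>
    unfolding V_def using set_integral_Icc_diff[OF bint[OF that(3)] that(1,2) order.refl] by simp
  have Bd: "(LINT r:{0..v}|lborel. \<bar>b \<omega> r\<bar>) - (LINT r:{0..u}|lborel. \<bar>b \<omega> r\<bar>) = (LINT r:{u<..v}|lborel. \<bar>b \<omega> r\<bar>)"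
    if "0 \<le> u" "u \<le> v" "\<omega> \<in> space P" for u v \<omega>
    by (rule set_integral_Icc_diff[OF babs[OF that(3)] that(1,2) order.refl])
  have Qd: "(LINT r:{0..v}|lborel. (?H r \<omega>)\<^sup>2) - (LINT r:{0..u}|lborel. (?H r \<omega>)\<^sup>2) = clamp_sum n \<tau> \<xi> u v \<omega>"
    if "0 \<le> u" "u \<le> v" "\<omega> \<in> space P" for u v \<omega>
    using set_integral_Icc_diff[OF _ that(1,2) order.refl, of "\<lambda>r. (?H r \<omega>)\<^sup>2"] Q[of 0 v] Q[of u v] that
    by (auto simp: set_integrable_Icc_Ioc)
  have absV: "\<bar>V v \<omega> - V u \<omega>\<bar> \<le> (LINT r:{u<..v}|lborel. \<bar>b \<omega> r\<bar>)" if "0 \<le> u" "u \<le> v" "\<omega> \<in> space P" for u v \<omega>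
    unfolding Vd[OF that] using set_integral_norm_bound[of lborel "{u<..v}" "b \<omega>"] bint[OF that(3), of u v]
    by (auto simp: set_integrable_Icc_Ioc)
  have absb: "(LINT r:{u<..v}|lborel. \<bar>b \<omega> r\<bar>) \<le> K * (v - u)" "0 \<le> (LINT r:{u<..v}|lborel. \<bar>b \<omega> r\<bar>)"
    if "0 \<le> u" "u \<le> v" "\<omega> \<in> space P" for u v \<omega>
  proof -
    have "(LINT r:{u<..v}|lborel. \<bar>b \<omega> r\<bar>) \<le> (LINT r:{u<..v}|lborel. K)"
    proof (rule set_integral_mono)
      show "set_integrable lborel {u<..v} (\<lambda>r. \<bar>b \<omega> r\<bar>)" using babs[OF that(3), of u v] by (simp add: set_integrable_Icc_Ioc)
      show "set_integrable lborel {u<..v} (\<lambda>r. K)" using that by (auto simp: set_integrable_def)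
    qed (use bb in auto)
    also have "\<dots> = K * (v - u)" using that by (simp add: set_lebesgue_integral_def)
    finally show "(LINT r:{u<..v}|lborel. \<bar>b \<omega> r\<bar>) \<le> K * (v - u)" .
    show "0 \<le> (LINT r:{u<..v}|lborel. \<bar>b \<omega> r\<bar>)"
      unfolding set_lebesgue_integral_def by (intro Bochner_Integration.integral_nonneg) auto
  qed
  have Ad: "A v \<omega> - A u \<omega> = (LINT r:{u<..v}|lborel. \<bar>b \<omega> r\<bar>) + clamp_sum n \<tau> \<xi> u v \<omega>"
    if "0 \<le> u" "u \<le> v" "\<omega> \<in> space P" for u v \<omega>
    unfolding A_def using Bd[OF that] Qd[OF that] by linarith
  have Amono: "A u \<omega> \<le> A v \<omega>" if "0 \<le> u" "u \<le> v" "\<omega> \<in> space P" for u v \<omega>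
    using Ad[OF that] absb(2)[OF that] Qb[OF that] by linarith
  define Y where "Y = (\<lambda>s \<omega>. V s \<omega> + X s \<omega>)"
  define \<Theta> where "\<Theta> = (\<lambda>s \<omega>. clock_weight N (A s \<omega>))"
  have \<Theta>F: "\<Theta> s \<in> borel_measurable (F s)" if "0 \<le> s" for s
    unfolding \<Theta>_def using AF[OF that] by measurable
  have VK: "\<bar>V v \<omega> - V u \<omega>\<bar> \<le> K * (v - u)" if "0 \<le> u" "u \<le> v" "\<omega> \<in> space P" for u v \<omega>
    using absV[OF that] absb(1)[OF that] by linarith
  have \<Theta>d: "\<Theta> v \<omega> \<le> \<Theta> u \<omega>" if "0 \<le> u" "u \<le> v" "\<omega> \<in> space P" for u v \<omega>
    unfolding \<Theta>_def by (intro clock_weight_antimono Amono that)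
  define G' where "G' = (\<lambda>m \<omega>. \<Sum>j<m. \<Theta> (grid t0 t1 m j) \<omega> *
          (hs (grid t0 t1 m j) (Y (grid t0 t1 m j) \<omega>) * (grid t0 t1 m (Suc j) - grid t0 t1 m j)
          + hy (grid t0 t1 m j) (Y (grid t0 t1 m j) \<omega>) * (V (grid t0 t1 m (Suc j)) \<omega> - V (grid t0 t1 m j) \<omega>)
          + hyy (grid t0 t1 m j) (Y (grid t0 t1 m j) \<omega>) * clamp_sum n \<tau> \<xi> (grid t0 t1 m j) (grid t0 t1 m (Suc j)) \<omega> / 2))"
  obtain C' where C': "C' \<ge> 0"
    "\<And>m. 0 < m \<Longrightarrow> (t1 - t0) / real m \<le> 1 \<Longrightarrow> G' m \<in> borel_measurable P \<and>
       expectation (\<lambda>\<omega>. \<Theta> t1 \<omega> * h t1 (Y t1 \<omega>))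
         \<le> expectation (\<lambda>\<omega>. \<Theta> t0 \<omega> * h t0 (Y t0 \<omega>)) + expectation (G' m) + C' * sqrt ((t1 - t0) / real m)"
    unfolding G'_def
    by (rule grid_inequality[where V = V and \<Theta> = \<Theta> and Y = Y and K = K, OF sd VF K VK \<Theta>F _ \<Theta>d])
      (auto simp: Y_def X_def \<Theta>_def clock_weight_bounds)
  have GG: "G' m = G m" for m
    unfolding G'_def G_def
    by (intro ext sum.cong refl) (use grid_mono[of t0 t1] times in \<open>simp add: \<Theta>_def Y_def Q(2)\<close>)
  have lim: "(\<lambda>m. (t1 - t0) / real m) \<longlonglongrightarrow> 0"
    using tendsto_mult[OF tendsto_const lim_1_over_n, of "t1 - t0"] by simp
  have lims: "(\<lambda>m. C' * sqrt ((t1 - t0) / real m)) \<longlonglongrightarrow> 0" "(\<lambda>m. (K + MQ) * ((t1 - t0) / real m)) \<longlonglongrightarrow> 0"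
    using tendsto_mult[OF tendsto_const tendsto_real_sqrt[OF lim], of C'] tendsto_mult[OF tendsto_const lim, of "K + MQ"]
    by simp_all
  \<comment> \<open>The mesh has four tasks: to be below 1 for the one-step estimate, below
    \<delta>, to make the accumulated error less than \<delta>, and to let the clock advance by less
    than 1 per cell as \<open>clock_sum_bound\<close> requires.\<close>
  have "\<forall>\<^sub>F m in sequentially. 0 < m \<and> (t1 - t0) / real m < 1 \<and> (t1 - t0) / real m < \<delta>
      \<and> C' * sqrt ((t1 - t0) / real m) < \<delta> \<and> (K + MQ) * ((t1 - t0) / real m) < 1"
    by (intro eventually_conj eventually_gt_at_top order_tendstoD(2)[OF lim] order_tendstoD(2)[OF lims(1)] order_tendstoD(2)[OF lims(2)])
      (use \<delta> in auto)
  then obtain m where m: "0 < m" "(t1 - t0) / real m < 1" "(t1 - t0) / real m < \<delta>"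
      "C' * sqrt ((t1 - t0) / real m) < \<delta>" "(K + MQ) * ((t1 - t0) / real m) < 1"
    by (auto simp: eventually_sequentially)
  let ?p = "grid t0 t1 m"
  have p: "t0 \<le> ?p j" "?p j \<le> t1" "0 \<le> ?p j" if "j \<le> m" for j
    using grid_bounds[of t0 t1 m j] m(1) that times by auto
  have ple: "?p j \<le> ?p (Suc j)" for j by (rule grid_mono) (use times in auto)
  show thesis
  proof (rule that[OF m(1)])
    show "(t1 - t0) / real m \<le> \<delta>" using m by simp
    show "G m \<in> borel_measurable P" using C'(2)[OF m(1)] m(2) GG by auto
    show "V s \<in> borel_measurable P" "A s \<in> borel_measurable P" "X s \<in> borel_measurable P" if "0 \<le> s" for s
      using VP[OF that that] AP[OF that that] XP[OF that that] by auto
    have "expectation (\<lambda>\<omega>. \<Theta> t0 \<omega> * h t0 (Y t0 \<omega>)) \<le> expectation (\<lambda>\<omega>. h t0 (Y t0 \<omega>))"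
    proof (rule integral_mono)
      have t: "t0 \<le> t0" "t0 \<le> t1" using times by auto
      have [measurable]: "Y t0 \<in> borel_measurable P"
        unfolding Y_def using VP[OF times(1) times(1)] XP[OF times(1) times(1)] by measurable
      note [measurable] = measurable_F_imp[OF times(1) \<Theta>F[OF times(1)]] slice_measurable[OF t]
      have hb: "\<bar>h t0 y\<bar> \<le> M" for y using h_nonneg[OF t, of y] h_bound[OF t, of y] by simp
      show "integrable P (\<lambda>\<omega>. h t0 (Y t0 \<omega>))" by (rule bounded_integrable[OF _ hb]) measurable
      then show "integrable P (\<lambda>\<omega>. \<Theta> t0 \<omega> * h t0 (Y t0 \<omega>))"
      proof (rule integrable_bounded_mult[where B = 1])
        show "\<Theta> t0 \<in> borel_measurable P" by measurable
      qed (simp add: \<Theta>_def clock_weight_bounds)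
      show "\<Theta> t0 \<omega> * h t0 (Y t0 \<omega>) \<le> h t0 (Y t0 \<omega>)" for \<omega>
        using mult_right_mono[OF clock_weight_bounds(2) h_nonneg[OF t], of N] unfolding \<Theta>_def by simp
    qed
    then show "expectation (\<lambda>\<omega>. clock_weight N (A t1 \<omega>) * h t1 (V t1 \<omega> + X t1 \<omega>))
      \<le> expectation (\<lambda>\<omega>. h t0 (V t0 \<omega> + X t0 \<omega>)) + expectation (G m) + \<delta>"
      using C'(2)[OF m(1)] m(2,4) unfolding GG \<Theta>_def Y_def by linarith
    fix \<omega> assume \<omega>: "\<omega> \<in> space P"
    \<comment> \<open>Every summand is at most \<open>M\<close> times the time step plus
      \<open>M\<close> times the weighted increment of the clock, which dominates both the drift
      increment and the quadratic variation.\<close>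
    have "\<bar>G m \<omega>\<bar> \<le> (\<Sum>j<m. M * (?p (Suc j) - ?p j) + M * (clock_weight N (A (?p j) \<omega>) * (A (?p (Suc j)) \<omega> - A (?p j) \<omega>)))"
      unfolding GG[symmetric] G'_def
    proof (rule order.trans[OF sum_abs sum_mono])
      fix j assume "j \<in> {..<m}"
      then have pj: "t0 \<le> ?p j" "?p j \<le> t1" "0 \<le> ?p j" using p[of j] by auto
      let ?y = "Y (?p j) \<omega>" and ?d = "?p (Suc j) - ?p j"
      let ?B = "LINT r:{?p j<..?p (Suc j)}|lborel. \<bar>b \<omega> r\<bar>" and ?Q = "clamp_sum n \<tau> \<xi> (?p j) (?p (Suc j)) \<omega>"
      let ?t = "\<Theta> (?p j) \<omega>"
      have t: "0 \<le> ?t" "?t \<le> 1" by (auto simp: \<Theta>_def clock_weight_bounds)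
      note a = pj(3) ple[of j] \<omega>
      have 1: "\<bar>hs (?p j) ?y * ?d\<bar> \<le> M * ?d"
        using hs_bound[OF pj(1,2), of ?y] ple[of j] by (simp add: abs_mult mult_right_mono)
      have 2: "\<bar>hy (?p j) ?y * (V (?p (Suc j)) \<omega> - V (?p j) \<omega>)\<bar> \<le> M * ?B"
        unfolding abs_mult using hy_bound[OF pj(1,2), of ?y] absV[OF a] M_pos by (intro mult_mono) auto
      have 3: "\<bar>hyy (?p j) ?y * ?Q / 2\<bar> \<le> M * ?Q"
      proof -
        have "\<bar>hyy (?p j) ?y\<bar> * ?Q \<le> M * ?Q" "0 \<le> M * ?Q"
          using hyy_bound[OF pj(1,2), of ?y] Qb[OF a] M_pos by (auto intro: mult_right_mono)
        then show ?thesis using Qb[OF a] by (simp add: abs_mult)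
      qed
      have "\<bar>hs (?p j) ?y * ?d + hy (?p j) ?y * (V (?p (Suc j)) \<omega> - V (?p j) \<omega>) + hyy (?p j) ?y * ?Q / 2\<bar> \<le> M * ?d + M * (?B + ?Q)"
        using 1 2 3 by (simp add: distrib_left)
      then have "?t * \<bar>hs (?p j) ?y * ?d + hy (?p j) ?y * (V (?p (Suc j)) \<omega> - V (?p j) \<omega>) + hyy (?p j) ?y * ?Q / 2\<bar> \<le> ?t * (M * ?d + M * (?B + ?Q))"
        using t by (intro mult_left_mono) auto
      also have "\<dots> = ?t * (M * ?d) + M * (?t * (?B + ?Q))" by (simp add: algebra_simps)
      also have "\<dots> \<le> M * ?d + M * (?t * (?B + ?Q))"
      proof -
        have "0 \<le> M * ?d" using M_pos ple[of j] by simp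
        then have "?t * (M * ?d) \<le> 1 * (M * ?d)" using t by (intro mult_right_mono) auto
        then show ?thesis by simp
      qed
      finally show "\<bar>?t * (hs (?p j) ?y * ?d + hy (?p j) ?y * (V (?p (Suc j)) \<omega> - V (?p j) \<omega>) + hyy (?p j) ?y * ?Q / 2)\<bar>
          \<le> M * ?d + M * (clock_weight N (A (?p j) \<omega>) * (A (?p (Suc j)) \<omega> - A (?p j) \<omega>))"
        unfolding Ad[OF a] abs_mult using t by (simp add: \<Theta>_def)
    qed
    also have "\<dots> = M * (\<Sum>j<m. ?p (Suc j) - ?p j) + M * (\<Sum>j<m. clock_weight N (A (?p j) \<omega>) * (A (?p (Suc j)) \<omega> - A (?p j) \<omega>))"
      by (simp add: sum.distrib sum_distrib_left)
    also have "(\<Sum>j<m. ?p (Suc j) - ?p j) = t1 - t0"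
      by (simp only: sum_lessThan_telescope grid_0 grid_end[OF m(1)])
    also have "(\<Sum>j<m. clock_weight N (A (?p j) \<omega>) * (A (?p (Suc j)) \<omega> - A (?p j) \<omega>)) \<le> N + 2"
    proof (rule clock_sum_bound[OF _ _ N])
      have "A 0 \<omega> = 0" unfolding A_def set_integral_Icc_Ioc by (simp add: set_lebesgue_integral_def)
      then show "0 \<le> A (?p 0) \<omega>" using Amono[OF order.refl times(1) \<omega>] by (simp add: grid_0)
      fix j assume "j < m"
      then have a: "0 \<le> ?p j" "?p j \<le> ?p (Suc j)" "\<omega> \<in> space P" using p[of j] ple \<omega> by auto
      have "A (?p (Suc j)) \<omega> - A (?p j) \<omega> \<le> (K + MQ) * (?p (Suc j) - ?p j)"
        unfolding Ad[OF a] using absb(1)[OF a] Qb[OF a] by (simp add: distrib_right)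
      also have "\<dots> \<le> 1" unfolding grid_Suc using m(5) by simp
      finally show "A (?p j) \<omega> \<le> A (?p (Suc j)) \<omega> \<and> A (?p (Suc j)) \<omega> \<le> A (?p j) \<omega> + 1"
        using Amono[OF a] by simp
    qed
    finally show "\<bar>G m \<omega>\<bar> \<le> M * (t1 - t0) + M * (N + 2)"
      using M_pos by (simp add: mult_left_mono)
  qed
qed

text \<open>\<open>q\<close> is a nonnegative bounded majorant of the generator and a Borel function
  of time and position. Nonnegativity allows the weight to be dropped under the integral, and joint
  measurability allows Fubini, after which \<phi> bounds the expectation at each time.
  \<open>Bq\<close> only has to exist; it does not occur in the conclusion.\<close>

lemma ito_inequality:
  fixes \<beta> \<sigma> Y :: "real \<Rightarrow> 'a \<Rightarrow> real" and q :: "real \<Rightarrow> real \<Rightarrow> real" and \<phi> :: "real \<Rightarrow> real" and y0 Bq :: real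
  assumes Y: "ito_process P F W y0 \<beta> \<sigma> Y"
    and q: "(\<lambda>z. q (fst z) (snd z)) \<in> borel_measurable (lborel \<Otimes>\<^sub>M borel)"
    and qb: "\<And>s y. t0 < s \<Longrightarrow> s \<le> t1 \<Longrightarrow> 0 \<le> q s y \<and> q s y \<le> Bq"
    and gen: "AE \<omega> in P. \<forall>s\<in>{t0<..t1}. hs s (Y s \<omega>) + \<beta> s \<omega> * hy s (Y s \<omega>) + (\<sigma> s \<omega>)\<^sup>2 / 2 * hyy s (Y s \<omega>) \<le> q s (Y s \<omega>)"
    and \<phi>: "set_integrable lborel {t0<..t1} \<phi>"
      "\<And>s. t0 < s \<Longrightarrow> s \<le> t1 \<Longrightarrow> expectation (\<lambda>\<omega>. q s (Y s \<omega>)) \<le> \<phi> s"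
    and Ym: "\<And>s. 0 \<le> s \<Longrightarrow> Y s \<in> borel_measurable P"
  shows "expectation (\<lambda>\<omega>. h t1 (Y t1 \<omega>)) \<le> expectation (\<lambda>\<omega>. h t0 (Y t0 \<omega>)) + (LINT s:{t0<..t1}|lborel. \<phi> s)"
proof -
  have t01: "0 \<le> t1" "t0 \<le> t1" "0 \<le> t0" using times by auto
  have prog: "progressively_measurable F \<beta>" "progressively_measurable F \<sigma>"
    and int\<beta>: "AE \<omega> in P. \<forall>t\<ge>0. set_integrable lborel {0..t} (\<lambda>s. \<beta> s \<omega>)"
    and int\<sigma>: "AE \<omega> in P. \<forall>t\<ge>0. set_integrable lborel {0..t} (\<lambda>s. (\<sigma> s \<omega>)\<^sup>2)"
    using Y by (auto simp: ito_process_def)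
  obtain X where X: "ito_integral P F W \<sigma> X"
    and YX: "AE \<omega> in P. \<forall>t\<ge>0. Y t \<omega> = y0 + (LINT s:{0..t}|lborel. \<beta> s \<omega>) + X t \<omega>"
    using Y by (auto simp: ito_process_def)
  have Xc: "AE \<omega> in P. continuous_on {0..} (\<lambda>t. X t \<omega>)" using X by (auto simp: ito_integral_def)
  obtain n \<tau> \<xi> where sd: "\<And>k. simple_data F (n k) (\<tau> k) (\<xi> k)"
    and Z1: "tendsto_zero_in_prob P (\<lambda>k \<omega>. \<integral>\<^sup>+s\<in>{0..t1}. ennreal ((simple_process (n k) (\<tau> k) (\<xi> k) s \<omega> - \<sigma> s \<omega>)\<^sup>2) \<partial>lborel)"
    and Z2: "tendsto_zero_in_prob P (\<lambda>k \<omega>. SUP t\<in>{0..t1}. ennreal \<bar>simple_integral W (n k) (\<tau> k) (\<xi> k) t \<omega> - X t \<omega>\<bar>)"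
    using X t01(1) unfolding ito_integral_def by blast
  \<comment> \<open>The subsequence is thinned out twice, so that the integrands and the integrals
    both converge almost surely along it.\<close>
  obtain r1 where r1: "strict_mono r1"
    "AE \<omega> in P. (\<lambda>k. \<integral>\<^sup>+s\<in>{0..t1}. ennreal ((simple_process (n (r1 k)) (\<tau> (r1 k)) (\<xi> (r1 k)) s \<omega> - \<sigma> s \<omega>)\<^sup>2) \<partial>lborel) \<longlonglongrightarrow> 0"
    using tendsto_zero_in_prob_AE_subseq[OF Z1] by blast
  obtain r2 where r2: "strict_mono r2"
    "AE \<omega> in P. (\<lambda>k. SUP t\<in>{0..t1}. ennreal \<bar>simple_integral W (n (r1 (r2 k))) (\<tau> (r1 (r2 k))) (\<xi> (r1 (r2 k))) t \<omega> - X t \<omega>\<bar>) \<longlonglongrightarrow> 0"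
    using tendsto_zero_in_prob_AE_subseq[OF tendsto_zero_in_prob_subseq[OF Z2 r1(1)]] by blast
  define \<rho> where "\<rho> = (\<lambda>k. r1 (r2 k))"
  define H where "H = (\<lambda>k. simple_process (n (\<rho> k)) (\<tau> (\<rho> k)) (\<xi> (\<rho> k)))"
  define Xk where "Xk = (\<lambda>k. simple_integral W (n (\<rho> k)) (\<tau> (\<rho> k)) (\<xi> (\<rho> k)))"
  \<comment> \<open>Progressive measurability controls the paths on bounded time intervals only.
    Cutting the coefficients off outside [0, t1] makes them measurable on the whole line.\<close>
  define bb where "bb = (\<lambda>\<omega> s. indicat_real {0..t1} s * \<beta> s \<omega>)"
  define sg where "sg = (\<lambda>\<omega> s. indicat_real {0..t1} s * \<sigma> s \<omega>)"
  have lim1: "AE \<omega> in P. (\<lambda>k. \<integral>\<^sup>+s\<in>{0..t1}. ennreal ((H k s \<omega> - sg \<omega> s)\<^sup>2) \<partial>lborel) \<longlonglongrightarrow> 0"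
    using r1(2)
  proof eventually_elim
    case (elim \<omega>)
    have "(\<integral>\<^sup>+s\<in>{0..t1}. ennreal ((H k s \<omega> - sg \<omega> s)\<^sup>2) \<partial>lborel) = (\<integral>\<^sup>+s\<in>{0..t1}. ennreal ((H k s \<omega> - \<sigma> s \<omega>)\<^sup>2) \<partial>lborel)" for k
      by (intro nn_integral_cong) (auto simp: sg_def indicator_def)
    then show ?case using LIMSEQ_subseq_LIMSEQ[OF elim r2(1)] by (simp add: H_def \<rho>_def o_def)
  qed
  have lim2: "AE \<omega> in P. (\<lambda>k. SUP t\<in>{0..t1}. ennreal \<bar>Xk k t \<omega> - X t \<omega>\<bar>) \<longlonglongrightarrow> 0"
    using r2(2) unfolding Xk_def \<rho>_def .
  define b where "b = (\<lambda>k \<omega> s. max (- real k) (min (real k) (bb \<omega> s)))"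
  define V where "V = (\<lambda>k s \<omega>. y0 + (LINT r:{0..s}|lborel. b k \<omega> r))"
  define A where "A = (\<lambda>k s \<omega>. (LINT r:{0..s}|lborel. \<bar>b k \<omega> r\<bar>) + (LINT r:{0..s}|lborel. (H k r \<omega>)\<^sup>2))"
  define A0 where "A0 = (\<lambda>s \<omega>. (LINT r:{0..s}|lborel. \<bar>bb \<omega> r\<bar>) + (LINT r:{0..s}|lborel. (sg \<omega> r)\<^sup>2))"
  \<comment> \<open>A jointly measurable version of \<open>Y\<close>, which itself is only
    measurable at each fixed time. Rounding down to multiples of 1 / (k + 1) leaves countably many
    times, and path continuity recovers \<open>Y\<close> in the limit; \<open>max 0\<close> keeps
    the times nonnegative.\<close>
  define Yt where "Yt = (\<lambda>s \<omega>. lim (\<lambda>k. Y (real_of_int \<lfloor>real (Suc k) * max 0 s\<rfloor> / real (Suc k)) \<omega>))"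
  have Yt_m: "(\<lambda>z. Yt (fst z) (snd z)) \<in> borel_measurable (lborel \<Otimes>\<^sub>M P)"
  proof -
    have "(\<lambda>z. Y (real_of_int \<lfloor>real (Suc k) * max 0 (fst z)\<rfloor> / real (Suc k)) (snd z)) \<in> borel_measurable (lborel \<Otimes>\<^sub>M P)" for k
    proof -
      have "(\<lambda>z. Y (max 0 (real_of_int i / real (Suc k))) (snd z)) \<in> borel_measurable (lborel \<Otimes>\<^sub>M P)" for i
        using measurable_compose[OF measurable_snd Ym[of "max 0 (real_of_int i / real (Suc k))"]] by simp
      moreover have "(\<lambda>z. \<lfloor>real (Suc k) * max 0 (fst z)\<rfloor>) \<in> measurable (lborel \<Otimes>\<^sub>M P) (count_space UNIV)"
        by measurable
      ultimately have "(\<lambda>z. Y (max 0 (real_of_int \<lfloor>real (Suc k) * max 0 (fst z)\<rfloor> / real (Suc k))) (snd z)) \<in> borel_measurable (lborel \<Otimes>\<^sub>M P)"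
        by (rule measurable_compose_countable)
      moreover have "max 0 (real_of_int \<lfloor>real (Suc k) * max 0 x\<rfloor> / real (Suc k)) = real_of_int \<lfloor>real (Suc k) * max 0 x\<rfloor> / real (Suc k)" for x :: real
        by (intro max_absorb2 divide_nonneg_nonneg) auto
      ultimately show ?thesis by simp
    qed
    then show ?thesis unfolding Yt_def by (rule borel_measurable_lim_metric)
  qed
  have Ycont: "AE \<omega> in P. continuous_on {0..} (\<lambda>s. Y s \<omega>)"
    using YX Xc int\<beta>
  proof eventually_elim
    case (elim \<omega>)
    have "continuous_on {0..T} (\<lambda>s. Y s \<omega>)" if "0 \<le> T" for T
    proof -
      have "continuous_on {0..T} (\<lambda>s. y0 + (LINT r:{0..s}|lborel. \<beta> r \<omega>) + X s \<omega>)"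
        using elim that by (intro continuous_on_add continuous_on_const continuous_on_set_integral continuous_on_subset[OF elim(2)]) auto
      then show ?thesis by (rule continuous_on_eq) (use elim in auto)
    qed
    then have c: "continuous_on {0..T} (\<lambda>s. Y s \<omega>)" for T by (cases "0 \<le> T") auto
    show ?case unfolding continuous_on_eq_continuous_within
    proof
      fix s :: real assume s: "s \<in> {0..}"
      have "continuous (at s within {0..s + 1}) (\<lambda>s. Y s \<omega>)"
        using c[of "s + 1"] s by (auto simp: continuous_on_eq_continuous_within)
      moreover have "at s within {0..s + 1} = at s within {0..}"
        by (rule at_within_nhd[of s "{..<s + 1}"]) auto
      ultimately show "continuous (at s within {0..}) (\<lambda>s. Y s \<omega>)" by simp
    qed
  qed
  have Yt_eq: "AE \<omega> in P. \<forall>s\<ge>0. Yt s \<omega> = Y s \<omega>"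
    using Ycont
  proof eventually_elim
    case (elim \<omega>)
    show ?case
    proof (intro allI impI)
      fix s :: real assume s: "0 \<le> s"
      let ?s = "\<lambda>k. real_of_int \<lfloor>real (Suc k) * s\<rfloor> / real (Suc k)"
      have "(\<lambda>k. ?s k - s) \<longlonglongrightarrow> 0"
      proof (rule Lim_null_comparison[OF always_eventually LIMSEQ_Suc[OF lim_1_over_n]], rule allI)
        fix k
        have "\<bar>real_of_int \<lfloor>real (Suc k) * s\<rfloor> - real (Suc k) * s\<bar> \<le> 1" by linarith
        then have "\<bar>real_of_int \<lfloor>real (Suc k) * s\<rfloor> - real (Suc k) * s\<bar> / real (Suc k) \<le> 1 / real (Suc k)"
          by (intro divide_right_mono) auto
        moreover have "?s k - s = (real_of_int \<lfloor>real (Suc k) * s\<rfloor> - real (Suc k) * s) / real (Suc k)"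
          by (simp add: diff_divide_distrib)
        ultimately show "norm (?s k - s) \<le> 1 / real (Suc k)" by (simp only: real_norm_def abs_divide abs_of_nat)
      qed
      from tendsto_add[OF this tendsto_const[of s]] have "?s \<longlonglongrightarrow> s" by simp
      then have "(\<lambda>k. Y (?s k) \<omega>) \<longlonglongrightarrow> Y s \<omega>"
        by (rule continuous_on_tendsto_compose[OF elim]) (use s in auto)
      then show "Yt s \<omega> = Y s \<omega>" unfolding Yt_def using s by (simp add: max_absorb2 limI)
    qed
  qed
  define Q where "Q = (\<lambda>\<omega>. LINT s:{t0<..t1}|lborel. q s (Yt s \<omega>))"
  have qYt: "(\<lambda>z. indicat_real {t0<..t1} (fst z) * q (fst z) (Yt (fst z) (snd z))) \<in> borel_measurable (lborel \<Otimes>\<^sub>M P)"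
  proof -
    have "(\<lambda>z. (fst z, Yt (fst z) (snd z))) \<in> measurable (lborel \<Otimes>\<^sub>M P) (lborel \<Otimes>\<^sub>M borel)"
      using Yt_m by (intro measurable_Pair measurable_fst)
    from measurable_compose[OF this q] have "(\<lambda>z. q (fst z) (Yt (fst z) (snd z))) \<in> borel_measurable (lborel \<Otimes>\<^sub>M P)" by simp
    then show ?thesis by measurable
  qed
  have qpath: "set_integrable lborel {t0<..t1} (\<lambda>s. q s (Yt s \<omega>))" if "\<omega> \<in> space P" for \<omega>
  proof -
    have m: "(\<lambda>s. indicat_real {t0<..t1} s * q s (Yt s \<omega>)) \<in> borel_measurable lborel"
      using measurable_Pair1[OF qYt that] by simp
    have i: "integrable lborel (\<lambda>s. Bq * indicat_real {t0<..t1} s)" using t01 by simp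
    show ?thesis unfolding set_integrable_def real_scaleR_def
      by (rule Bochner_Integration.integrable_bound[OF i m])
        (rule AE_I2, use qb in \<open>auto simp: indicator_def intro: order.trans[OF _ abs_ge_self]\<close>)
  qed
  have Q0: "0 \<le> Q \<omega>" for \<omega>
    unfolding Q_def set_lebesgue_integral_def using qb by (intro Bochner_Integration.integral_nonneg) (auto simp: indicator_def)
  have QB: "Q \<omega> \<le> Bq * (t1 - t0)" if "\<omega> \<in> space P" for \<omega>
  proof -
    have "Q \<omega> \<le> (LINT s:{t0<..t1}|lborel. Bq)"
      unfolding Q_def by (rule set_integral_mono[OF qpath[OF that]]) (use qb t01 in \<open>auto simp: set_integrable_def\<close>)
    also have "\<dots> = Bq * (t1 - t0)" using t01 by (simp add: set_lebesgue_integral_def)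
    finally show ?thesis .
  qed
  have Qm: "Q \<in> borel_measurable P"
    unfolding Q_def set_lebesgue_integral_def real_scaleR_def
    by (rule lborel.borel_measurable_lebesgue_integral)
      (use measurable_compose[OF measurable_pair_swap' qYt] in \<open>simp add: case_prod_beta\<close>)
  \<comment> \<open>Fubini is applied to \<open>Yt\<close>. At each fixed time \<open>Yt\<close>
    equals \<open>Y\<close> almost surely, so the bound \<phi> is available for the inner
    integral.\<close>
  have EQ: "expectation Q \<le> (LINT s:{t0<..t1}|lborel. \<phi> s)"
  proof -
    interpret pair_sigma_finite lborel P ..
    have \<phi>0: "0 \<le> \<phi> s" if "t0 < s" "s \<le> t1" for s
    proof -
      have "0 \<le> expectation (\<lambda>\<omega>. q s (Y s \<omega>))" by (rule Bochner_Integration.integral_nonneg) (use qb[OF that] in auto)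
      with \<phi>(2)[OF that] show ?thesis by linarith
    qed
    have L0: "0 \<le> (LINT s:{t0<..t1}|lborel. \<phi> s)"
      unfolding set_lebesgue_integral_def using \<phi>0 by (intro Bochner_Integration.integral_nonneg) (auto simp: indicator_def)
    have "ennreal (expectation Q) = (\<integral>\<^sup>+\<omega>. ennreal (Q \<omega>) \<partial>P)"
      by (rule nn_integral_eq_integral[symmetric])
        (use Q0 QB Qm in \<open>auto intro!: bounded_integrable[where B = "Bq * (t1 - t0)"]\<close>)
    also have "\<dots> = (\<integral>\<^sup>+\<omega>. (\<integral>\<^sup>+s. ennreal (indicat_real {t0<..t1} s * q s (Yt s \<omega>)) \<partial>lborel) \<partial>P)"
    proof (rule nn_integral_cong)
      fix \<omega> assume "\<omega> \<in> space P"
      then show "ennreal (Q \<omega>) = (\<integral>\<^sup>+s. ennreal (indicat_real {t0<..t1} s * q s (Yt s \<omega>)) \<partial>lborel)"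
        unfolding Q_def set_lebesgue_integral_def real_scaleR_def
        by (intro nn_integral_eq_integral[symmetric]) (use qpath qb in \<open>auto simp: set_integrable_def indicator_def\<close>)
    qed
    also have "\<dots> = (\<integral>\<^sup>+s. (\<integral>\<^sup>+\<omega>. ennreal (indicat_real {t0<..t1} s * q s (Yt s \<omega>)) \<partial>P) \<partial>lborel)"
      using Fubini'[of "\<lambda>s \<omega>. ennreal (indicat_real {t0<..t1} s * q s (Yt s \<omega>))"] qYt by (simp add: case_prod_beta)
    also have "\<dots> \<le> (\<integral>\<^sup>+s. ennreal (indicat_real {t0<..t1} s * \<phi> s) \<partial>lborel)"
    proof (rule nn_integral_mono)
      fix s :: real
      show "(\<integral>\<^sup>+\<omega>. ennreal (indicat_real {t0<..t1} s * q s (Yt s \<omega>)) \<partial>P) \<le> ennreal (indicat_real {t0<..t1} s * \<phi> s)"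
      proof (cases "s \<in> {t0<..t1}")
        case True
        then have s: "t0 < s" "s \<le> t1" "0 \<le> s" using t01 by auto
        have qm: "q s \<in> borel_measurable borel" using measurable_Pair2[OF q, of s] by simp
        have "(\<integral>\<^sup>+\<omega>. ennreal (indicat_real {t0<..t1} s * q s (Yt s \<omega>)) \<partial>P) = (\<integral>\<^sup>+\<omega>. ennreal (q s (Y s \<omega>)) \<partial>P)"
          by (rule nn_integral_cong_AE) (use Yt_eq in eventually_elim, use True s in auto)
        also have "\<dots> = ennreal (expectation (\<lambda>\<omega>. q s (Y s \<omega>)))"
          by (rule nn_integral_eq_integral)
            (use qb[OF s(1,2)] measurable_compose[OF Ym[OF s(3)] qm] in \<open>auto intro!: bounded_integrable[where B = Bq]\<close>)
        also have "\<dots> \<le> ennreal (\<phi> s)" using \<phi>(2)[OF s(1,2)] by (rule ennreal_leI)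
        finally show ?thesis using True by simp
      qed simp
    qed
    also have "\<dots> = ennreal (LINT s:{t0<..t1}|lborel. \<phi> s)"
      unfolding set_lebesgue_integral_def real_scaleR_def
      by (rule nn_integral_eq_integral) (use \<phi> \<phi>0 in \<open>auto simp: set_integrable_def indicator_def\<close>)
    finally show ?thesis using L0 by simp
  qed
  have t: "t0 \<le> t1" "t1 \<le> t1" "t0 \<le> t0" using t01 by auto
  have hb: "\<bar>h s y\<bar> \<le> M" if "t0 \<le> s" "s \<le> t1" for s y using h_nonneg[OF that, of y] h_bound[OF that, of y] by simp
  note [measurable] = slice_measurable(1)[OF t(1,2)] slice_measurable(1)[OF t(3,1)]
  have A0m: "A0 t1 \<in> borel_measurable P"
    unfolding A0_def bb_def sg_def
    using measurable_F_imp[OF t01(1) progressive_integral[OF prog(1) t01(1), of "\<lambda>x. \<bar>x\<bar>" t1]]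
      measurable_F_imp[OF t01(1) progressive_integral[OF prog(2) t01(1), of "\<lambda>x. x\<^sup>2" t1]] by measurable
  \<comment> \<open>The level k tends to infinity for a fixed threshold N of the clock; N itself is
    removed at the end.\<close>
  have weighted: "expectation (\<lambda>\<omega>. clock_weight (real N) (A0 t1 \<omega>) * h t1 (Y t1 \<omega>))
      \<le> expectation (\<lambda>\<omega>. h t0 (Y t0 \<omega>)) + (LINT s:{t0<..t1}|lborel. \<phi> s)" for N :: nat
  proof -
    define G where "G = (\<lambda>k m \<omega>. \<Sum>j<m. clock_weight (real N) (A k (grid t0 t1 m j) \<omega>) *
          (hs (grid t0 t1 m j) (V k (grid t0 t1 m j) \<omega> + Xk k (grid t0 t1 m j) \<omega>) * (grid t0 t1 m (Suc j) - grid t0 t1 m j)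
          + hy (grid t0 t1 m j) (V k (grid t0 t1 m j) \<omega> + Xk k (grid t0 t1 m j) \<omega>) * (V k (grid t0 t1 m (Suc j)) \<omega> - V k (grid t0 t1 m j) \<omega>)
          + hyy (grid t0 t1 m j) (V k (grid t0 t1 m j) \<omega> + Xk k (grid t0 t1 m j) \<omega>)
              * (LINT s:{grid t0 t1 m j<..grid t0 t1 m (Suc j)}|lborel. (H k s \<omega>)\<^sup>2) / 2))"
    define B where "B = M * (t1 - t0) + M * (real N + 2)"
    define R where "R = (\<lambda>k m. 0 < m \<and> (t1 - t0) / real m \<le> 1 / real (Suc k) \<and> G k m \<in> borel_measurable P \<and>
        (\<forall>\<omega>\<in>space P. \<bar>G k m \<omega>\<bar> \<le> B) \<and>
        expectation (\<lambda>\<omega>. clock_weight (real N) (A k t1 \<omega>) * h t1 (V k t1 \<omega> + Xk k t1 \<omega>))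
          \<le> expectation (\<lambda>\<omega>. h t0 (V k t0 \<omega> + Xk k t0 \<omega>)) + expectation (G k m) + 1 / real (Suc k) \<and>
        (\<forall>s\<ge>0. V k s \<in> borel_measurable P \<and> A k s \<in> borel_measurable P \<and> Xk k s \<in> borel_measurable P))"
    \<comment> \<open>A diagonal choice: the grid of level k is taken fine enough for an error of at
      most 1 / (k + 1), since the error constant depends on the level.\<close>
    have "\<exists>m. R k m" for k
      unfolding R_def
      unfolding G_def B_def V_def A_def b_def bb_def Xk_def H_def
      apply (rule level_inequality[OF sd[of "\<rho> k"] prog(1), of "real k" "real N" "1 / real (Suc k)" y0])
         apply (simp; fail)+
      subgoal premises p for m
        by (intro exI[of _ m] conjI ballI allI impI; rule p; assumption)
      done
    then obtain m where "\<And>k. R k (m k)" by metis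
    note R = this[unfolded R_def]
    have m: "\<And>k. 0 < m k" "\<And>k. (t1 - t0) / real (m k) \<le> 1 / real (Suc k)"
      and Gm: "\<And>k. G k (m k) \<in> borel_measurable P" and GB: "\<And>k \<omega>. \<omega> \<in> space P \<Longrightarrow> \<bar>G k (m k) \<omega>\<bar> \<le> B"
      and ineq: "\<And>k. expectation (\<lambda>\<omega>. clock_weight (real N) (A k t1 \<omega>) * h t1 (V k t1 \<omega> + Xk k t1 \<omega>))
          \<le> expectation (\<lambda>\<omega>. h t0 (V k t0 \<omega> + Xk k t0 \<omega>)) + expectation (G k (m k)) + 1 / real (Suc k)"
      and meas: "\<And>k s. 0 \<le> s \<Longrightarrow> V k s \<in> borel_measurable P" "\<And>k s. 0 \<le> s \<Longrightarrow> A k s \<in> borel_measurable P"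
        "\<And>k s. 0 \<le> s \<Longrightarrow> Xk k s \<in> borel_measurable P"
      using R by blast+
    have mlim: "(\<lambda>k. (t1 - t0) / real (m k)) \<longlonglongrightarrow> 0"
      by (rule Lim_null_comparison[OF always_eventually LIMSEQ_Suc[OF lim_1_over_n]]) (use m t01 in auto)
    \<comment> \<open>The limit of \<open>G\<close> is not known to be measurable in \<open>\<omega>\<close>, but its upper bound \<open>Q\<close> is.\<close>
    have conv: "AE \<omega> in P. (\<lambda>k. max (G k (m k) \<omega> - Q \<omega>) 0) \<longlonglongrightarrow> 0
        \<and> (\<lambda>k. clock_weight (real N) (A k t1 \<omega>) * h t1 (V k t1 \<omega> + Xk k t1 \<omega>)) \<longlonglongrightarrow> clock_weight (real N) (A0 t1 \<omega>) * h t1 (Y t1 \<omega>)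
        \<and> (\<lambda>k. h t0 (V k t0 \<omega> + Xk k t0 \<omega>)) \<longlonglongrightarrow> h t0 (Y t0 \<omega>)"
      using int\<beta> int\<sigma> YX Xc lim1 lim2 gen Yt_eq AE_space
    proof eventually_elim
      case (elim \<omega>)
      have "(\<lambda>s. indicat_real {0..t1} s *\<^sub>R bb \<omega> s) = (\<lambda>s. indicat_real {0..t1} s *\<^sub>R \<beta> s \<omega>)"
        "(\<lambda>s. indicat_real {0..t1} s *\<^sub>R (sg \<omega> s)\<^sup>2) = (\<lambda>s. indicat_real {0..t1} s *\<^sub>R (\<sigma> s \<omega>)\<^sup>2)"
        by (auto simp: fun_eq_iff bb_def sg_def indicator_def)
      then have s\<beta>: "set_integrable lborel {0..t1} (bb \<omega>)" and s\<sigma>: "set_integrable lborel {0..t1} (\<lambda>s. (sg \<omega> s)\<^sup>2)"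
        using elim(1,2) t01 unfolding set_integrable_def by auto
      have H2: "set_integrable lborel {0..t1} (\<lambda>s. (H k s \<omega>)\<^sup>2)" for k
      proof -
        have "has_bochner_integral lborel (\<lambda>s. indicat_real {0<..t1} s *\<^sub>R (H k s \<omega>)\<^sup>2) (clamp_sum (n (\<rho> k)) (\<tau> (\<rho> k)) (\<xi> (\<rho> k)) 0 t1 \<omega>)"
          unfolding H_def by (rule clamp_sum_eq) (use sd[of "\<rho> k"] t01 in \<open>auto simp: simple_data_def\<close>)
        then show ?thesis
          unfolding set_integrable_Icc_Ioc by (auto simp: set_integrable_def has_bochner_integral_iff)
      qed
      have Hm: "(\<lambda>s. H k s \<omega>) \<in> borel_measurable lborel" for k
        unfolding H_def simple_process_def by measurable
      have Yeq: "Y s \<omega> = y0 + (LINT r:{0..s}|lborel. bb \<omega> r) + X s \<omega>" if "0 \<le> s" "s \<le> t1" for s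
      proof -
        have "(LINT r:{0..s}|lborel. \<beta> r \<omega>) = (LINT r:{0..s}|lborel. bb \<omega> r)"
          by (rule set_lebesgue_integral_cong) (use that in \<open>auto simp: bb_def\<close>)
        then show ?thesis using elim(3) that by simp
      qed
      note PL = path_limit(1)[where \<beta> = "bb \<omega>" and g = "sg \<omega>" and H = "\<lambda>k s. H k s \<omega>" and X = "\<lambda>s. X s \<omega>"
          and Xk = "\<lambda>k s. Xk k s \<omega>" and Y = "\<lambda>s. Y s \<omega>" and m = m and N = "real N" and ?y0.0 = y0,
          OF progressive_path[OF prog(1) t01(1) elim(9), folded bb_def[THEN fun_cong]] s\<beta>
            progressive_path[OF prog(2) t01(1) elim(9), folded sg_def[THEN fun_cong]] s\<sigma> Hm H2 elim(5) elim(6)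
            continuous_on_subset[OF elim(4)] Yeq m(1) mlim]
        path_limit(4)[where \<beta> = "bb \<omega>" and g = "sg \<omega>" and H = "\<lambda>k s. H k s \<omega>" and X = "\<lambda>s. X s \<omega>"
          and Xk = "\<lambda>k s. Xk k s \<omega>" and Y = "\<lambda>s. Y s \<omega>" and m = m and N = "real N" and ?y0.0 = y0,
          OF progressive_path[OF prog(1) t01(1) elim(9), folded bb_def[THEN fun_cong]] s\<beta>
            progressive_path[OF prog(2) t01(1) elim(9), folded sg_def[THEN fun_cong]] s\<sigma> Hm H2 elim(5) elim(6)
            continuous_on_subset[OF elim(4)] Yeq m(1) mlim]
        path_limit(2)[where \<beta> = "bb \<omega>" and g = "sg \<omega>" and H = "\<lambda>k s. H k s \<omega>" and X = "\<lambda>s. X s \<omega>"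
          and Xk = "\<lambda>k s. Xk k s \<omega>" and Y = "\<lambda>s. Y s \<omega>" and m = m and ?y0.0 = y0,
          OF progressive_path[OF prog(1) t01(1) elim(9), folded bb_def[THEN fun_cong]] s\<beta>
            progressive_path[OF prog(2) t01(1) elim(9), folded sg_def[THEN fun_cong]] s\<sigma> Hm H2 elim(5) elim(6)
            continuous_on_subset[OF elim(4)] Yeq m(1) mlim]
        path_limit(3)[where \<beta> = "bb \<omega>" and g = "sg \<omega>" and H = "\<lambda>k s. H k s \<omega>" and X = "\<lambda>s. X s \<omega>"
          and Xk = "\<lambda>k s. Xk k s \<omega>" and Y = "\<lambda>s. Y s \<omega>" and m = m and ?y0.0 = y0,
          OF progressive_path[OF prog(1) t01(1) elim(9), folded bb_def[THEN fun_cong]] s\<beta>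
            progressive_path[OF prog(2) t01(1) elim(9), folded sg_def[THEN fun_cong]] s\<sigma> Hm H2 elim(5) elim(6)
            continuous_on_subset[OF elim(4)] Yeq m(1) mlim]
      let ?I = "LINT s:{t0<..t1}|lborel. clock_weight (real N) (A0 s \<omega>) * (hs s (Y s \<omega>) + bb \<omega> s * hy s (Y s \<omega>) + (sg \<omega> s)\<^sup>2 / 2 * hyy s (Y s \<omega>))"
      have Glim: "(\<lambda>k. G k (m k) \<omega>) \<longlonglongrightarrow> ?I" and Iint: "set_integrable lborel {t0<..t1} (\<lambda>s. clock_weight (real N) (A0 s \<omega>) * (hs s (Y s \<omega>) + bb \<omega> s * hy s (Y s \<omega>) + (sg \<omega> s)\<^sup>2 / 2 * hyy s (Y s \<omega>)))"
        and Alim: "(\<lambda>k. A k t1 \<omega>) \<longlonglongrightarrow> A0 t1 \<omega>"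
        and Ylim: "\<And>s. 0 \<le> s \<Longrightarrow> s \<le> t1 \<Longrightarrow> (\<lambda>k. V k s \<omega> + Xk k s \<omega>) \<longlonglongrightarrow> Y s \<omega>"
        using PL unfolding G_def A_def A0_def V_def b_def by simp_all
      have "?I \<le> Q \<omega>"
        unfolding Q_def
      proof (rule set_integral_mono[OF Iint qpath[OF elim(9)]])
        fix s assume s: "s \<in> {t0<..t1}"
        then have "bb \<omega> s = \<beta> s \<omega>" "sg \<omega> s = \<sigma> s \<omega>" using t01 by (auto simp: bb_def sg_def)
        moreover have "Yt s \<omega> = Y s \<omega>" using elim(8) s t01 by auto
        moreover have "clock_weight (real N) (A0 s \<omega>) * L \<le> q s (Y s \<omega>)" if "L \<le> q s (Y s \<omega>)" for L
          using mult_left_mono[OF that clock_weight_bounds(1), of "real N" "A0 s \<omega>"]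
            mult_right_mono[OF clock_weight_bounds(2)[of "real N" "A0 s \<omega>"], of "q s (Y s \<omega>)"] qb[of s "Y s \<omega>"] s by auto
        ultimately show "clock_weight (real N) (A0 s \<omega>) * (hs s (Y s \<omega>) + bb \<omega> s * hy s (Y s \<omega>) + (sg \<omega> s)\<^sup>2 / 2 * hyy s (Y s \<omega>)) \<le> q s (Yt s \<omega>)"
          using elim(7) s by simp
      qed
      then have "(\<lambda>k. max (G k (m k) \<omega> - Q \<omega>) 0) \<longlonglongrightarrow> 0"
        using tendsto_max[OF tendsto_diff[OF Glim tendsto_const[of "Q \<omega>"]] tendsto_const[of 0]] by (simp add: max_absorb2)
      moreover have "(\<lambda>k. h t1 (V k t1 \<omega> + Xk k t1 \<omega>)) \<longlonglongrightarrow> h t1 (Y t1 \<omega>)"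
        by (rule continuous_on_tendsto_compose[OF slice_cont[OF h_cont t(1,2)] Ylim]) (use t01 in auto)
      moreover have "(\<lambda>k. h t0 (V k t0 \<omega> + Xk k t0 \<omega>)) \<longlonglongrightarrow> h t0 (Y t0 \<omega>)"
        by (rule continuous_on_tendsto_compose[OF slice_cont[OF h_cont t(3,1)] Ylim]) (use t01 in auto)
      ultimately show ?case by (intro conjI tendsto_mult tendsto_clock_weight Alim)
    qed
    note [measurable] = meas(1)[OF t01(1)] meas(2)[OF t01(1)] meas(3)[OF t01(1)] meas(1)[OF t01(3)] meas(3)[OF t01(3)]
      Ym[OF t01(1)] Ym[OF t01(3)] A0m Gm Qm
    have B0: "0 \<le> B" unfolding B_def using M_pos t01 by auto
    have i: "integrable P (\<lambda>\<omega>. B)" "integrable P (\<lambda>\<omega>. M)" by auto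
    \<comment> \<open>\<open>G\<close> is at most \<open>Q\<close> plus the positive part of their
      difference. The positive part tends to 0 almost surely and is dominated by \<open>B\<close>,
      because \<open>Q\<close> is nonnegative.\<close>
    have E1: "(\<lambda>k. expectation (\<lambda>\<omega>. max (G k (m k) \<omega> - Q \<omega>) 0)) \<longlonglongrightarrow> expectation (\<lambda>\<omega>. 0)"
    proof (rule integral_dominated_convergence[OF _ _ i(1)])
      show "AE \<omega> in P. norm (max (G k (m k) \<omega> - Q \<omega>) 0) \<le> B" for k
      proof (rule AE_I2)
        fix \<omega> assume "\<omega> \<in> space P"
        from GB[OF this, of k] Q0[of \<omega>] B0 show "norm (max (G k (m k) \<omega> - Q \<omega>) 0) \<le> B"
          by (simp add: max_def abs_le_iff)
      qed
    qed (use conv in auto)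
    have E2: "(\<lambda>k. expectation (\<lambda>\<omega>. clock_weight (real N) (A k t1 \<omega>) * h t1 (V k t1 \<omega> + Xk k t1 \<omega>)))
        \<longlonglongrightarrow> expectation (\<lambda>\<omega>. clock_weight (real N) (A0 t1 \<omega>) * h t1 (Y t1 \<omega>))"
    proof (rule integral_dominated_convergence[OF _ _ i(2)])
      show "AE \<omega> in P. norm (clock_weight (real N) (A k t1 \<omega>) * h t1 (V k t1 \<omega> + Xk k t1 \<omega>)) \<le> M" for k
      proof (rule AE_I2)
        fix \<omega>
        have "\<bar>clock_weight (real N) (A k t1 \<omega>)\<bar> * \<bar>h t1 (V k t1 \<omega> + Xk k t1 \<omega>)\<bar> \<le> 1 * M"
          using hb[OF t(1,2)] clock_weight_bounds by (intro mult_mono) auto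
        then show "norm (clock_weight (real N) (A k t1 \<omega>) * h t1 (V k t1 \<omega> + Xk k t1 \<omega>)) \<le> M" by (simp add: abs_mult)
      qed
    qed (use conv in auto)
    have E3: "(\<lambda>k. expectation (\<lambda>\<omega>. h t0 (V k t0 \<omega> + Xk k t0 \<omega>))) \<longlonglongrightarrow> expectation (\<lambda>\<omega>. h t0 (Y t0 \<omega>))"
      by (rule integral_dominated_convergence[OF _ _ i(2)]) (use conv hb[OF t(3,1)] in auto)
    have "expectation (\<lambda>\<omega>. clock_weight (real N) (A k t1 \<omega>) * h t1 (V k t1 \<omega> + Xk k t1 \<omega>))
        \<le> expectation (\<lambda>\<omega>. h t0 (V k t0 \<omega> + Xk k t0 \<omega>)) + (expectation Q + expectation (\<lambda>\<omega>. max (G k (m k) \<omega> - Q \<omega>) 0)) + 1 / real (Suc k)" for k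
    proof -
      have iQ: "integrable P Q" by (rule bounded_integrable[OF Qm]) (use Q0 QB in auto)
      have iG: "integrable P (G k (m k))" by (rule bounded_integrable[OF Gm GB])
      have "expectation (G k (m k)) \<le> expectation (\<lambda>\<omega>. Q \<omega> + max (G k (m k) \<omega> - Q \<omega>) 0)"
        using iQ iG by (intro integral_mono) auto
      also have "\<dots> = expectation Q + expectation (\<lambda>\<omega>. max (G k (m k) \<omega> - Q \<omega>) 0)"
        using iQ iG by (intro Bochner_Integration.integral_add) auto
      finally show ?thesis using ineq[of k] by linarith
    qed
    moreover have "(\<lambda>k. expectation (\<lambda>\<omega>. h t0 (V k t0 \<omega> + Xk k t0 \<omega>)) + (expectation Q + expectation (\<lambda>\<omega>. max (G k (m k) \<omega> - Q \<omega>) 0)) + 1 / real (Suc k))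
        \<longlonglongrightarrow> expectation (\<lambda>\<omega>. h t0 (Y t0 \<omega>)) + (expectation Q + expectation (\<lambda>\<omega>. 0)) + 0"
      by (intro tendsto_add E3 E1 tendsto_const LIMSEQ_Suc[OF lim_1_over_n])
    ultimately have "expectation (\<lambda>\<omega>. clock_weight (real N) (A0 t1 \<omega>) * h t1 (Y t1 \<omega>))
        \<le> expectation (\<lambda>\<omega>. h t0 (Y t0 \<omega>)) + (expectation Q + expectation (\<lambda>\<omega>. 0)) + 0"
      by (intro LIMSEQ_le[OF E2]) auto
    then show ?thesis using EQ by simp
  qed
  note [measurable] = A0m Ym[OF t01(1)]
  \<comment> \<open>For each \<omega> the clock at time t1 is a real number, so the weight equals 1
    for all large N.\<close>
  have "(\<lambda>N. expectation (\<lambda>\<omega>. clock_weight (real N) (A0 t1 \<omega>) * h t1 (Y t1 \<omega>))) \<longlonglongrightarrow> expectation (\<lambda>\<omega>. h t1 (Y t1 \<omega>))"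
  proof (rule integral_dominated_convergence[where w = "\<lambda>_. M"])
    show "AE \<omega> in P. (\<lambda>N. clock_weight (real N) (A0 t1 \<omega>) * h t1 (Y t1 \<omega>)) \<longlonglongrightarrow> h t1 (Y t1 \<omega>)"
    proof (rule AE_I2)
      fix \<omega>
      obtain n :: nat where n: "A0 t1 \<omega> \<le> real n" using real_arch_simple by blast
      have "\<forall>\<^sub>F N in sequentially. clock_weight (real N) (A0 t1 \<omega>) * h t1 (Y t1 \<omega>) = h t1 (Y t1 \<omega>)"
        using eventually_ge_at_top[of n] by eventually_elim (use n in \<open>simp add: clock_weight_1\<close>)
      then show "(\<lambda>N. clock_weight (real N) (A0 t1 \<omega>) * h t1 (Y t1 \<omega>)) \<longlonglongrightarrow> h t1 (Y t1 \<omega>)" by (rule tendsto_eventually)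
    qed
    show "AE \<omega> in P. norm (clock_weight (real N) (A0 t1 \<omega>) * h t1 (Y t1 \<omega>)) \<le> M" for N
    proof (rule AE_I2)
      fix \<omega>
      have "\<bar>clock_weight (real N) (A0 t1 \<omega>)\<bar> * \<bar>h t1 (Y t1 \<omega>)\<bar> \<le> 1 * M"
        using hb[OF t(1,2)] clock_weight_bounds by (intro mult_mono) auto
      then show "norm (clock_weight (real N) (A0 t1 \<omega>) * h t1 (Y t1 \<omega>)) \<le> M" by (simp add: abs_mult)
    qed
  qed auto
  then show ?thesis by (rule LIMSEQ_le_const2) (use weighted in auto)
qed

end

section \<open>Smoothed density bounds\<close>

lemma locally_bounded_on_interval:
  assumes "locally_bounded f"
  obtains B where "B \<ge> 0" "\<And>x. \<bar>x\<bar> \<le> R \<Longrightarrow> \<bar>f x\<bar> \<le> B"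
proof -
  have "\<exists>r>0. bounded (f ` cball x r)" for x using assms by (simp add: locally_bounded_def)
  then obtain r where r: "\<And>x. r x > 0" "\<And>x. bounded (f ` cball x (r x))" by metis
  have cover: "{-R..R} \<subseteq> (\<Union>x\<in>{-R..R}. ball x (r x))" by (intro subsetI UN_I) (auto simp: r(1))
  obtain T where T: "finite T" "{-R..R} \<subseteq> (\<Union>x\<in>T. ball x (r x))"
    by (rule compactE_image[OF compact_Icc open_ball cover])
  have "bounded (\<Union>x\<in>T. f ` cball x (r x))" using T(1) r(2) by (intro bounded_UN) auto
  moreover have "f ` {-R..R} \<subseteq> (\<Union>x\<in>T. f ` cball x (r x))"
  proof
    fix z assume "z \<in> f ` {-R..R}"
    then obtain y where y: "y \<in> {-R..R}" "z = f y" by auto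
    then obtain x where "x \<in> T" "y \<in> ball x (r x)" using T(2) by blast
    then have "x \<in> T" "y \<in> cball x (r x)" by (auto simp: mem_ball_imp_mem_cball)
    then show "z \<in> (\<Union>x\<in>T. f ` cball x (r x))" using y by blast
  qed
  ultimately have "bounded (f ` {-R..R})" by (rule bounded_subset)
  then obtain B where "\<forall>z\<in>f ` {-R..R}. norm z \<le> B" unfolding bounded_iff by blast
  then have B: "\<bar>f x\<bar> \<le> B" if "x \<in> {-R..R}" for x using that by auto
  show thesis
  proof (rule that[of "max B 0"])
    fix x :: real assume "\<bar>x\<bar> \<le> R"
    then have "x \<in> {-R..R}" by auto
    from B[OF this] show "\<bar>f x\<bar> \<le> max B 0" by simp
  qed simp
qed

text \<open>A compactness argument, taken from the notion \<open>local_lipschitz\<close> for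
  time-dependent maps with the one-point time set {0}.\<close>

lemma locally_lipschitz_on_interval:
  assumes "locally_lipschitz f"
  obtains L where "L-lipschitz_on {-R..R} f"
proof -
  have "local_lipschitz {0 :: real} {-R..R} (\<lambda>_. f)"
    unfolding local_lipschitz_def
  proof (intro ballI)
    fix x t :: real assume "x \<in> {-R..R}"
    from assms obtain r L where "r > 0" "L-lipschitz_on (cball x r) f" unfolding locally_lipschitz_def by blast
    then show "\<exists>u>0. \<exists>L. \<forall>t\<in>cball t u \<inter> {0}. L-lipschitz_on (cball x u \<inter> {-R..R}) f"
      by (intro exI[of _ r] conjI exI[of _ L]) (auto intro: lipschitz_on_subset)
  qed
  then obtain L where "\<And>t. t \<in> {0 :: real} \<Longrightarrow> L-lipschitz_on {-R..R} f"
    using local_lipschitz_compact_implies_lipschitz[of "{0 :: real}" "{-R..R}" "\<lambda>_. f"] by auto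
  then show thesis using that by blast
qed

text \<open>On a compact interval \<sigma> attains a positive minimum, and \<sigma>^2 is Lipschitz
  with constant 2 L max \<sigma>. The lower bound is local only; the cutoff keeps all estimates
  inside the interval.\<close>

lemma volatility_bounds:
  fixes \<sigma> :: "real \<Rightarrow> real"
  assumes lip: "locally_lipschitz \<sigma>" and pos: "\<And>y. \<sigma> y > 0" and R: "R > 0"
  obtains c0 S L where "0 < c0" "0 \<le> L" "\<And>x. \<bar>x\<bar> \<le> R \<Longrightarrow> c0 \<le> (\<sigma> x)\<^sup>2 \<and> (\<sigma> x)\<^sup>2 \<le> S"
    "\<And>x y. \<bar>x\<bar> \<le> R \<Longrightarrow> \<bar>y\<bar> \<le> R \<Longrightarrow> \<bar>(\<sigma> y)\<^sup>2 - (\<sigma> x)\<^sup>2\<bar> \<le> L * \<bar>y - x\<bar>"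
proof -
  obtain L where L: "L-lipschitz_on {-R..R} \<sigma>" by (rule locally_lipschitz_on_interval[OF lip])
  have cont: "continuous_on {-R..R} \<sigma>" by (rule lipschitz_on_continuous_on[OF L])
  have ne: "{-R..R} \<noteq> {}" using R by auto
  obtain m where m: "m \<in> {-R..R}" "\<And>x. x \<in> {-R..R} \<Longrightarrow> \<sigma> m \<le> \<sigma> x"
    using continuous_attains_inf[OF compact_Icc ne cont] by blast
  obtain M where M: "M \<in> {-R..R}" "\<And>x. x \<in> {-R..R} \<Longrightarrow> \<sigma> x \<le> \<sigma> M"
    using continuous_attains_sup[OF compact_Icc ne cont] by blast
  have L0: "L \<ge> 0" using L by (rule lipschitz_on_nonneg)
  show thesis
  proof (rule that[of "(\<sigma> m)\<^sup>2" "L * (2 * \<sigma> M)" "(\<sigma> M)\<^sup>2"])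
    show "0 < (\<sigma> m)\<^sup>2" using pos[of m] by simp
    show "0 \<le> L * (2 * \<sigma> M)" using L0 pos[of M] by simp
    show "(\<sigma> m)\<^sup>2 \<le> (\<sigma> x)\<^sup>2 \<and> (\<sigma> x)\<^sup>2 \<le> (\<sigma> M)\<^sup>2" if "\<bar>x\<bar> \<le> R" for x
    proof -
      have "x \<in> {-R..R}" using that by auto
      from m(2)[OF this] M(2)[OF this] pos[of m] pos[of x] show ?thesis by (simp add: power_mono)
    qed
    show "\<bar>(\<sigma> y)\<^sup>2 - (\<sigma> x)\<^sup>2\<bar> \<le> L * (2 * \<sigma> M) * \<bar>y - x\<bar>" if "\<bar>x\<bar> \<le> R" "\<bar>y\<bar> \<le> R" for x y
    proof -
      have xy: "x \<in> {-R..R}" "y \<in> {-R..R}" using that by auto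
      have "\<bar>\<sigma> y - \<sigma> x\<bar> \<le> L * \<bar>y - x\<bar>" using lipschitz_onD[OF L xy(2,1)] by (simp add: dist_real_def)
      moreover have "\<bar>\<sigma> y + \<sigma> x\<bar> \<le> 2 * \<sigma> M" using M(2)[OF xy(1)] M(2)[OF xy(2)] pos[of x] pos[of y] by simp
      ultimately have "\<bar>\<sigma> y - \<sigma> x\<bar> * \<bar>\<sigma> y + \<sigma> x\<bar> \<le> (L * \<bar>y - x\<bar>) * (2 * \<sigma> M)"
        using L0 by (intro mult_mono) auto
      moreover have "(\<sigma> y)\<^sup>2 - (\<sigma> x)\<^sup>2 = (\<sigma> y - \<sigma> x) * (\<sigma> y + \<sigma> x)" by (simp add: power2_eq_square algebra_simps)
      ultimately show ?thesis by (simp add: abs_mult mult_ac)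
    qed
  qed
qed

text \<open>The exponent -3/4 lies above -1, so the integral stays bounded as \<open>e\<close> tends
  to 0 although the integrand blows up at t1. The antiderivative is -(4 / c) v^(1/4).\<close>

lemma integral_powr_variance:
  fixes e c t0 t1 :: real
  assumes e: "e > 0" and c: "c > 0" and t: "t0 \<le> t1"
  shows "set_integrable lborel {t0<..t1} (\<lambda>s. (e + c * (t1 - s)) powr (-3/4))"
    and "(LINT s:{t0<..t1}|lborel. (e + c * (t1 - s)) powr (-3/4)) \<le> 4 / c * (e + c * (t1 - t0)) powr (1/4)"
proof -
  let ?v = "\<lambda>s. e + c * (t1 - s)"
  have v: "?v s > 0" if "s \<le> t1" for s using that e c by (intro add_pos_nonneg) auto
  have cont: "continuous_on {t0..t1} (\<lambda>s. ?v s powr (-3/4))"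
    by (intro continuous_intros) (use v in force)
  have "set_integrable lborel {t0..t1} (\<lambda>s. ?v s powr (-3/4))"
    unfolding set_integrable_def by (rule borel_integrable_compact[OF compact_Icc cont])
  then show "set_integrable lborel {t0<..t1} (\<lambda>s. ?v s powr (-3/4))"
    by (simp only: set_integrable_Icc_Ioc)
  have "(LINT s:{t0..t1}|lborel. ?v s powr (-3/4)) = - (4 / c) * ?v t1 powr (1/4) - - (4 / c) * ?v t0 powr (1/4)"
    unfolding set_lebesgue_integral_def
  proof (rule integral_FTC_atLeastAtMost[OF t _ cont])
    fix s assume s: "t0 \<le> s" "s \<le> t1"
    have "((\<lambda>s. - (4 / c) * ?v s powr (1/4)) has_real_derivative ?v s powr (-3/4)) (at s)"
      using v[OF s(2)] c by (auto intro!: derivative_eq_intros simp: powr_diff field_simps powr_minus_divide)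
    then show "((\<lambda>s. - (4 / c) * ?v s powr (1/4)) has_vector_derivative ?v s powr (-3/4)) (at s within {t0..t1})"
      by (simp add: has_real_derivative_iff_has_vector_derivative[symmetric] has_field_derivative_at_within)
  qed
  also have "\<dots> \<le> 4 / c * ?v t0 powr (1/4)" using c by simp
  finally show "(LINT s:{t0<..t1}|lborel. ?v s powr (-3/4)) \<le> 4 / c * ?v t0 powr (1/4)"
    by (simp add: set_integral_Icc_Ioc)
qed

text \<open>
  This holds trivially for \<open>a = 1/2\<close>, and for \<open>a = 0\<close> it is a bound on the density of \<open>Y t\<close> in \<open>[-R, R]\<close>.
\<close>

definition (in prob_space) smoothed_bound :: "(real \<Rightarrow> 'a \<Rightarrow> real) \<Rightarrow> real \<Rightarrow> real \<Rightarrow> real \<Rightarrow> real \<Rightarrow> bool" where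
  "smoothed_bound Y t R s0 a \<longleftrightarrow> (\<forall>E>0. \<exists>K\<ge>0. \<forall>x s \<epsilon>. \<bar>x\<bar> \<le> R \<longrightarrow> s0 \<le> s \<longrightarrow> s \<le> t \<longrightarrow> 0 < \<epsilon> \<longrightarrow> \<epsilon> \<le> E \<longrightarrow>
     expectation (\<lambda>\<omega>. indicator {-R..R} (Y s \<omega>) * gauss_deriv 0 \<epsilon> (Y s \<omega> - x)) \<le> K * \<epsilon> powr (- a))"

section \<open>Improving the smoothed bound\<close>

context brownian_basis
begin

lemma gauss_measurable [measurable]: "gauss_deriv 0 v \<in> borel_measurable borel"
  unfolding gauss_deriv.simps(1)[abs_def] by measurable

text \<open>The maximum of the kernel gives the starting exponent 1/2 of the iteration.\<close>

lemma smoothed_integrable: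
  fixes U :: "'a \<Rightarrow> real"
  assumes [measurable]: "U \<in> borel_measurable P" and \<epsilon>: "\<epsilon> > 0"
  shows "integrable P (\<lambda>\<omega>. indicat_real {-R..R} (U \<omega>) * gauss_deriv 0 \<epsilon> (U \<omega> - x))"
    and "expectation (\<lambda>\<omega>. indicat_real {-R..R} (U \<omega>) * gauss_deriv 0 \<epsilon> (U \<omega> - x)) \<le> \<epsilon> powr (-1/2)"
proof -
  have b: "\<bar>indicat_real {-R..R} (U \<omega>) * gauss_deriv 0 \<epsilon> (U \<omega> - x)\<bar> \<le> \<epsilon> powr (-1/2)" for \<omega>
    using gauss_le[OF \<epsilon>, of "U \<omega> - x"] gauss_nonneg[OF \<epsilon>, of "U \<omega> - x"]
    by (cases "U \<omega> \<in> {-R..R}") (simp_all del: gauss_deriv.simps)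
  show i: "integrable P (\<lambda>\<omega>. indicat_real {-R..R} (U \<omega>) * gauss_deriv 0 \<epsilon> (U \<omega> - x))"
    by (rule bounded_integrable[OF _ b]) measurable
  have "expectation (\<lambda>\<omega>. indicat_real {-R..R} (U \<omega>) * gauss_deriv 0 \<epsilon> (U \<omega> - x)) \<le> expectation (\<lambda>_. \<epsilon> powr (-1/2))"
    by (rule integral_mono[OF i]) (use b in \<open>auto simp: abs_le_iff simp del: gauss_deriv.simps\<close>)
  then show "expectation (\<lambda>\<omega>. indicat_real {-R..R} (U \<omega>) * gauss_deriv 0 \<epsilon> (U \<omega> - x)) \<le> \<epsilon> powr (-1/2)"
    by (simp add: prob_space del: gauss_deriv.simps)
qed

text \<open>Apply \<open>ito_inequality\<close> from s0 to the time r to the test function frozen at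
  x. At time r it dominates a multiple of the smoothed kernel on [-R', R']; at time s0 it is bounded
  independently of \<epsilon>, since the variance is at least c0 (s1 - s0). In between, the
  generator is controlled by the hypothesis at the scale of twice the variance.\<close>

lemma smoothed_bound_step:
  fixes b \<sigma> :: "real \<Rightarrow> real" and Y :: "real \<Rightarrow> 'a \<Rightarrow> real"
  assumes \<sigma>_pos: "\<And>y. \<sigma> y > 0" and b_bdd: "locally_bounded b" and \<sigma>_lip: "locally_lipschitz \<sigma>"
    and Y: "ito_process P F W y0 (\<lambda>s \<omega>. b (Y s \<omega>)) (\<lambda>s \<omega>. \<sigma> (Y s \<omega>)) Y"
    and Ym: "\<And>s. 0 \<le> s \<Longrightarrow> Y s \<in> borel_measurable P"
    and R: "0 < R'" "R' < R" and s: "0 \<le> s0" "s0 < s1" "s1 \<le> t" and a: "a \<ge> 1/4"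
    and hyp: "smoothed_bound Y t R s0 a"
  shows "smoothed_bound Y t R' s1 (a - 1/4)"
  unfolding smoothed_bound_def
proof (intro allI impI)
  note [simp del] = gauss_deriv.simps
  fix E :: real assume E: "E > 0"
  have R0: "R > 0" using R by simp
  obtain c0 S L where c0: "0 < c0" and L: "0 \<le> L"
    and S: "\<And>x. \<bar>x\<bar> \<le> R \<Longrightarrow> c0 \<le> (\<sigma> x)\<^sup>2 \<and> (\<sigma> x)\<^sup>2 \<le> S"
    and Lip: "\<And>x y. \<bar>x\<bar> \<le> R \<Longrightarrow> \<bar>y\<bar> \<le> R \<Longrightarrow> \<bar>(\<sigma> y)\<^sup>2 - (\<sigma> x)\<^sup>2\<bar> \<le> L * \<bar>y - x\<bar>"
    by (rule volatility_bounds[OF \<sigma>_lip \<sigma>_pos R0]) blast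
  obtain B where B: "B \<ge> 0" "\<And>x. \<bar>x\<bar> \<le> R \<Longrightarrow> \<bar>b x\<bar> \<le> B"
    by (rule locally_bounded_on_interval[OF b_bdd]) blast
  have S0: "S > 0" using S[of 0] c0 R0 by auto
  \<comment> \<open>The largest variance that occurs, as \<epsilon> \<le> E, c \<le> S and the
    elapsed time is at most t. The hypothesis is needed up to 2 V because the generator bound
    doubles the variance.\<close>
  define V where "V = E + S * t"
  have V: "V > 0" unfolding V_def using E S0 s by (intro add_pos_nonneg) auto
  define D where "D = 46 * (R ^ 8 * L + B * (8 * R ^ 7 * sqrt V + R ^ 8) + S * (56 * R ^ 6 * sqrt V + 16 * R ^ 7))"
  have D: "D \<ge> 0" unfolding D_def using R0 L B S0 V by (intro mult_nonneg_nonneg add_nonneg_nonneg) auto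
  have "2 * V > 0" using V by simp
  from hyp[unfolded smoothed_bound_def, THEN spec, THEN mp, OF this]
  obtain K where K: "K \<ge> 0" "\<And>x s \<epsilon>. \<bar>x\<bar> \<le> R \<Longrightarrow> s0 \<le> s \<Longrightarrow> s \<le> t \<Longrightarrow> 0 < \<epsilon> \<Longrightarrow> \<epsilon> \<le> 2 * V \<Longrightarrow>
     expectation (\<lambda>\<omega>. indicator {-R..R} (Y s \<omega>) * gauss_deriv 0 \<epsilon> (Y s \<omega> - x)) \<le> K * \<epsilon> powr (- a)"
    by blast
  \<comment> \<open>The minimum of the cutoff over the smaller interval, positive because R' <
    R.\<close>
  define \<kappa> where "\<kappa> = (R\<^sup>2 - R'\<^sup>2) ^ 4"
  have \<kappa>: "\<kappa> > 0" unfolding \<kappa>_def using R by (intro zero_less_power) (simp add: power_strict_mono)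
  define K1 where "K1 = R ^ 8 * (c0 * (s1 - s0)) powr (-1/2)"
  define K' where "K' = (K1 * E powr (a - 1/4) + D * K * (4 / c0 * V powr (1/4))) / \<kappa>"
  have K1: "K1 \<ge> 0" unfolding K1_def using R0 by auto
  have K': "K' \<ge> 0" unfolding K'_def using K1 D K c0 \<kappa> by (intro divide_nonneg_pos add_nonneg_nonneg mult_nonneg_nonneg) auto
  show "\<exists>K\<ge>0. \<forall>x s \<epsilon>. \<bar>x\<bar> \<le> R' \<longrightarrow> s1 \<le> s \<longrightarrow> s \<le> t \<longrightarrow> 0 < \<epsilon> \<longrightarrow> \<epsilon> \<le> E \<longrightarrow>
     expectation (\<lambda>\<omega>. indicator {-R'..R'} (Y s \<omega>) * gauss_deriv 0 \<epsilon> (Y s \<omega> - x)) \<le> K * \<epsilon> powr (- (a - 1/4))"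
  proof (intro exI[of _ K'] conjI K' allI impI)
    fix x r \<epsilon> :: real assume x: "\<bar>x\<bar> \<le> R'" and r: "s1 \<le> r" "r \<le> t" and \<epsilon>: "0 < \<epsilon>" "\<epsilon> \<le> E"
    define c where "c = (\<sigma> x)\<^sup>2"
    have xR: "\<bar>x\<bar> \<le> R" using x R by simp
    have c: "c0 \<le> c" "c \<le> S" "0 < c" using S[OF xR] c0 by (auto simp: c_def)
    have r0: "s0 < r" "0 \<le> r" using r s by auto
    let ?v = "\<lambda>u. \<epsilon> + c * (r - u)"
    have v: "0 < ?v u" "\<epsilon> \<le> ?v u" "?v u \<le> V" if "s0 \<le> u" "u \<le> r" for u
    proof -
      have "0 \<le> c * (r - u)" using c that by simp
      then show "0 < ?v u" "\<epsilon> \<le> ?v u" using \<epsilon> by auto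
      have "c * (r - u) \<le> S * t" using c that s r by (intro mult_mono) auto
      then show "?v u \<le> V" using \<epsilon> by (simp add: V_def)
    qed
    obtain M C where tf: "test_function s0 r M C (test_fun R c \<epsilon> r x) (test_fun_s R c \<epsilon> r x) (test_fun_y R c \<epsilon> r x) (test_fun_yy R c \<epsilon> r x)"
      using test_fun_regular[of s0 r \<epsilon> c R x] s r0 \<epsilon> c R0 by auto
    interpret brownian_test P F W s0 r M C "test_fun R c \<epsilon> r x" "test_fun_s R c \<epsilon> r x" "test_fun_y R c \<epsilon> r x" "test_fun_yy R c \<epsilon> r x"
      by (intro brownian_test.intro brownian_basis_axioms tf)
    \<comment> \<open>The indicator is justified by the cutoff: outside [-R, R] the test function
      and its derivatives vanish, so the generator is 0 there.\<close>
    define q where "q = (\<lambda>u y. indicat_real {-R..R} y * (D * ?v u powr (-1/2) * gauss_deriv 0 (2 * ?v u) (y - x)))"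
    define \<phi> where "\<phi> = (\<lambda>u. D * K * \<epsilon> powr (- (a - 1/4)) * ?v u powr (-3/4))"
    have bound: "expectation (\<lambda>\<omega>. test_fun R c \<epsilon> r x r (Y r \<omega>))
        \<le> expectation (\<lambda>\<omega>. test_fun R c \<epsilon> r x s0 (Y s0 \<omega>)) + (LINT u:{s0<..r}|lborel. \<phi> u)"
    proof (rule ito_inequality[OF Y])
      show "(\<lambda>z. q (fst z) (snd z)) \<in> borel_measurable (lborel \<Otimes>\<^sub>M borel)"
        unfolding q_def gauss_deriv.simps(1) by measurable
      \<comment> \<open>A crude bound of order 1 / \<epsilon>, which only serves to make
        \<open>q\<close> bounded for fixed \<epsilon>.\<close>
      show "0 \<le> q u y \<and> q u y \<le> D * (\<epsilon> powr (-1/2) * \<epsilon> powr (-1/2))" if "s0 < u" "u \<le> r" for u y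
      proof -
        note vu = v[of u]
        have u: "s0 \<le> u" "u \<le> r" using that by auto
        have g: "0 \<le> gauss_deriv 0 (2 * ?v u) (y - x)" using vu(1)[OF u] by (intro gauss_nonneg) auto
        have "gauss_deriv 0 (2 * ?v u) (y - x) \<le> (2 * ?v u) powr (-1/2)" using vu(1)[OF u] by (intro gauss_le) auto
        also have "\<dots> \<le> \<epsilon> powr (-1/2)" using vu[OF u] \<epsilon> by (intro powr_mono2') auto
        finally have "?v u powr (-1/2) * gauss_deriv 0 (2 * ?v u) (y - x) \<le> \<epsilon> powr (-1/2) * \<epsilon> powr (-1/2)"
          using vu[OF u] \<epsilon> g by (intro mult_mono powr_mono2') auto
        then have "D * (?v u powr (-1/2) * gauss_deriv 0 (2 * ?v u) (y - x)) \<le> D * (\<epsilon> powr (-1/2) * \<epsilon> powr (-1/2))"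
          using D by (intro mult_left_mono)
        then show ?thesis using D g by (auto simp: q_def indicator_def mult.assoc)
      qed
      show "AE \<omega> in P. \<forall>u\<in>{s0<..r}. test_fun_s R c \<epsilon> r x u (Y u \<omega>) + b (Y u \<omega>) * test_fun_y R c \<epsilon> r x u (Y u \<omega>)
          + (\<sigma> (Y u \<omega>))\<^sup>2 / 2 * test_fun_yy R c \<epsilon> r x u (Y u \<omega>) \<le> q u (Y u \<omega>)"
      proof (rule AE_I2, rule ballI)
        fix \<omega> u assume u: "u \<in> {s0<..r}"
        let ?y = "Y u \<omega>"
        show "test_fun_s R c \<epsilon> r x u ?y + b ?y * test_fun_y R c \<epsilon> r x u ?y + (\<sigma> ?y)\<^sup>2 / 2 * test_fun_yy R c \<epsilon> r x u ?y \<le> q u ?y"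
        proof (cases "\<bar>?y\<bar> \<le> R")
          case True
          have "test_fun_s R c \<epsilon> r x u ?y + b ?y * test_fun_y R c \<epsilon> r x u ?y + (\<sigma> ?y)\<^sup>2 / 2 * test_fun_yy R c \<epsilon> r x u ?y
              \<le> D * ?v u powr (-1/2) * gauss_deriv 0 (2 * ?v u) (?y - x)"
            unfolding D_def
            by (rule test_fun_generator_bound) (use R0 Lip[OF xR True] B(2)[OF True] S[OF True] True v[of u] u L in \<open>auto simp: c_def\<close>)
          moreover have "?y \<in> {-R..R}" using True by auto
          ultimately show ?thesis by (simp only: q_def indicator_simps mult_1)
        next
          case False
          then have z: "bump R k ?y = 0" if "k > 0" for k using bump_zero[of R ?y k] R0 that by auto
          have "0 \<le> q u ?y"
            unfolding q_def using D v[of u] u gauss_nonneg[of "2 * ?v u" "?y - x"] by auto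
          then show ?thesis unfolding test_fun_s_def test_fun_y_def test_fun_yy_def by (simp add: z)
        qed
      qed
      show "set_integrable lborel {s0<..r} \<phi>"
        unfolding \<phi>_def by (intro set_integrable_mult_right integral_powr_variance(1)) (use \<epsilon> c r0 in auto)
      show "expectation (\<lambda>\<omega>. q u (Y u \<omega>)) \<le> \<phi> u" if "s0 < u" "u \<le> r" for u
      proof -
        have u: "s0 \<le> u" "u \<le> r" "u \<le> t" using that r by auto
        note vu = v[OF u(1,2)]
        have "expectation (\<lambda>\<omega>. q u (Y u \<omega>)) = D * ?v u powr (-1/2) * expectation (\<lambda>\<omega>. indicat_real {-R..R} (Y u \<omega>) * gauss_deriv 0 (2 * ?v u) (Y u \<omega> - x))"
          unfolding q_def by (subst Bochner_Integration.integral_mult_right_zero[symmetric]) (simp add: mult_ac)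
        also have "\<dots> \<le> D * ?v u powr (-1/2) * (K * (2 * ?v u) powr (- a))"
          by (intro mult_left_mono K(2)) (use xR u vu D in auto)
        also have "\<dots> \<le> D * ?v u powr (-1/2) * (K * ?v u powr (- a))"
          using vu D K a by (intro mult_left_mono powr_mono2') auto
        \<comment> \<open>The exponent -1/2 - a is split as -(a - 1/4) - 3/4. The next step replaces
          v by \<epsilon> \<le> v in the first factor, where \<open>a \<ge> 1/4\<close> gives the
          monotonicity; the second factor is integrated over time.\<close>
        also have "\<dots> = D * K * (?v u powr (- (a - 1/4)) * ?v u powr (-3/4))"
        proof -
          have "?v u powr (-1/2) * ?v u powr (- a) = ?v u powr (- (a - 1/4)) * ?v u powr (-3/4)"
            unfolding powr_add[symmetric] by (rule arg_cong[where f = "\<lambda>p. ?v u powr p"]) simp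
          then show ?thesis by (simp add: mult_ac)
        qed
        also have "\<dots> \<le> D * K * (\<epsilon> powr (- (a - 1/4)) * ?v u powr (-3/4))"
          using vu \<epsilon> D K a by (intro mult_left_mono mult_right_mono powr_mono2') auto
        finally show ?thesis by (simp add: \<phi>_def mult_ac)
      qed
    qed (use Ym in auto)
    have i\<phi>: "(LINT u:{s0<..r}|lborel. \<phi> u) \<le> D * K * \<epsilon> powr (- (a - 1/4)) * (4 / c0 * V powr (1/4))"
    proof -
      have "(LINT u:{s0<..r}|lborel. \<phi> u) = D * K * \<epsilon> powr (- (a - 1/4)) * (LINT u:{s0<..r}|lborel. ?v u powr (-3/4))"
        unfolding \<phi>_def by (rule set_integral_mult_right)
      also have "\<dots> \<le> D * K * \<epsilon> powr (- (a - 1/4)) * (4 / c * ?v s0 powr (1/4))"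
        using D K \<epsilon> c r0 by (intro mult_left_mono integral_powr_variance(2)) auto
      also have "\<dots> \<le> D * K * \<epsilon> powr (- (a - 1/4)) * (4 / c0 * V powr (1/4))"
        using D K c c0 v[of s0] r0 by (intro mult_left_mono mult_mono divide_left_mono powr_mono2) auto
      finally show ?thesis .
    qed
    have start: "expectation (\<lambda>\<omega>. test_fun R c \<epsilon> r x s0 (Y s0 \<omega>)) \<le> K1"
    proof -
      have "test_fun R c \<epsilon> r x s0 y \<le> K1" for y
      proof -
        have "gauss_deriv 0 (?v s0) (y - x) \<le> ?v s0 powr (-1/2)" using v[of s0] r0 by (intro gauss_le) auto
        also have "\<dots> \<le> (c0 * (s1 - s0)) powr (-1/2)"
        proof (intro powr_mono2')
          have "c0 * (s1 - s0) \<le> c * (r - s0)" using c c0 r s by (intro mult_mono) auto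
          then show "c0 * (s1 - s0) \<le> ?v s0" using \<epsilon> by simp
        qed (use c0 s in auto)
        finally show ?thesis unfolding test_fun_def K1_def
          using bump_le[of R 4 y] bump_nonneg[of R 4 y] gauss_nonneg[of "?v s0" "y - x"] v[of s0] r0
          by (intro mult_mono) (auto simp flip: power_mult)
      qed
      then have "expectation (\<lambda>\<omega>. test_fun R c \<epsilon> r x s0 (Y s0 \<omega>)) \<le> expectation (\<lambda>_. K1)"
      proof (intro integral_mono)
        show "integrable P (\<lambda>\<omega>. test_fun R c \<epsilon> r x s0 (Y s0 \<omega>))"
          using h_nonneg[of s0] h_bound[of s0] r0 Ym[OF s(1)] slice_measurable(1)[of s0]
          by (intro bounded_integrable[where B = M]) (auto intro: measurable_compose)
      qed auto
      then show ?thesis by (simp add: prob_space)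
    qed
    \<comment> \<open>The initial term is constant in \<epsilon>. It is brought to the form of the
      other terms by (E / \<epsilon>)^(a - 1/4) \<ge> 1, which is why \<open>smoothed_bound\<close>
      restricts \<epsilon> to at most \<open>E\<close>.\<close>
    have K1E: "K1 \<le> K1 * E powr (a - 1/4) * \<epsilon> powr (- (a - 1/4))"
    proof -
      have "1 \<le> (E / \<epsilon>) powr (a - 1/4)" using \<epsilon> a by (intro ge_one_powr_ge_zero) auto
      also have "\<dots> = E powr (a - 1/4) * \<epsilon> powr (- (a - 1/4))"
        using \<epsilon> E by (simp only: powr_divide powr_minus_divide less_imp_le) simp
      finally show ?thesis using mult_left_mono[of 1 "E powr (a - 1/4) * \<epsilon> powr (- (a - 1/4))" K1] K1 by (simp add: mult.assoc)
    qed
    have "\<kappa> * expectation (\<lambda>\<omega>. indicat_real {-R'..R'} (Y r \<omega>) * gauss_deriv 0 \<epsilon> (Y r \<omega> - x))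
        = expectation (\<lambda>\<omega>. \<kappa> * (indicat_real {-R'..R'} (Y r \<omega>) * gauss_deriv 0 \<epsilon> (Y r \<omega> - x)))" by simp
    also have "\<dots> \<le> expectation (\<lambda>\<omega>. test_fun R c \<epsilon> r x r (Y r \<omega>))"
    proof (rule integral_mono)
      show "integrable P (\<lambda>\<omega>. \<kappa> * (indicat_real {-R'..R'} (Y r \<omega>) * gauss_deriv 0 \<epsilon> (Y r \<omega> - x)))"
        using smoothed_integrable(1)[OF Ym[OF r0(2)] \<epsilon>(1)] by auto
      show "integrable P (\<lambda>\<omega>. test_fun R c \<epsilon> r x r (Y r \<omega>))"
        using h_nonneg[of r] h_bound[of r] r0 Ym[OF r0(2)] slice_measurable(1)[of r]
        by (intro bounded_integrable[where B = M]) (auto intro: measurable_compose)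
      fix \<omega>
      have g: "0 \<le> gauss_deriv 0 \<epsilon> (Y r \<omega> - x)" using \<epsilon> by (intro gauss_nonneg)
      show "\<kappa> * (indicat_real {-R'..R'} (Y r \<omega>) * gauss_deriv 0 \<epsilon> (Y r \<omega> - x)) \<le> test_fun R c \<epsilon> r x r (Y r \<omega>)"
      proof (cases "Y r \<omega> \<in> {-R'..R'}")
        case True
        then have "\<kappa> \<le> bump R 4 (Y r \<omega>)" unfolding \<kappa>_def using R by (intro bump_ge) auto
        then show ?thesis using True g by (auto simp: test_fun_def intro: mult_right_mono)
      qed (use g bump_nonneg[of R 4] in \<open>simp add: test_fun_def\<close>)
    qed
    also have "\<dots> \<le> K1 * E powr (a - 1/4) * \<epsilon> powr (- (a - 1/4)) + D * K * \<epsilon> powr (- (a - 1/4)) * (4 / c0 * V powr (1/4))"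
      using bound i\<phi> start K1E by linarith
    also have "\<dots> = \<kappa> * (K' * \<epsilon> powr (- (a - 1/4)))"
      using \<kappa> by (simp add: K'_def field_simps)
    finally show "expectation (\<lambda>\<omega>. indicat_real {-R'..R'} (Y r \<omega>) * gauss_deriv 0 \<epsilon> (Y r \<omega> - x)) \<le> K' * \<epsilon> powr (- (a - 1/4))"
      using \<kappa> by simp
  qed
qed

text \<open>With \<epsilon> = (v - u)^2 the kernel centred at u is at least exp (-1/2) / (v - u) on
  [u, v], so a bound on the smoothed law that is uniform in \<epsilon> bounds the probability by a
  multiple of the length.\<close>

lemma interval_probability_bound:
  fixes b \<sigma> :: "real \<Rightarrow> real" and Y :: "real \<Rightarrow> 'a \<Rightarrow> real"
  assumes \<sigma>_pos: "\<And>y. \<sigma> y > 0" and b_bdd: "locally_bounded b" and \<sigma>_lip: "locally_lipschitz \<sigma>"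
    and Y: "ito_process P F W y0 (\<lambda>s \<omega>. b (Y s \<omega>)) (\<lambda>s \<omega>. \<sigma> (Y s \<omega>)) Y"
    and Ym: "\<And>s. 0 \<le> s \<Longrightarrow> Y s \<in> borel_measurable P"
    and R: "R > 0" and t: "t > 0"
  obtains C where "C \<ge> 0" "\<And>u v. -R \<le> u \<Longrightarrow> u < v \<Longrightarrow> v \<le> R \<Longrightarrow> prob {\<omega> \<in> space P. Y t \<omega> \<in> {u..v}} \<le> C * (v - u)"
proof -
  note [simp del] = gauss_deriv.simps
  note step = smoothed_bound_step[OF \<sigma>_pos b_bdd \<sigma>_lip Y Ym]
  \<comment> \<open>Two rounds are needed to get from 1/2 to 0. The radius shrinks from R + 2 over R
    + 1 to R, and the initial time moves from 0 over t / 2 to t.\<close>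
  have "smoothed_bound Y t (R + 2) 0 (1/2)"
    unfolding smoothed_bound_def
  proof (intro allI impI exI[of _ "1 :: real"] conjI)
    fix x s \<epsilon> :: real assume "0 \<le> s" "0 < \<epsilon>"
    then show "expectation (\<lambda>\<omega>. indicator {-(R + 2)..R + 2} (Y s \<omega>) * gauss_deriv 0 \<epsilon> (Y s \<omega> - x)) \<le> 1 * \<epsilon> powr (- (1/2))"
      by (intro order.trans[OF smoothed_integrable(2)[OF Ym]]) simp_all
  qed simp
  then have "smoothed_bound Y t (R + 1) (t / 2) (1/2 - 1/4)"
    by (rule step[rotated -1]) (use R t in auto)
  then have "smoothed_bound Y t R t (1/2 - 1/4 - 1/4)"
    by (rule step[rotated -1]) (use R t in auto)
  note final = this
  have "(2 * R)\<^sup>2 > 0" using R by simp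
  from final[unfolded smoothed_bound_def, THEN spec, THEN mp, OF this]
  obtain K where K0: "K \<ge> 0" and "\<And>x s \<epsilon>. \<bar>x\<bar> \<le> R \<Longrightarrow> t \<le> s \<Longrightarrow> s \<le> t \<Longrightarrow> 0 < \<epsilon> \<Longrightarrow> \<epsilon> \<le> (2 * R)\<^sup>2 \<Longrightarrow>
     expectation (\<lambda>\<omega>. indicator {-R..R} (Y s \<omega>) * gauss_deriv 0 \<epsilon> (Y s \<omega> - x)) \<le> K * \<epsilon> powr (- (1/2 - 1/4 - 1/4))"
    by blast
  from this(2)[of _ t] have K: "expectation (\<lambda>\<omega>. indicator {-R..R} (Y t \<omega>) * gauss_deriv 0 \<epsilon> (Y t \<omega> - x)) \<le> K"
    if "\<bar>x\<bar> \<le> R" "0 < \<epsilon>" "\<epsilon> \<le> (2 * R)\<^sup>2" for x \<epsilon>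
    using that by simp
  show thesis
  proof (rule that[of "exp (1/2) * K"])
    fix u v assume uv: "-R \<le> u" "u < v" "v \<le> R"
    \<comment> \<open>Smoothing at the scale of the interval itself. Since v - u \<le> 2 R, these
      values never exceed (2 R)^2.\<close>
    define \<epsilon> where "\<epsilon> = (v - u)\<^sup>2"
    have "\<epsilon> \<le> (2 * R)\<^sup>2" unfolding \<epsilon>_def by (rule power_mono) (use uv in auto)
    then have \<epsilon>: "0 < \<epsilon>" "\<epsilon> \<le> (2 * R)\<^sup>2" "sqrt \<epsilon> = v - u" using uv by (auto simp: \<epsilon>_def)
    have [measurable]: "Y t \<in> borel_measurable P" using Ym t by simp
    let ?A = "{\<omega> \<in> space P. Y t \<omega> \<in> {u..v}}"
    let ?k = "exp (- (1/2)) / (v - u)"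
    have "?k * prob ?A = expectation (\<lambda>\<omega>. ?k * indicator ?A \<omega>)" by simp
    also have "\<dots> \<le> expectation (\<lambda>\<omega>. indicator {-R..R} (Y t \<omega>) * gauss_deriv 0 \<epsilon> (Y t \<omega> - u))"
    proof (rule integral_mono)
      show "integrable P (\<lambda>\<omega>. indicator {-R..R} (Y t \<omega>) * gauss_deriv 0 \<epsilon> (Y t \<omega> - u))"
        using smoothed_integrable(1)[OF Ym \<epsilon>(1)] t by simp
      have "?A \<in> events" by measurable
      then show "integrable P (\<lambda>\<omega>. ?k * indicat_real ?A \<omega>)"
        by (intro integrable_mult_right integrable_real_indicator) (auto simp: less_top[symmetric])
      fix \<omega> assume "\<omega> \<in> space P"
      show "?k * indicator ?A \<omega> \<le> indicator {-R..R} (Y t \<omega>) * gauss_deriv 0 \<epsilon> (Y t \<omega> - u)"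
      proof (cases "\<omega> \<in> ?A")
        case True
        then have y: "0 \<le> Y t \<omega> - u" "Y t \<omega> - u \<le> v - u" "Y t \<omega> \<in> {-R..R}" using uv by auto
        have "(Y t \<omega> - u)\<^sup>2 \<le> \<epsilon>" unfolding \<epsilon>_def using y by (intro power_mono) auto
        then have "exp (- (1/2)) \<le> exp (- (Y t \<omega> - u)\<^sup>2 / (2 * \<epsilon>))" using \<epsilon> by (simp add: field_simps)
        then have "?k \<le> gauss_deriv 0 \<epsilon> (Y t \<omega> - u)"
          unfolding gauss_deriv.simps(1) \<epsilon>(3) using uv by (intro divide_right_mono) auto
        then show ?thesis using True y by simp
      qed (use gauss_nonneg[OF \<epsilon>(1)] in simp)
    qed
    also have "\<dots> \<le> K" using K[OF _ \<epsilon>(1,2), of u] uv by auto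
    finally have "exp (1/2) * (v - u) * (?k * prob ?A) \<le> exp (1/2) * (v - u) * K"
      using uv by (intro mult_left_mono) auto
    moreover have "exp (1/2) * (v - u) * (?k * prob ?A) = prob ?A"
      using uv by (simp add: exp_minus field_simps)
    ultimately show "prob ?A \<le> exp (1/2) * K * (v - u)" by (simp add: mult_ac)
  qed (use K0 in auto)
qed

end

section \<open>From interval probabilities to a locally bounded density\<close>

text \<open>
  The set function \<open>A \<mapsto> C |A| - \<mu> A\<close> is realised by the Stieltjes measure of the nondecreasing function
  \<open>x \<mapsto> C x - \<mu> ((a, x])\<close>.
\<close>

lemma emeasure_le_lborel_of_intervals:
  fixes \<mu> :: "real measure" and a b C :: real
  assumes fin: "finite_measure \<mu>" and sets_\<mu>: "sets \<mu> = sets borel" and C: "C \<ge> 0" and ab: "a < b"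
    and le: "\<And>u v. a \<le> u \<Longrightarrow> u < v \<Longrightarrow> v \<le> b \<Longrightarrow> measure \<mu> {u<..v} \<le> C * (v - u)"
    and A: "A \<in> sets borel" "A \<subseteq> {a<..b}"
  shows "emeasure \<mu> A \<le> ennreal C * emeasure lborel A"
proof -
  interpret finite_measure \<mu> by (rule fin)
  note [measurable_cong] = sets_\<mu>
  \<comment> \<open>\<open>interval_measure\<close> wants a function on the whole line; clamping
    makes \<open>G\<close> constant outside [a, b].\<close>
  define cl where "cl = (\<lambda>x. max a (min x b))"
  define m where "m = (\<lambda>x. measure \<mu> {a<..cl x})"
  define G where "G = (\<lambda>x. C * cl x - m x)"
  have cl: "a \<le> cl x" "cl x \<le> b" for x using ab by (auto simp: cl_def)
  have clm: "x \<le> y \<Longrightarrow> cl x \<le> cl y" for x y by (auto simp: cl_def)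
  have md: "m y - m x = measure \<mu> {cl x<..cl y}" if "x \<le> y" for x y
  proof -
    have eq: "{a<..cl y} = {a<..cl x} \<union> {cl x<..cl y}" using cl(1)[of x] clm[OF that] by auto
    have "measure \<mu> ({a<..cl x} \<union> {cl x<..cl y}) = measure \<mu> {a<..cl x} + measure \<mu> {cl x<..cl y}"
      by (rule finite_measure_Union) (auto simp: sets_\<mu>)
    then show ?thesis by (simp add: m_def eq)
  qed
  have mb: "measure \<mu> {cl x<..cl y} \<le> C * (cl y - cl x)" if "x \<le> y" for x y
    using le[OF cl(1) _ cl(2), of x y] clm[OF that] by (cases "cl x = cl y") auto
  have Gd: "G y - G x = C * (cl y - cl x) - measure \<mu> {cl x<..cl y}" if "x \<le> y" for x y
    using md[OF that] by (simp add: G_def algebra_simps)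
  have Gmono: "G x \<le> G y" if "x \<le> y" for x y using Gd[OF that] mb[OF that] by linarith
  \<comment> \<open>Subtracting \<mu> can only slow the growth down. Together with monotonicity this
    squeezes \<open>G\<close> to its value at x from the right.\<close>
  have Gb: "G y - G x \<le> C * (y - x)" if "x \<le> y" for x y
  proof -
    have "C * (cl y - cl x) \<le> C * (y - x)" using that C by (intro mult_left_mono) (auto simp: cl_def)
    then show ?thesis using Gd[OF that] measure_nonneg[of \<mu> "{cl x<..cl y}"] by linarith
  qed
  have Gcont: "continuous (at_right x) G" for x
    unfolding continuous_within
  proof (rule tendsto_sandwich)
    show "\<forall>\<^sub>F y in at_right x. G x \<le> G y" unfolding eventually_at_right_field using Gmono by (intro exI[of _ "x + 1"]) auto
    show "\<forall>\<^sub>F y in at_right x. G y \<le> G x + C * (y - x)"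
    proof -
      have "G y \<le> G x + C * (y - x)" if "x \<le> y" for y using Gb[OF that] by linarith
      then show ?thesis unfolding eventually_at_right_field by (intro exI[of _ "x + 1"]) auto
    qed
    show "((\<lambda>y. G x + C * (y - x)) \<longlongrightarrow> G x) (at_right x)"
      by (rule tendsto_eq_intros | simp)+
  qed simp
  define \<nu> where "\<nu> = interval_measure G"
  have sets_\<nu>: "sets \<nu> = sets borel" by (simp add: \<nu>_def)
  have \<nu>I: "emeasure \<nu> {x<..y} = ennreal (G y - G x)" if "x \<le> y" for x y
    unfolding \<nu>_def by (rule emeasure_interval_measure_Ioc[OF that Gmono Gcont])
  let ?J = "{a<..b}"
  have \<nu>J: "emeasure \<nu> ?J \<noteq> \<infinity>" using \<nu>I[of a b] ab by simp
  have lJ: "emeasure lborel ?J \<noteq> \<infinity>" using ab by simp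
  have f\<nu>: "emeasure \<nu> (S \<inter> ?J) \<noteq> \<infinity>" and fl: "emeasure lborel (S \<inter> ?J) \<noteq> \<infinity>" if "S \<in> sets borel" for S
    using emeasure_mono[of "S \<inter> ?J" ?J \<nu>] emeasure_mono[of "S \<inter> ?J" ?J lborel] \<nu>J lJ sets_\<nu> by (auto simp: top_unique)
  \<comment> \<open>\<mu> + \<nu> = C times Lebesgue measure inside \<open>?J\<close>: true on
    half-open intervals by construction and extended to Borel sets by the Dynkin argument.
    Restriction to \<open>?J\<close> makes all three measures finite, so complements may be
    subtracted in the reals. The claim follows as \<nu> is nonnegative.\<close>
  have key: "measure \<mu> (S \<inter> ?J) + measure \<nu> (S \<inter> ?J) = C * measure lborel (S \<inter> ?J)" if "S \<in> sets borel" for S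
  proof -
    have bs: "sets (borel :: real measure) = sigma_sets UNIV (range (\<lambda>(i, j). {i<..j::real}))"
      by (subst borel_sigma_sets_Ioc) (rule sets_measure_of, simp)
    have sb: "S \<in> sigma_sets UNIV (range (\<lambda>(i, j). {i<..j})) \<Longrightarrow> S \<in> sets borel" for S :: "real set" by (simp add: bs)
    have ist: "Int_stable (range (\<lambda>(i, j). {i<..j::real}))"
    proof (rule Int_stableI)
      fix A B assume "A \<in> range (\<lambda>(i, j). {i<..j::real})" "B \<in> range (\<lambda>(i, j). {i<..j::real})"
      then obtain i j k l where "A = {i<..j}" "B = {k<..l}" by auto
      then have "A \<inter> B = {max i k<..min j l}" by auto
      then show "A \<inter> B \<in> range (\<lambda>(i, j). {i<..j::real})" by (auto intro: range_eqI[of _ _ "(max i k, min j l)"])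
    qed
    have base: "measure \<mu> ({i<..j} \<inter> ?J) + measure \<nu> ({i<..j} \<inter> ?J) = C * measure lborel ({i<..j} \<inter> ?J)" for i j
    proof -
      have eq: "{i<..j} \<inter> ?J = {max i a<..min j b}" by auto
      show ?thesis
      proof (cases "max i a \<le> min j b")
        case True
        let ?x = "max i a" and ?y = "min j b"
        have c: "cl ?x = ?x" "cl ?y = ?y" using True by (auto simp: cl_def)
        have "measure \<nu> {?x<..?y} = G ?y - G ?x" using \<nu>I[OF True] Gmono[OF True] by (simp add: measure_def)
        also have "\<dots> = C * (?y - ?x) - measure \<mu> {?x<..?y}" using Gd[OF True] c by simp
        finally show ?thesis unfolding eq using True by (simp add: measure_def)
      next
        case False
        then have empty: "{max i a<..min j b} = {}" by auto
        show ?thesis unfolding eq empty by simp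
      qed
    qed
    have sub: "range (\<lambda>(i, j). {i<..j::real}) \<subseteq> Pow UNIV" by simp
    from ist sub that[unfolded bs] show ?thesis
    proof (induction rule: sigma_sets_induct_disjoint)
      case (basic A)
      then show ?case using base by auto
    next
      case (compl A)
      have Ab: "A \<in> sets borel" using compl sb by blast
      have eq: "(UNIV - A) \<inter> ?J = ?J - A \<inter> ?J" by auto
      have 1: "measure \<mu> (?J - A \<inter> ?J) = measure \<mu> ?J - measure \<mu> (A \<inter> ?J)"
        using Ab by (intro measure_Diff) (auto simp: sets_\<mu>)
      have 2: "measure \<nu> (?J - A \<inter> ?J) = measure \<nu> ?J - measure \<nu> (A \<inter> ?J)"
        using Ab \<nu>J by (intro measure_Diff) (auto simp: sets_\<nu>)
      have 3: "measure lborel (?J - A \<inter> ?J) = measure lborel ?J - measure lborel (A \<inter> ?J)"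
        using Ab lJ by (intro measure_Diff) auto
      have "measure \<mu> ?J + measure \<nu> ?J = C * measure lborel ?J" using base[of a b] by simp
      then show ?case unfolding eq 1 2 3 right_diff_distrib using compl by linarith
    next
      case (union A)
      have Ab: "A i \<in> sets borel" for i using union sb by auto
      have eq: "\<Union>(range A) \<inter> ?J = (\<Union>i. A i \<inter> ?J)" by auto
      have dis: "disjoint_family (\<lambda>i. A i \<inter> ?J)" using union(1) by (auto simp: disjoint_family_on_def)
      have Ub: "\<Union>(range A) \<in> sets borel" using Ab by auto
      have 1: "(\<lambda>i. measure \<mu> (A i \<inter> ?J)) sums measure \<mu> (\<Union>i. A i \<inter> ?J)"
        using Ab dis by (intro measure_UNION) (auto simp: sets_\<mu>)
      have 2: "(\<lambda>i. measure \<nu> (A i \<inter> ?J)) sums measure \<nu> (\<Union>i. A i \<inter> ?J)"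
        using Ab by (intro measure_UNION dis f\<nu>[OF Ub, unfolded eq]) (auto simp: sets_\<nu>)
      have 3: "(\<lambda>i. measure lborel (A i \<inter> ?J)) sums measure lborel (\<Union>i. A i \<inter> ?J)"
        using Ab by (intro measure_UNION dis fl[OF Ub, unfolded eq]) auto
      from sums_add[OF 1 2] sums_mult[OF 3, of C] union(3)
      show ?case unfolding eq by (simp add: sums_iff)
    qed simp
  qed
  have AJ: "A \<inter> ?J = A" using A(2) by auto
  have "measure \<mu> A \<le> C * measure lborel A"
    using key[OF A(1)] measure_nonneg[of \<nu> "A \<inter> ?J"] unfolding AJ by linarith
  then have "ennreal (measure \<mu> A) \<le> ennreal (C * measure lborel A)" by (rule ennreal_leI)
  also have "\<dots> = ennreal C * ennreal (measure lborel A)" using C by (simp add: ennreal_mult)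
  finally show ?thesis
    using fl[OF A(1)] unfolding AJ by (simp add: emeasure_eq_measure emeasure_eq_ennreal_measure)
qed

text \<open>The Radon-Nikodym derivative obeys the bounds only almost everywhere. Capping it by the
  local constant changes it on a null set and makes the bound hold at every point, as local
  boundedness requires.\<close>

lemma locally_bounded_density:
  fixes \<mu> :: "real measure" and C :: "nat \<Rightarrow> real"
  assumes sets_\<mu>: "sets \<mu> = sets borel" and C: "\<And>n. C n \<ge> 0"
    and le: "\<And>n A. A \<in> sets borel \<Longrightarrow> A \<subseteq> {- real (Suc n)<..real (Suc n)} \<Longrightarrow> emeasure \<mu> A \<le> ennreal (C n) * emeasure lborel A"
  shows "\<exists>f :: real \<Rightarrow> real. f \<in> borel_measurable borel \<and> (\<forall>x. 0 \<le> f x) \<and> locally_bounded f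
    \<and> \<mu> = density lborel (\<lambda>x. ennreal (f x))"
proof -
  \<comment> \<open>The window of index n reaches to n + 1. The spare unit puts -n into the window,
    which is open on the left, so x always lies in the window whose index is \<bar>x\<bar> rounded
    up.\<close>
  let ?J = "\<lambda>n. {- real (Suc n)<..real (Suc n)}"
  have cover: "x \<in> ?J (nat \<lceil>\<bar>x\<bar>\<rceil>)" for x
  proof -
    have "\<bar>x\<bar> \<le> real (nat \<lceil>\<bar>x\<bar>\<rceil>)" by (rule real_nat_ceiling_ge)
    moreover have "real (Suc (nat \<lceil>\<bar>x\<bar>\<rceil>)) = real (nat \<lceil>\<bar>x\<bar>\<rceil>) + 1" by (rule of_nat_Suc[THEN trans]) simp
    ultimately have "\<bar>x\<bar> < real (Suc (nat \<lceil>\<bar>x\<bar>\<rceil>))" by linarith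
    then show ?thesis unfolding greaterThanAtMost_iff by linarith
  qed
  have ac: "absolutely_continuous lborel \<mu>"
    unfolding absolutely_continuous_def
  proof (rule subsetI)
    fix N :: "real set" assume N: "N \<in> null_sets lborel"
    have "N \<inter> ?J n \<in> null_sets \<mu>" for n
    proof -
      have "emeasure lborel (N \<inter> ?J n) = 0" by (rule emeasure_eq_0[of N]) (use N in \<open>auto simp: null_sets_def\<close>)
      moreover have "N \<inter> ?J n \<in> sets borel" using N by auto
      ultimately have "emeasure \<mu> (N \<inter> ?J n) \<le> 0" using le[of "N \<inter> ?J n" n] by simp
      then show ?thesis using \<open>N \<inter> ?J n \<in> sets borel\<close> by (auto simp: null_sets_def sets_\<mu>)
    qed
    then have "(\<Union>n. N \<inter> ?J n) \<in> null_sets \<mu>" by (intro null_sets_UN) auto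
    moreover have "(\<Union>n. N \<inter> ?J n) = N" using cover by blast
    ultimately show "N \<in> null_sets \<mu>" by simp
  qed
  define D where "D = RN_deriv lborel \<mu>"
  have D: "D \<in> borel_measurable borel" using borel_measurable_RN_deriv[of lborel \<mu>] by (simp add: D_def)
  have dens: "density lborel D = \<mu>"
    unfolding D_def by (rule sigma_finite_measure.density_RN_deriv[OF sigma_finite_lborel ac]) (simp add: sets_\<mu>)
  have bound: "AE x in lborel. x \<in> ?J n \<longrightarrow> D x \<le> ennreal (C n)" for n
  proof -
    \<comment> \<open>The set where the bound fails. The excess of \<open>D\<close> over
      \<open>C n\<close> is positive on it but has integral 0, so the set is null.\<close>
    define A where "A = {x \<in> ?J n. D x > ennreal (C n)}"
    have A: "A \<in> sets borel" unfolding A_def using D by measurable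
    have "emeasure lborel A \<le> emeasure lborel (?J n)" by (rule emeasure_mono) (auto simp: A_def)
    also have "\<dots> < \<infinity>" by simp
    finally have fA: "emeasure lborel A \<noteq> \<infinity>" by simp
    have "(\<integral>\<^sup>+x\<in>A. D x \<partial>lborel) = emeasure \<mu> A"
      using A D by (subst dens[symmetric]) (simp add: emeasure_density)
    also have "\<dots> \<le> ennreal (C n) * emeasure lborel A" by (rule le[OF A]) (auto simp: A_def)
    also have "\<dots> = (\<integral>\<^sup>+x\<in>A. ennreal (C n) \<partial>lborel)" using A by (simp add: nn_integral_cmult_indicator)
    finally have i: "(\<integral>\<^sup>+x\<in>A. D x \<partial>lborel) \<le> (\<integral>\<^sup>+x\<in>A. ennreal (C n) \<partial>lborel)" .
    have fi: "(\<integral>\<^sup>+x\<in>A. ennreal (C n) \<partial>lborel) \<noteq> \<infinity>"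
      using A fA by (simp add: nn_integral_cmult_indicator ennreal_mult_eq_top_iff)
    have "(\<integral>\<^sup>+x. D x * indicator A x - ennreal (C n) * indicator A x \<partial>lborel)
        = (\<integral>\<^sup>+x\<in>A. D x \<partial>lborel) - (\<integral>\<^sup>+x\<in>A. ennreal (C n) \<partial>lborel)"
      by (rule nn_integral_diff) (use A D fi in \<open>auto simp: A_def indicator_def\<close>)
    also have "\<dots> = 0" using i fi by (simp add: diff_eq_0_iff_ennreal less_top)
    finally have "AE x in lborel. D x * indicator A x - ennreal (C n) * indicator A x = 0"
      using A D by (subst (asm) nn_integral_0_iff_AE) auto
    then show ?thesis
    proof eventually_elim
      case (elim x)
      show ?case
      proof (rule impI, rule ccontr)
        assume "x \<in> ?J n" "\<not> D x \<le> ennreal (C n)"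
        then have "x \<in> A" "ennreal (C n) < D x" by (auto simp: A_def)
        then have "D x - ennreal (C n) = 0" using elim by simp
        then show False using \<open>ennreal (C n) < D x\<close> by (auto simp: diff_eq_0_iff_ennreal)
      qed
    qed
  qed
  \<comment> \<open>\<open>enn2real\<close> would turn infinite values of \<open>D\<close> into 0,
    but they only occur on a null set.\<close>
  define f where "f = (\<lambda>x. min (enn2real (D x)) (C (nat \<lceil>\<bar>x\<bar>\<rceil>)))"
  show ?thesis
  proof (intro exI[of _ f] conjI allI)
    have "(\<lambda>x :: real. C (nat \<lceil>\<bar>x\<bar>\<rceil>)) \<in> borel_measurable borel"
      by (rule measurable_compose[of _ _ "count_space UNIV"]) measurable
    then show fm: "f \<in> borel_measurable borel" unfolding f_def using D by measurable
    show "0 \<le> f x" for x using C by (simp add: f_def)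
    show "locally_bounded f"
      unfolding locally_bounded_def
    proof (intro allI exI[of _ 1] conjI)
      fix x :: real
      let ?N = "nat \<lceil>\<bar>x\<bar> + 1\<rceil>"
      show "bounded (f ` cball x 1)"
        unfolding bounded_iff
      proof (intro exI ballI)
        fix z assume "z \<in> f ` cball x 1"
        then obtain y where "y \<in> cball x 1" and z: "z = f y" by blast
        then have y: "\<bar>y\<bar> \<le> \<bar>x\<bar> + 1" by (auto simp: dist_real_def)
        have "nat \<lceil>\<bar>y\<bar>\<rceil> \<le> ?N" using y by (intro nat_mono ceiling_mono)
        \<comment> \<open>The constants \<open>C\<close> need not be monotone, so their sum up to
          the largest index near x serves as the common bound.\<close>
        then have "C (nat \<lceil>\<bar>y\<bar>\<rceil>) \<le> (\<Sum>k\<le>?N. C k)" using C by (intro member_le_sum) auto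
        moreover have "f y \<le> C (nat \<lceil>\<bar>y\<bar>\<rceil>)" "0 \<le> f y" unfolding f_def using C by auto
        ultimately show "norm z \<le> (\<Sum>k\<le>?N. C k)" unfolding z by simp
      qed
    qed simp
    have "AE x in lborel. \<forall>n. x \<in> ?J n \<longrightarrow> D x \<le> ennreal (C n)" using bound by (subst AE_all_countable) auto
    then have "AE x in lborel. D x = ennreal (f x)"
    proof eventually_elim
      case (elim x)
      then have "D x \<le> ennreal (C (nat \<lceil>\<bar>x\<bar>\<rceil>))" using cover by blast
      moreover from this have "D x < \<top>" by (rule le_less_trans) simp
      moreover have "enn2real (D x) \<le> C (nat \<lceil>\<bar>x\<bar>\<rceil>)"
        using enn2real_mono[OF calculation(1)] C by simp
      ultimately show ?case by (simp add: f_def min_absorb1)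
    qed
    then have "density lborel D = density lborel (\<lambda>x. ennreal (f x))"
      using D fm by (intro density_cong) auto
    then show "\<mu> = density lborel (\<lambda>x. ennreal (f x))" using dens by simp
  qed
qed

theorem corollary2p6:
  fixes P :: "'a measure" and F :: "real \<Rightarrow> 'a measure"
    and W Y :: "real \<Rightarrow> 'a \<Rightarrow> real"
    and b \<sigma> :: "real \<Rightarrow> real" and y0 t :: real
  assumes basis: "stochastic_basis P F"
    and W: "brownian_motion P F W"
    and \<sigma>_pos: "\<And>y. \<sigma> y > 0"
    and b_meas: "b \<in> borel_measurable borel"
    and b_bdd: "locally_bounded b"
    and \<sigma>_lip: "locally_lipschitz \<sigma>"
    and Y: "ito_process P F W y0 (\<lambda>s \<omega>. b (Y s \<omega>)) (\<lambda>s \<omega>. \<sigma> (Y s \<omega>)) Y"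
    and t: "t > 0"
  shows "\<exists>f :: real \<Rightarrow> real. (\<forall>x. 0 \<le> f x) \<and> locally_bounded f \<and>
    distributed P lborel (Y t) (\<lambda>x. ennreal (f x))"
proof -
  interpret brownian_basis P F W
    by (intro brownian_basis.intro basis brownian_basis_axioms.intro W)
  \<comment> \<open>\<open>ito_process\<close> ties \<open>Y s\<close> to measurable quantities only
    through an almost sure identity; completeness of P then makes \<open>Y s\<close> itself
    measurable.\<close>
  have Ym: "Y s \<in> borel_measurable P" if s: "0 \<le> s" for s
  proof -
    have prog: "progressively_measurable F (\<lambda>s \<omega>. b (Y s \<omega>))" using Y by (simp add: ito_process_def)
    obtain X where X: "adapted F X"
      and YX: "AE \<omega> in P. \<forall>t\<ge>0. Y t \<omega> = y0 + (LINT s:{0..t}|lborel. b (Y s \<omega>)) + X t \<omega>"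
      using Y by (auto simp: ito_process_def ito_integral_def)
    have "(\<lambda>\<omega>. LINT r:{0..s}|lborel. indicat_real {0..s} r * b (Y r \<omega>)) \<in> borel_measurable P"
      using measurable_F_imp[OF s progressive_integral[OF prog s, of "\<lambda>x. x" s]] by simp
    also have "(\<lambda>\<omega>. LINT r:{0..s}|lborel. indicat_real {0..s} r * b (Y r \<omega>)) = (\<lambda>\<omega>. LINT r:{0..s}|lborel. b (Y r \<omega>))"
      by (intro ext set_lebesgue_integral_cong) auto
    finally have [measurable]: "(\<lambda>\<omega>. LINT r:{0..s}|lborel. b (Y r \<omega>)) \<in> borel_measurable P" .
    have [measurable]: "X s \<in> borel_measurable P" using X s measurable_F_imp by (auto simp: adapted_def)
    have "(\<lambda>\<omega>. y0 + (LINT r:{0..s}|lborel. b (Y r \<omega>)) + X s \<omega>) \<in> borel_measurable P" by measurable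
    then show ?thesis
      by (rule borel_measurable_AE_eq) (use YX in eventually_elim, use s in auto)
  qed
  have Yt[measurable]: "Y t \<in> borel_measurable P" using Ym t by simp
  define \<mu> where "\<mu> = distr P borel (Y t)"
  have fin: "finite_measure \<mu>" unfolding \<mu>_def by (rule finite_measure_distr[OF Yt])
  have sets_\<mu>: "sets \<mu> = sets borel" by (simp add: \<mu>_def)
  have "\<exists>C\<ge>0. \<forall>u v. - real (Suc n) \<le> u \<longrightarrow> u < v \<longrightarrow> v \<le> real (Suc n) \<longrightarrow> prob {\<omega> \<in> space P. Y t \<omega> \<in> {u..v}} \<le> C * (v - u)" for n
    by (rule interval_probability_bound[OF \<sigma>_pos b_bdd \<sigma>_lip Y Ym, of "real (Suc n)" t]) (use t in auto)
  then obtain C where C: "\<And>n. C n \<ge> 0"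
    and prob: "\<And>n u v. - real (Suc n) \<le> u \<Longrightarrow> u < v \<Longrightarrow> v \<le> real (Suc n) \<Longrightarrow> prob {\<omega> \<in> space P. Y t \<omega> \<in> {u..v}} \<le> C n * (v - u)"
    by metis
  have le: "emeasure \<mu> A \<le> ennreal (C n) * emeasure lborel A"
    if A: "A \<in> sets borel" "A \<subseteq> {- real (Suc n)<..real (Suc n)}" for n A
  proof (rule emeasure_le_lborel_of_intervals[OF fin sets_\<mu> C _ _ A])
    fix u v assume uv: "- real (Suc n) \<le> u" "u < v" "v \<le> real (Suc n)"
    have "measure \<mu> {u<..v} = prob {\<omega> \<in> space P. Y t \<omega> \<in> {u<..v}}"
      unfolding \<mu>_def by (subst measure_distr) (auto intro!: arg_cong[where f = prob])
    also have "\<dots> \<le> prob {\<omega> \<in> space P. Y t \<omega> \<in> {u..v}}"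
      by (rule finite_measure_mono) auto
    also have "\<dots> \<le> C n * (v - u)" by (rule prob[OF uv])
    finally show "measure \<mu> {u<..v} \<le> C n * (v - u)" .
  qed simp
  obtain f :: "real \<Rightarrow> real" where f: "f \<in> borel_measurable borel" "\<forall>x. 0 \<le> f x" "locally_bounded f" "\<mu> = density lborel (\<lambda>x. ennreal (f x))"
    using locally_bounded_density[where C = C, OF sets_\<mu> C le] by blast
  have "distr P lborel (Y t) = \<mu>" unfolding \<mu>_def by (rule distr_cong) auto
  then have "distributed P lborel (Y t) (\<lambda>x. ennreal (f x))"
    unfolding distributed_def using f by auto
  with f(2,3) show ?thesis by blast
qed

end
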